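(* Let $n,m\in\mathbb{Z}_{\ge 0}$, $d\ge 1$, and let $M,N$ be $\mathfrak{gl}(n|m)$-(super)modules in the category $\mathcal{O}$, and $V$ the natural module. Let $\mathcal{G}_d$ be the degenerate two boundary braid algebra (defined in the context). There is a well-defined algebra homomorphism $$\rho:\mathcal{G}_d\to \operatorname{End}_{\mathfrak{gl}(n|m)}(M\otimes N\otimes V^{\otimes d})$$ given on generators by $$t_i\mapsto 1_M\otimes 1_N\otimes 1_V^{\otimes (i-1)}\otimes\sigma\otimes 1_V^{\otimes (d-i-1)}\quad(1\le i\le d-1),$$ $$x_i\mapsto \tfrac12(\kappa_{M,i}-\kappa_{M,i-1}),\qquad y_i\mapsto \tfrac12(\kappa_{N,i}-\kappa_{N,i-1}),\qquad z_i\mapsto\tfrac12(\kappa_{M\otimes N,i}-\kappa_{M\otimes N,i-1}+\kappa_V)\quad(1\le i\le d),$$ $$z_0\mapsto \tfrac12(\kappa_{M\otimes N}-\kappa_M-\kappa_N),$$ where $\sigma$ is the signed swap on $V\otimes V$, $\sigma(v\otimes w)=(-1)^{\overline v\cdot\overline w}\,w\otimes v$ for homogeneous $v,w\in V$.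
   Context: Everything is over $\mathbb{C}$; modules are supermodules. For $1\le i\le n+m$ put $\overline i=\overline 0$ if $i\le n$ and $\overline i=\overline 1$ if $i>n$. $\mathfrak g=\mathfrak{gl}(n|m)$ is the Lie superalgebra of $(n+m)\times(n+m)$ matrices, the matrix unit $E_{ij}$ having parity $\overline i+\overline j$, with bracket $[x,y]=xy-(-1)^{\overline x\,\overline y}yx$ on homogeneous elements. $V$ is the space of column vectors with basis $e_1,\dots,e_{n+m}$, $e_i$ of parity $\overline i$, with $\mathfrak g$ acting by matrix multiplication. Tensor products of modules use the comultiplication $\Delta(x)=x\otimes 1+1\otimes x$ ($x\in\mathfrak g$) with the usual super sign rule: moving a homogeneous operator $x$ past a homogeneous vector $v$ gives the sign $(-1)^{\overline x\,\overline v}$. Category $\mathcal O$ is taken with respect to the diagonal Cartan subalgebra $\mathfrak h$ and the upper triangular Borel subalgebra. The Casimir element is $\kappa=\sum_{i,j=1}^{n+m}(-1)^{\overline j}E_{ij}E_{ji}\in U(\mathfrak g)$, which is central. $\kappa_V$ is the scalar by which $\kappa$ acts on $V$. As operators on $M\otimes N\otimes V^{\otimes d}$: $\kappa_M$ (resp. $\kappa_N$, $\kappa_{M\otimes N}$) is the action of $\kappa$ on the factor $M$ (resp. on the factor $N$, on the $\mathfrak g$-module $M\otimes N$), identity on the other factors; for $0\le i\le d$, $\kappa_{M,i}$ (resp. $\kappa_{N,i}$, $\kappa_{M\otimes N,i}$) is the action of $\kappa$, via iterated comultiplication, on the tensor product of $M$ (resp. $N$, $M\otimes N$) with the first $i$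 copies of $V$, identity on the remaining factors (with super signs for elements passing over skipped factors). Thus $\kappa_{M,0}=\kappa_M$, etc. The degenerate two boundary braid algebra $\mathcal G_d$ is the associative unital $\mathbb C$-algebra generated by the polynomial rings $\mathbb C[x_1,\dots,x_d]$, $\mathbb C[y_1,\dots,y_d]$, $\mathbb C[z_0,\dots,z_d]$ and the group algebra $\mathbb C\Sigma_d$ of the symmetric group (with simple transpositions $t_1,\dots,t_{d-1}$), subject to the following relations: (R1) $x_it_j=t_jx_i$, $y_it_j=t_jy_i$, $z_it_j=t_jz_i$ whenever $i\ne j,j+1$; (R2) $(z_0+\cdots+z_i)x_j=x_j(z_0+\cdots+z_i)$ and $(z_0+\cdots+z_i)y_j=y_j(z_0+\cdots+z_i)$ for $i\ge j$; (R3) $t_i(x_i+x_{i+1})=(x_i+x_{i+1})t_i$ and $t_i(y_i+y_{i+1})=(y_i+y_{i+1})t_i$ for $1\le i\le d-1$; (R4) $t_it_{i+1}(x_{i+1}-t_ix_it_i)t_{i+1}t_i=x_{i+2}-t_{i+1}x_{i+1}t_{i+1}$ and $t_it_{i+1}(y_{i+1}-t_iy_it_i)t_{i+1}t_i=y_{i+2}-t_{i+1}y_{i+1}t_{i+1}$ for $1\le i\le d-2$; (R5) $x_{i+1}-t_ix_it_i=y_{i+1}-t_iy_it_i$ for $1\le i\le d-1$; (R6) $z_i=x_i+y_i-m_i$ for $1\le i\le d$. Here $m_j=\sum_{i=1}^{j-1}m_{i,j}$ (so $m_1=0$), $m_{i,i+1}=x_{i+1}-t_ix_it_i$, and $m_{i,j}=t_{(i\,j-1)}m_{j-1,j}t_{(i\,j-1)}$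 for $j>i+1$, where $t_{(i\,j)}\in\Sigma_d$ is the transposition interchanging $i$ and $j$. *)

theory Defs
  imports
    Complex_Main
    "HOL-Library.Poly_Mapping"
    "HOL-Library.FuncSet"
    "HOL-Library.Z2"
    "HOL-Combinatorics.Permutations"
    "HOL-Algebra.QuotRing"
    "Jordan_Normal_Form.Matrix"
begin

hide_const (open) Multiset.mult

section \<open>Signs and the Lie superalgebra gl(n|m)\<close>

text \<open>
  Matrix and vector indices run from 0 to n + m - 1, as in Jordan_Normal_Form.
  Parities are elements of the field with two elements.
\<close>

definition ksgn :: "bit \<Rightarrow> complex" where
  "ksgn p = (if p = 0 then 1 else - 1)"

definition idx_parity :: "nat \<Rightarrow> nat \<Rightarrow> bit" where
  "idx_parity n i = (if i < n then 0 else 1)"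

definition gl_carrier :: "nat \<Rightarrow> nat \<Rightarrow> complex mat set" where
  "gl_carrier n m = carrier_mat (n + m) (n + m)"

definition gl_part :: "nat \<Rightarrow> nat \<Rightarrow> bit \<Rightarrow> complex mat set" where
  "gl_part n m p = {x \<in> gl_carrier n m.
     \<forall>i<n + m. \<forall>j<n + m. idx_parity n i + idx_parity n j \<noteq> p \<longrightarrow> x $$ (i, j) = 0}"

definition unit_mat :: "nat \<Rightarrow> nat \<Rightarrow> nat \<Rightarrow> complex mat" where
  "unit_mat k i j = mat k k (\<lambda>(a, b). if a = i \<and> b = j then 1 else 0)"

text \<open>The bracket of a homogeneous x of parity p with a homogeneous y of parity q.\<close>

definition sbracket :: "bit \<Rightarrow> bit \<Rightarrow> complex mat \<Rightarrow> complex mat \<Rightarrow> complex mat" where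
  "sbracket p q x y = x * y - ksgn (p * q) \<cdot>\<^sub>m (y * x)"

definition cartan :: "nat \<Rightarrow> nat \<Rightarrow> complex mat set" where
  "cartan n m = {h \<in> gl_carrier n m. diagonal_mat h}"

definition borel :: "nat \<Rightarrow> nat \<Rightarrow> complex mat set" where
  "borel n m = {x \<in> gl_carrier n m. upper_triangular x}"


section \<open>Supermodules and category O\<close>

record 'a gl_smod =
  sscale :: "complex \<Rightarrow> 'a \<Rightarrow> 'a"
  spart :: "bit \<Rightarrow> 'a set"
  sact :: "complex mat \<Rightarrow> 'a \<Rightarrow> 'a"

text \<open>The underlying vector space is a whole type; sact is only meaningful on gl_carrier.\<close>

locale gl_supermodule = vector_space "sscale M"
  for n m :: nat and M :: "'a::ab_group_add gl_smod" +
  assumes part_subspace: "subspace (spart M p)"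
    and part_disjoint: "spart M 0 \<inter> spart M 1 = {0}"
    and part_sum: "\<exists>v0\<in>spart M 0. \<exists>v1\<in>spart M 1. v = v0 + v1"
    and act_linear: "x \<in> gl_carrier n m \<Longrightarrow> Vector_Spaces.linear (sscale M) (sscale M) (sact M x)"
    and act_add: "\<lbrakk>x \<in> gl_carrier n m; y \<in> gl_carrier n m\<rbrakk>
      \<Longrightarrow> sact M (x + y) v = sact M x v + sact M y v"
    and act_smult: "x \<in> gl_carrier n m \<Longrightarrow> sact M (c \<cdot>\<^sub>m x) v = sscale M c (sact M x v)"
    and act_parity: "\<lbrakk>x \<in> gl_part n m p; v \<in> spart M q\<rbrakk> \<Longrightarrow> sact M x v \<in> spart M (p + q)"
    and act_bracket: "\<lbrakk>x \<in> gl_part n m p; y \<in> gl_part n m q\<rbrakk>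
      \<Longrightarrow> sact M (sbracket p q x y) v
        = sact M x (sact M y v) - sscale M (ksgn (p * q)) (sact M y (sact M x v))"

definition weight_space ::
    "nat \<Rightarrow> nat \<Rightarrow> 'a::ab_group_add gl_smod \<Rightarrow> (complex mat \<Rightarrow> complex) \<Rightarrow> 'a set" where
  "weight_space n m M l = {v. \<forall>h\<in>cartan n m. sact M h v = sscale M (l h) v}"

text \<open>
  Finitely generated, semisimple over the Cartan subalgebra, locally finite over the Borel
  subalgebra. The sum of the weight spaces is automatically direct. Weights are arbitrary
  functions here, since a nonzero weight vector forces linearity.
\<close>

definition category_O :: "nat \<Rightarrow> nat \<Rightarrow> 'a::ab_group_add gl_smod \<Rightarrow> bool" where
  "category_O n m M \<longleftrightarrow> gl_supermodule n m M
     \<and> (\<exists>S. finite S \<and> (\<forall>W. module.subspace (sscale M) W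
            \<and> (\<forall>x\<in>gl_carrier n m. sact M x ` W \<subseteq> W) \<and> S \<subseteq> W \<longrightarrow> W = UNIV))
     \<and> module.span (sscale M) (\<Union>l. weight_space n m M l) = UNIV
     \<and> (\<forall>v. \<exists>B. finite B \<and> v \<in> module.span (sscale M) B
            \<and> (\<forall>x\<in>borel n m. sact M x ` module.span (sscale M) B \<subseteq> module.span (sscale M) B))"

text \<open>The homogeneous component of parity p, and the operator sending v to (-1)^(q |v|) v.\<close>

definition hcomp :: "'a::ab_group_add gl_smod \<Rightarrow> bit \<Rightarrow> 'a \<Rightarrow> 'a" where
  "hcomp M p v = (THE w. w \<in> spart M p \<and> v - w \<in> spart M (p + 1))"

definition koszul :: "'a::ab_group_add gl_smod \<Rightarrow> bit \<Rightarrow> 'a \<Rightarrow> 'a" where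
  "koszul M q v = (\<Sum>p\<in>UNIV. sscale M (ksgn (q * p)) (hcomp M p v))"

text \<open>
  The same for the natural module V, the vectors of dimension n + m, on which matrices act
  by multiplication.
\<close>

definition vpart :: "nat \<Rightarrow> nat \<Rightarrow> bit \<Rightarrow> complex vec set" where
  "vpart n m p = {v \<in> carrier_vec (n + m). \<forall>i<n + m. idx_parity n i \<noteq> p \<longrightarrow> v $ i = 0}"

definition vcomp :: "nat \<Rightarrow> bit \<Rightarrow> complex vec \<Rightarrow> complex vec" where
  "vcomp n p v = vec (dim_vec v) (\<lambda>i. if idx_parity n i = p then v $ i else 0)"

definition vkoszul :: "nat \<Rightarrow> bit \<Rightarrow> complex vec \<Rightarrow> complex vec" where
  "vkoszul n q v = vec (dim_vec v) (\<lambda>i. ksgn (q * idx_parity n i) * v $ i)"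

text \<open>
  The scalar by which the Casimir element acts on V. (For n = m = 0 every scalar has the
  property, and all of them act on the zero space in the same way.)
\<close>

definition kappa_V :: "nat \<Rightarrow> nat \<Rightarrow> complex" where
  "kappa_V n m = (SOME c. \<forall>v\<in>carrier_vec (n + m).
     vec (n + m) (\<lambda>a. \<Sum>i<n + m. \<Sum>j<n + m. ksgn (idx_parity n j)
        * (unit_mat (n + m) i j *\<^sub>v (unit_mat (n + m) j i *\<^sub>v v)) $ a)
     = c \<cdot>\<^sub>v v)"


section \<open>Finitely supported functions\<close>

definition fscale :: "complex \<Rightarrow> ('g \<Rightarrow>\<^sub>0 complex) \<Rightarrow> ('g \<Rightarrow>\<^sub>0 complex)" where
  "fscale c f = Poly_Mapping.map ((*) c) f"

lemma fscale_lookup: "Poly_Mapping.lookup (fscale c f) g = c * Poly_Mapping.lookup f g"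
  by (simp add: fscale_def map.rep_eq when_def)

lemma vector_space_fscale: "vector_space fscale"
  by standard (auto intro!: poly_mapping_eqI simp: fscale_lookup lookup_add algebra_simps)

definition fbasis :: "'g \<Rightarrow> ('g \<Rightarrow>\<^sub>0 complex)" where
  "fbasis g = Poly_Mapping.single g 1"

text \<open>The linear extension of a map given on the basis.\<close>

definition flift :: "('g \<Rightarrow> ('h \<Rightarrow>\<^sub>0 complex)) \<Rightarrow> ('g \<Rightarrow>\<^sub>0 complex) \<Rightarrow> ('h \<Rightarrow>\<^sub>0 complex)" where
  "flift \<phi> f = (\<Sum>g\<in>Poly_Mapping.keys f. fscale (Poly_Mapping.lookup f g) (\<phi> g))"

definition free_module :: "'g set \<Rightarrow> (complex, 'g \<Rightarrow>\<^sub>0 complex) module" where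
  "free_module G = \<lparr>carrier = {f. Poly_Mapping.keys f \<subseteq> G}, mult = undefined, one = undefined,
     zero = 0, add = (+), smult = fscale\<rparr>"


section \<open>The tensor product of M, N and d copies of V\<close>

text \<open>
  The triple (u, w, vs) stands for the pure tensor of u, w and the entries of vs. The tensor
  product is the free vector space on such triples modulo the multilinearity relations;
  its elements are cosets.
\<close>

type_synonym ('a, 'b) pure = "'a \<times> 'b \<times> complex vec list"

text \<open>The tensor factors: M, N, and the k-th copy of V, counted from 1.\<close>

datatype slot = SlotM | SlotN | SlotV nat

definition MV_slots :: "nat \<Rightarrow> slot set" where
  "MV_slots i = {SlotM} \<union> SlotV ` {1..i}"

definition NV_slots :: "nat \<Rightarrow> slot set" where
  "NV_slots i = {SlotN} \<union> SlotV ` {1..i}"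

definition MNV_slots :: "nat \<Rightarrow> slot set" where
  "MNV_slots i = {SlotM, SlotN} \<union> SlotV ` {1..i}"

context
  fixes n m d :: nat
    and M :: "'a::ab_group_add gl_smod" and N :: "'b::ab_group_add gl_smod"
begin

definition pure_tensors :: "('a, 'b) pure set" where
  "pure_tensors = {(u, w, vs). length vs = d \<and> set vs \<subseteq> carrier_vec (n + m)}"

definition multilin_rels :: "(('a, 'b) pure \<Rightarrow>\<^sub>0 complex) set" where
  "multilin_rels =
     {fbasis (u + u', w, vs) - fbasis (u, w, vs) - fbasis (u', w, vs) | u u' w vs.
        (u, w, vs) \<in> pure_tensors}
   \<union> {fbasis (sscale M c u, w, vs) - fscale c (fbasis (u, w, vs)) | c u w vs.
        (u, w, vs) \<in> pure_tensors}
   \<union> {fbasis (u, w + w', vs) - fbasis (u, w, vs) - fbasis (u, w', vs) | u w w' vs.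
        (u, w, vs) \<in> pure_tensors}
   \<union> {fbasis (u, sscale N c w, vs) - fscale c (fbasis (u, w, vs)) | c u w vs.
        (u, w, vs) \<in> pure_tensors}
   \<union> {fbasis (u, w, vs[k := v + v']) - fbasis (u, w, vs[k := v]) - fbasis (u, w, vs[k := v'])
        | u w vs k v v'. (u, w, vs) \<in> pure_tensors \<and> k < d
          \<and> v \<in> carrier_vec (n + m) \<and> v' \<in> carrier_vec (n + m)}
   \<union> {fbasis (u, w, vs[k := c \<cdot>\<^sub>v v]) - fscale c (fbasis (u, w, vs[k := v]))
        | c u w vs k v. (u, w, vs) \<in> pure_tensors \<and> k < d \<and> v \<in> carrier_vec (n + m)}"

definition null_tensors :: "(('a, 'b) pure \<Rightarrow>\<^sub>0 complex) set" where
  "null_tensors = module.span fscale multilin_rels"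

definition tensor_class :: "(('a, 'b) pure \<Rightarrow>\<^sub>0 complex) \<Rightarrow> (('a, 'b) pure \<Rightarrow>\<^sub>0 complex) set" where
  "tensor_class f = null_tensors +>\<^bsub>free_module pure_tensors\<^esub> f"

definition tensor_space :: "(complex, (('a, 'b) pure \<Rightarrow>\<^sub>0 complex) set) module" where
  "tensor_space = \<lparr>carrier = a_rcosets\<^bsub>free_module pure_tensors\<^esub> null_tensors,
     mult = undefined, one = undefined, zero = null_tensors,
     add = set_add (free_module pure_tensors),
     smult = (\<lambda>c X. \<Union>f\<in>X. tensor_class (fscale c f))\<rparr>"

text \<open>The map of the quotient induced by a map of the free vector space.\<close>

definition induced ::
    "((('a, 'b) pure \<Rightarrow>\<^sub>0 complex) \<Rightarrow> (('a, 'b) pure \<Rightarrow>\<^sub>0 complex))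
      \<Rightarrow> (('a, 'b) pure \<Rightarrow>\<^sub>0 complex) set \<Rightarrow> (('a, 'b) pure \<Rightarrow>\<^sub>0 complex) set" where
  "induced F = (\<lambda>X\<in>carrier tensor_space. \<Union>f\<in>X. tensor_class (F f))"

definition tensor_part :: "bit \<Rightarrow> (('a, 'b) pure \<Rightarrow>\<^sub>0 complex) set set" where
  "tensor_part p = tensor_class ` module.span fscale
     {fbasis (u, w, vs) | u w vs. \<exists>a b ps. u \<in> spart M a \<and> w \<in> spart N b
        \<and> length vs = d \<and> length ps = d \<and> (\<forall>k<d. vs ! k \<in> vpart n m (ps ! k))
        \<and> p = a + b + sum_list ps}"

text \<open>
  An element x of parity p acting in one tensor factor: it passes over all factors to the
  left, each of which contributes the sign (-1)^(p |v|).
\<close>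

fun slot_act :: "bit \<Rightarrow> complex mat \<Rightarrow> slot \<Rightarrow> ('a, 'b) pure \<Rightarrow> ('a, 'b) pure" where
  "slot_act p x SlotM (u, w, vs) = (sact M x u, w, vs)"
| "slot_act p x SlotN (u, w, vs) = (koszul M p u, sact N x w, vs)"
| "slot_act p x (SlotV k) (u, w, vs) = (koszul M p u, koszul N p w,
     map (vkoszul n p) (take (k - 1) vs) @ [x *\<^sub>v (vs ! (k - 1))] @ drop k vs)"

text \<open>
  The action of x, via the iterated comultiplication, on the factors in S; the other factors
  are skipped.
\<close>

definition slots_act ::
    "slot set \<Rightarrow> bit \<Rightarrow> complex mat
      \<Rightarrow> (('a, 'b) pure \<Rightarrow>\<^sub>0 complex) \<Rightarrow> (('a, 'b) pure \<Rightarrow>\<^sub>0 complex)" where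
  "slots_act S p x f = (\<Sum>s\<in>S. flift (\<lambda>g. fbasis (slot_act p x s g)) f)"

definition tensor_act ::
    "bit \<Rightarrow> complex mat
      \<Rightarrow> (('a, 'b) pure \<Rightarrow>\<^sub>0 complex) set \<Rightarrow> (('a, 'b) pure \<Rightarrow>\<^sub>0 complex) set" where
  "tensor_act p x = induced (slots_act (MNV_slots d) p x)"

text \<open>The Casimir element acting on the factors in S.\<close>

definition casimir ::
    "slot set \<Rightarrow> (('a, 'b) pure \<Rightarrow>\<^sub>0 complex) set \<Rightarrow> (('a, 'b) pure \<Rightarrow>\<^sub>0 complex) set" where
  "casimir S = induced (\<lambda>f. \<Sum>i<n + m. \<Sum>j<n + m. fscale (ksgn (idx_parity n j))
     (slots_act S (idx_parity n i + idx_parity n j) (unit_mat (n + m) i j)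
       (slots_act S (idx_parity n j + idx_parity n i) (unit_mat (n + m) j i) f)))"

text \<open>The signed swap of the i-th and (i+1)-st copies of V, for i from 1 to d - 1.\<close>

definition signed_swap ::
    "nat \<Rightarrow> (('a, 'b) pure \<Rightarrow>\<^sub>0 complex) set \<Rightarrow> (('a, 'b) pure \<Rightarrow>\<^sub>0 complex) set" where
  "signed_swap i = induced (flift (\<lambda>(u, w, vs). \<Sum>p\<in>UNIV. \<Sum>q\<in>UNIV. fscale (ksgn (p * q))
     (fbasis (u, w, vs[i - 1 := vcomp n q (vs ! i), i := vcomp n p (vs ! (i - 1))]))))"

definition tensor_lin ::
    "((('a, 'b) pure \<Rightarrow>\<^sub>0 complex) set \<Rightarrow> (('a, 'b) pure \<Rightarrow>\<^sub>0 complex) set) set" where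
  "tensor_lin = {F \<in> carrier tensor_space \<rightarrow>\<^sub>E carrier tensor_space.
     (\<forall>X\<in>carrier tensor_space. \<forall>Y\<in>carrier tensor_space.
        F (X \<oplus>\<^bsub>tensor_space\<^esub> Y) = F X \<oplus>\<^bsub>tensor_space\<^esub> F Y)
   \<and> (\<forall>c. \<forall>X\<in>carrier tensor_space.
        F (c \<odot>\<^bsub>tensor_space\<^esub> X) = c \<odot>\<^bsub>tensor_space\<^esub> F X)}"

text \<open>Homogeneous g-endomorphisms of parity q, with the super sign rule.\<close>

definition tensor_hom_part ::
    "bit \<Rightarrow> ((('a, 'b) pure \<Rightarrow>\<^sub>0 complex) set \<Rightarrow> (('a, 'b) pure \<Rightarrow>\<^sub>0 complex) set) set" where
  "tensor_hom_part q = {F \<in> tensor_lin.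
     (\<forall>p. \<forall>X\<in>tensor_part p. F X \<in> tensor_part (p + q))
   \<and> (\<forall>p. \<forall>x\<in>gl_part n m p. \<forall>X\<in>carrier tensor_space.
        F (tensor_act p x X) = ksgn (p * q) \<odot>\<^bsub>tensor_space\<^esub> tensor_act p x (F X))}"

definition tensor_End ::
    "(complex, (('a, 'b) pure \<Rightarrow>\<^sub>0 complex) set \<Rightarrow> (('a, 'b) pure \<Rightarrow>\<^sub>0 complex) set) module" where
  "tensor_End = \<lparr>
     carrier = {\<lambda>X\<in>carrier tensor_space. F0 X \<oplus>\<^bsub>tensor_space\<^esub> F1 X | F0 F1.
        F0 \<in> tensor_hom_part 0 \<and> F1 \<in> tensor_hom_part 1},
     mult = (\<lambda>F G. compose (carrier tensor_space) F G),
     one = (\<lambda>X\<in>carrier tensor_space. X),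
     zero = (\<lambda>X\<in>carrier tensor_space. \<zero>\<^bsub>tensor_space\<^esub>),
     add = (\<lambda>F G. \<lambda>X\<in>carrier tensor_space. F X \<oplus>\<^bsub>tensor_space\<^esub> G X),
     smult = (\<lambda>c F. \<lambda>X\<in>carrier tensor_space. c \<odot>\<^bsub>tensor_space\<^esub> F X)\<rparr>"

end


section \<open>The degenerate two boundary braid algebra\<close>

text \<open>
  Words form the free monoid under concatenation, so that the finitely supported functions
  on words are the noncommutative polynomials.
\<close>

instantiation list :: (type) monoid_add
begin

definition zero_list :: "'a list" where "zero_list = []"

definition plus_list :: "'a list \<Rightarrow> 'a list \<Rightarrow> 'a list" where "plus_list = (@)"

instance
  by standard (simp_all add: zero_list_def plus_list_def)

end

text \<open>There is one generator for every permutation of {1..d}: they span the group algebra.\<close>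

datatype braid_gen = GenX nat | GenY nat | GenZ nat | GenP "nat \<Rightarrow> nat"

type_synonym braid_poly = "braid_gen list \<Rightarrow>\<^sub>0 complex"

definition braid_gens :: "nat \<Rightarrow> braid_gen set" where
  "braid_gens d = GenX ` {1..d} \<union> GenY ` {1..d} \<union> GenZ ` {0..d} \<union> GenP ` {\<pi>. \<pi> permutes {1..d}}"

definition free_alg :: "nat \<Rightarrow> (complex, braid_poly) module" where
  "free_alg d = \<lparr>carrier = {p. Poly_Mapping.keys p \<subseteq> lists (braid_gens d)},
     mult = (*), one = 1, zero = 0, add = (+), smult = fscale\<rparr>"

lemma keys_mult_lists:
  fixes a b :: "'g list \<Rightarrow>\<^sub>0 complex"
  assumes "Poly_Mapping.keys a \<subseteq> lists A" "Poly_Mapping.keys b \<subseteq> lists A"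
  shows "Poly_Mapping.keys (a * b) \<subseteq> lists A"
  using keys_mult[of a b] assms by (fastforce simp: plus_list_def)

lemma keys_add_sub:
  fixes a b :: "'g \<Rightarrow>\<^sub>0 complex"
  assumes "Poly_Mapping.keys a \<subseteq> L" "Poly_Mapping.keys b \<subseteq> L"
  shows "Poly_Mapping.keys (a + b) \<subseteq> L" "Poly_Mapping.keys (a - b) \<subseteq> L"
  using keys_add[of a b] keys_diff[of a b] assms by blast+

lemma free_alg_ring: "ring (free_alg d)"
proof (rule ringI)
  show "abelian_group (free_alg d)"
  proof (rule abelian_groupI)
    fix x assume x: "x \<in> carrier (free_alg d)"
    show "\<exists>y\<in>carrier (free_alg d). y \<oplus>\<^bsub>free_alg d\<^esub> x = \<zero>\<^bsub>free_alg d\<^esub>"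
      using x by (intro bexI[of _ "- x"]) (auto simp: free_alg_def)
  qed (auto simp: free_alg_def algebra_simps dest: keys_add_sub(1)[THEN subsetD, rotated 2])
  show "Group.monoid (free_alg d)"
    by unfold_locales (simp_all add: free_alg_def mult.assoc keys_mult_lists zero_list_def)
qed (auto simp: free_alg_def algebra_simps)

definition xg :: "nat \<Rightarrow> braid_poly" where "xg i = fbasis [GenX i]"
definition yg :: "nat \<Rightarrow> braid_poly" where "yg i = fbasis [GenY i]"
definition zg :: "nat \<Rightarrow> braid_poly" where "zg i = fbasis [GenZ i]"
definition pg :: "(nat \<Rightarrow> nat) \<Rightarrow> braid_poly" where "pg \<pi> = fbasis [GenP \<pi>]"

definition tt :: "nat \<Rightarrow> nat \<Rightarrow> braid_poly" where "tt i j = pg (Transposition.transpose i j)"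
definition tg :: "nat \<Rightarrow> braid_poly" where "tg i = tt i (Suc i)"

text \<open>The elements m_{i,j} for 1 \<le> i < j, and m_j.\<close>

definition mm :: "nat \<Rightarrow> nat \<Rightarrow> braid_poly" where
  "mm i j = (let s = xg j - tg (j - 1) * xg (j - 1) * tg (j - 1)
     in if j = i + 1 then s else tt i (j - 1) * s * tt i (j - 1))"

definition mg :: "nat \<Rightarrow> braid_poly" where "mg j = (\<Sum>i\<in>{1..<j}. mm i j)"

inductive braid_rel :: "nat \<Rightarrow> braid_poly \<Rightarrow> braid_poly \<Rightarrow> bool" for d :: nat where
  group_one: "braid_rel d (pg id) 1"
| group_mult: "\<lbrakk>\<pi> permutes {1..d}; \<pi>' permutes {1..d}\<rbrakk> \<Longrightarrow> braid_rel d (pg \<pi> * pg \<pi>') (pg (\<pi> \<circ> \<pi>'))"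
| xx: "\<lbrakk>i \<in> {1..d}; j \<in> {1..d}\<rbrakk> \<Longrightarrow> braid_rel d (xg i * xg j) (xg j * xg i)"
| yy: "\<lbrakk>i \<in> {1..d}; j \<in> {1..d}\<rbrakk> \<Longrightarrow> braid_rel d (yg i * yg j) (yg j * yg i)"
| zz: "\<lbrakk>i \<in> {0..d}; j \<in> {0..d}\<rbrakk> \<Longrightarrow> braid_rel d (zg i * zg j) (zg j * zg i)"
| xt: "\<lbrakk>i \<in> {1..d}; j \<in> {1..<d}; i \<noteq> j; i \<noteq> j + 1\<rbrakk> \<Longrightarrow> braid_rel d (xg i * tg j) (tg j * xg i)"
| yt: "\<lbrakk>i \<in> {1..d}; j \<in> {1..<d}; i \<noteq> j; i \<noteq> j + 1\<rbrakk> \<Longrightarrow> braid_rel d (yg i * tg j) (tg j * yg i)"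
| zt: "\<lbrakk>i \<in> {0..d}; j \<in> {1..<d}; i \<noteq> j; i \<noteq> j + 1\<rbrakk> \<Longrightarrow> braid_rel d (zg i * tg j) (tg j * zg i)"
| zx: "\<lbrakk>j \<in> {1..d}; i \<in> {j..d}\<rbrakk>
    \<Longrightarrow> braid_rel d ((\<Sum>k\<in>{0..i}. zg k) * xg j) (xg j * (\<Sum>k\<in>{0..i}. zg k))"
| zy: "\<lbrakk>j \<in> {1..d}; i \<in> {j..d}\<rbrakk>
    \<Longrightarrow> braid_rel d ((\<Sum>k\<in>{0..i}. zg k) * yg j) (yg j * (\<Sum>k\<in>{0..i}. zg k))"
| tx: "i \<in> {1..<d} \<Longrightarrow> braid_rel d (tg i * (xg i + xg (i + 1))) ((xg i + xg (i + 1)) * tg i)"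
| ty: "i \<in> {1..<d} \<Longrightarrow> braid_rel d (tg i * (yg i + yg (i + 1))) ((yg i + yg (i + 1)) * tg i)"
| ttx: "\<lbrakk>1 \<le> i; i + 2 \<le> d\<rbrakk> \<Longrightarrow> braid_rel d
    (tg i * tg (i + 1) * (xg (i + 1) - tg i * xg i * tg i) * tg (i + 1) * tg i)
    (xg (i + 2) - tg (i + 1) * xg (i + 1) * tg (i + 1))"
| tty: "\<lbrakk>1 \<le> i; i + 2 \<le> d\<rbrakk> \<Longrightarrow> braid_rel d
    (tg i * tg (i + 1) * (yg (i + 1) - tg i * yg i * tg i) * tg (i + 1) * tg i)
    (yg (i + 2) - tg (i + 1) * yg (i + 1) * tg (i + 1))"
| xy: "i \<in> {1..<d} \<Longrightarrow> braid_rel d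
    (xg (i + 1) - tg i * xg i * tg i) (yg (i + 1) - tg i * yg i * tg i)"
| zm: "i \<in> {1..d} \<Longrightarrow> braid_rel d (zg i) (xg i + yg i - mg i)"

lemma braid_rel_carrier:
  assumes "braid_rel d a b" "d \<ge> 1"
  shows "a - b \<in> carrier (free_alg d)"
proof -
  let ?C = "carrier (free_alg d)"
  have A: "a + b \<in> ?C" "a - b \<in> ?C" "a * b \<in> ?C" if "a \<in> ?C" "b \<in> ?C" for a b
    using that by (simp_all add: free_alg_def keys_add_sub keys_mult_lists del: in_lists_conv_set)
  have g: "i \<in> {1..d} \<Longrightarrow> xg i \<in> ?C" "i \<in> {1..d} \<Longrightarrow> yg i \<in> ?C" "i \<in> {0..d} \<Longrightarrow> zg i \<in> ?C"
    "\<pi> permutes {1..d} \<Longrightarrow> pg \<pi> \<in> ?C" for i \<pi>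
    by (auto simp: xg_def yg_def zg_def pg_def fbasis_def free_alg_def braid_gens_def)
  have one: "1 \<in> ?C" by (auto simp: free_alg_def zero_list_def)
  have t: "i \<in> {1..d} \<Longrightarrow> j \<in> {1..d} \<Longrightarrow> tt i j \<in> ?C" for i j
    unfolding tt_def by (intro g permutes_swap_id)
  have t1: "i \<in> {1..<d} \<Longrightarrow> tg i \<in> ?C" for i unfolding tg_def by (rule t) auto
  have zero: "0 \<in> ?C" by (simp add: free_alg_def)
  have s: "(\<Sum>i\<in>S. f i) \<in> ?C" if "\<And>i. i \<in> S \<Longrightarrow> f i \<in> ?C" "finite S" for S and f :: "nat \<Rightarrow> _"
    using that(2,1) by (induction S) (auto intro!: A zero)
  have m: "mm i j \<in> ?C" if "1 \<le> i" "i < j" "j \<le> d" for i j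
    unfolding mm_def Let_def using that by (auto intro!: A g t t1)
  have m1: "mg j \<in> ?C" if "1 \<le> j" "j \<le> d" for j unfolding mg_def using that by (auto intro!: s m)
  show ?thesis using assms
    by cases (auto intro!: A g t1 one s m1 permutes_id permutes_compose)
qed

definition braid_ideal :: "nat \<Rightarrow> braid_poly set" where
  "braid_ideal d = Idl\<^bsub>free_alg d\<^esub> {a - b | a b. braid_rel d a b}"

definition braid_class :: "nat \<Rightarrow> braid_poly \<Rightarrow> braid_poly set" where
  "braid_class d p = braid_ideal d +>\<^bsub>free_alg d\<^esub> p"

definition braid_alg :: "nat \<Rightarrow> (complex, braid_poly set) module" where
  "braid_alg d = ring.extend (free_alg d Quot braid_ideal d)
     (module.fields (\<lambda>c X. \<Union>p\<in>X. braid_class d (fscale c p)))"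

lemma braid_alg_simps:
  "carrier (braid_alg d) = a_rcosets\<^bsub>free_alg d\<^esub> braid_ideal d"
  "x \<otimes>\<^bsub>braid_alg d\<^esub> y = rcoset_mult (free_alg d) (braid_ideal d) x y"
  "c \<odot>\<^bsub>braid_alg d\<^esub> y = (\<Union>p\<in>y. braid_class d (fscale c p))"
  "\<one>\<^bsub>braid_alg d\<^esub> = braid_class d 1"
  by (auto simp: braid_alg_def FactRing_def ring.defs module.defs braid_class_def free_alg_def)

text \<open>Unital complex algebra homomorphisms.\<close>

definition alg_hom :: "(complex, 'c) module \<Rightarrow> (complex, 'e) module \<Rightarrow> ('c \<Rightarrow> 'e) set" where
  "alg_hom A B = {h \<in> Ring.ring_hom A B. \<forall>c. \<forall>a\<in>carrier A. h (c \<odot>\<^bsub>A\<^esub> a) = c \<odot>\<^bsub>B\<^esub> h a}"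

end

theory Submission
  imports Defs
begin

text \<open>
  All operators live in the ring \<open>R\<close> of linear endomorphisms of the free vector space on pure
  tensors. A linear projector \<open>e\<close> whose kernel on the span of the pure tensors is the space of
  multilinearity relations identifies the operators on the tensor product with elements of the
  corner \<open>e R e\<close>, so that identities can be tested on tensors of homogeneous vectors and unit
  vectors and then combined by ring algebra.

  The matrix units acting in the single slots satisfy the relations of gl(n|m) within a slot and
  supercommute between different slots. Hence the Casimir element of a set of slots commutes with
  the action on every larger set, and it expands into pairwise terms \<open>\<Omega>(s, t)\<close>. Two facts about
  the natural module then give everything: \<open>\<Omega>(k, l)\<close> is the signed transposition for two copies of
  V, and \<open>\<Omega>(k, k)\<close> is the scalar \<open>\<kappa>_V\<close>. In particular \<open>x_(i+1) - t_i x_i t_i\<close> and its analogue for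
  \<open>y\<close> are both sent to \<open>t_i\<close>, and \<open>m_(i,j)\<close> is sent to the transposition of i and j.
\<close>


section \<open>The ring of linear endomorphisms of a free vector space\<close>

text \<open>The factor 1/2 and the shifts by \<kappa>_V have one source. Adding a copy of V to a set
  of slots changes the Casimir element by twice the sum of its pairwise terms with the old slots,
  plus \<kappa>_V. Hence x_i goes to the sum of \<Omega>(s, i) over M and the earlier copies of V,
  plus \<kappa>_V/2, and likewise y_i with N. Their sum counts the earlier copies of V twice, and
  m_i removes one count. What remains has constant \<kappa>_V, whereas half a difference of Casimir
  elements has only \<kappa>_V/2: hence the additional \<kappa>_V in the formula for z_i. The
  formula for z_0 isolates \<Omega>(M, N). The commutation relations need no such expansion: Casimir
  elements of nested or of disjoint sets of slots commute, and sums of consecutive generators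
  telescope to such elements. Two obstacles shape the rest. There is a generator for every
  permutation, so the signs of arbitrary permutations must be shown multiplicative. And an action on
  pure tensors is linear in the matrix only modulo the multilinearity relations, so it can be
  expanded into matrix units only in the corner.\<close>

interpretation fs: vector_space fscale
  by (rule vector_space_fscale)

lemma flift_superset:
  assumes "finite A" "Poly_Mapping.keys f \<subseteq> A"
  shows "flift \<phi> f = (\<Sum>g\<in>A. fscale (Poly_Mapping.lookup f g) (\<phi> g))"
  unfolding flift_def
  by (rule sum.mono_neutral_left) (use assms in \<open>auto simp: in_keys_iff\<close>)

lemma flift_add: "flift \<phi> (f + g) = flift \<phi> f + flift \<phi> g"
proof -
  let ?A = "Poly_Mapping.keys f \<union> Poly_Mapping.keys g"
  have "flift \<phi> h = (\<Sum>x\<in>?A. fscale (Poly_Mapping.lookup h x) (\<phi> x))" if "h \<in> {f, g, f + g}" for h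
    using that keys_add[of f g] by (intro flift_superset) auto
  then show ?thesis
    by (simp add: lookup_add fs.scale_left_distrib sum.distrib)
qed

lemma keys_fscale: "Poly_Mapping.keys (fscale c f) \<subseteq> Poly_Mapping.keys f"
  by (auto simp: in_keys_iff fscale_lookup)

lemma flift_fscale: "flift \<phi> (fscale c f) = fscale c (flift \<phi> f)"
proof -
  have "flift \<phi> (fscale c f)
      = (\<Sum>x\<in>Poly_Mapping.keys f. fscale (Poly_Mapping.lookup (fscale c f) x) (\<phi> x))"
    by (intro flift_superset keys_fscale) simp
  then show ?thesis
    by (simp add: flift_def fscale_lookup fs.scale_sum_right)
qed

lemma linear_flift: "Vector_Spaces.linear fscale fscale (flift \<phi>)"
  by unfold_locales (simp_all add: flift_add flift_fscale)

lemma flift_fbasis [simp]: "flift \<phi> (fbasis g) = \<phi> g"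
  by (simp add: flift_def fbasis_def)

lemma flift_fbasis_id: "flift fbasis f = f"
proof (rule poly_mapping_eqI)
  fix k
  have "Poly_Mapping.lookup (flift fbasis f) k
      = (\<Sum>g\<in>Poly_Mapping.keys f. if g = k then Poly_Mapping.lookup f k else 0)"
    unfolding flift_def lookup_sum
    by (rule sum.cong) (auto simp: fscale_lookup fbasis_def lookup_single when_def)
  then show "Poly_Mapping.lookup (flift fbasis f) k = Poly_Mapping.lookup f k"
    by (simp add: in_keys_iff)
qed

lemma linear_eq_flift:
  assumes "Vector_Spaces.linear fscale fscale F"
  shows "F f = flift (\<lambda>g. F (fbasis g)) f"
proof -
  interpret F: Vector_Spaces.linear fscale fscale F by fact
  have "F f = F (flift fbasis f)" by (simp only: flift_fbasis_id)
  also have "\<dots> = flift (\<lambda>g. F (fbasis g)) f"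
    unfolding flift_def by (simp add: F.sum F.scale)
  finally show ?thesis .
qed


text \<open>A separate type makes composition the multiplication of a \<open>ring_1\<close>, so that
  operator identities become ordinary ring algebra.\<close>

typedef 'g endo = "{F :: ('g \<Rightarrow>\<^sub>0 complex) \<Rightarrow> ('g \<Rightarrow>\<^sub>0 complex). Vector_Spaces.linear fscale fscale F}"
  morphisms app Endo
  by (rule exI[of _ id]) (simp add: fs.linear_id)

setup_lifting type_definition_endo

lemma linear_app: "Vector_Spaces.linear fscale fscale (app F)"
  using app[of F] by simp

lemma app_linear [simp]:
  "app F (f + g) = app F f + app F g" "app F (f - g) = app F f - app F g"
  "app F (fscale c f) = fscale c (app F f)" "app F 0 = 0" "app F (- f) = - app F f"
  "app F (sum h S) = (\<Sum>s\<in>S. app F (h s))"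
proof -
  interpret F: Vector_Spaces.linear fscale fscale "app F" by (rule linear_app)
  show "app F (f + g) = app F f + app F g" "app F (f - g) = app F f - app F g"
    "app F (fscale c f) = fscale c (app F f)" "app F 0 = 0" "app F (- f) = - app F f"
    "app F (sum h S) = (\<Sum>s\<in>S. app F (h s))"
    by (simp_all add: F.add F.diff F.scale F.zero F.neg F.sum)
qed

lemma endo_eqI: "(\<And>g. app F (fbasis g) = app G (fbasis g)) \<Longrightarrow> F = G"
  by (metis (no_types, lifting) app_inject ext linear_app linear_eq_flift)

instantiation endo :: (type) ring_1
begin

lift_definition zero_endo :: "'a endo" is "\<lambda>f. 0"
  by unfold_locales simp_all
lift_definition one_endo :: "'a endo" is "\<lambda>f. f"
  by unfold_locales simp_all
lift_definition plus_endo :: "'a endo \<Rightarrow> 'a endo \<Rightarrow> 'a endo" is "\<lambda>F G f. F f + G f"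
  by (simp add: Vector_Spaces.linear_iff fs.scale_right_distrib)
lift_definition minus_endo :: "'a endo \<Rightarrow> 'a endo \<Rightarrow> 'a endo" is "\<lambda>F G f. F f - G f"
  by (simp add: Vector_Spaces.linear_iff fs.scale_right_diff_distrib)
lift_definition uminus_endo :: "'a endo \<Rightarrow> 'a endo" is "\<lambda>F f. - F f"
  by (simp add: Vector_Spaces.linear_iff)
lift_definition times_endo :: "'a endo \<Rightarrow> 'a endo \<Rightarrow> 'a endo" is "\<lambda>F G f. F (G f)"
  by (simp add: Vector_Spaces.linear_iff)

instance
proof
  show "(0 :: 'a endo) \<noteq> 1"
  proof
    assume "(0 :: 'a endo) = 1"
    then have "app 0 (fbasis g) = app 1 (fbasis g)" for g :: 'a by simp
    then show False
      by (simp add: zero_endo.rep_eq one_endo.rep_eq fbasis_def poly_mapping_eq_iff fun_eq_iff)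
        (metis lookup_single_eq zero_neq_one)
  qed
qed (transfer; auto simp: fun_eq_iff Vector_Spaces.linear_iff algebra_simps)+

end

lemma app_ops [simp]:
  "app (F + G) f = app F f + app G f" "app (F - G) f = app F f - app G f" "app (- F) f = - app F f"
  "app (F * G) f = app F (app G f)" "app 0 f = 0" "app 1 f = f"
  by (transfer; simp)+

lemma app_sum [simp]: "app (sum F S) f = (\<Sum>s\<in>S. app (F s) f)"
  by (induction S rule: infinite_finite_induct) simp_all

text \<open>Since \<open>endo\<close> carries only a ring structure, scalars enter as central
  elements of the ring.\<close>

lift_definition sc :: "complex \<Rightarrow> 'g endo" is "\<lambda>c. fscale c"
  by (rule fs.linear_scale_self)

lemma app_sc [simp]: "app (sc c) f = fscale c f"
  by transfer simp

lift_definition efl :: "('g \<Rightarrow> ('g \<Rightarrow>\<^sub>0 complex)) \<Rightarrow> 'g endo" is flift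
  by (rule linear_flift)

lemma app_efl: "app (efl \<phi>) f = flift \<phi> f"
  by (simp add: efl.rep_eq)


section \<open>Casimir operators on slots\<close>

text \<open>Signs taken inside an arbitrary ring keep the algebra of Casimir elements free of
  scalars; \<open>sg_eq_sc\<close> later identifies them with \<open>ksgn\<close>.\<close>

definition sg :: "bit \<Rightarrow> 'r::ring_1" where
  "sg p = (if p = 0 then 1 else - 1)"

lemma sg_square [simp]: "sg p * sg p = 1" "sg p * (sg p * x) = x"
  by (simp_all add: sg_def)

lemma sg_comm: "sg p * x = x * sg p"
  by (simp add: sg_def)

lemma sg_cases: "sg p = 1 \<or> sg p = - 1"
  by (simp add: sg_def)

text \<open>A super Leibniz rule: \<open>z\<close> moves left past \<open>y\<close> and then past
  \<open>x\<close>. The two signs cancel on the main term, and each exchange leaves its own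
  correction terms.\<close>

lemma swap_past_product:
  fixes s x y z A B C D :: "'r::ring_1"
  assumes "s = 1 \<or> s = - 1"
    and "y * z = s * (z * y) + A - s * B" and "x * z = s * (z * x) + C - s * D"
  shows "x * y * z = z * (x * y) + s * (C * y) - D * y + x * A - s * (x * B)"
proof -
  have "x * y * z = x * (s * (z * y) + A - s * B)"
    by (simp only: assms(2) mult.assoc)
  also have "\<dots> = s * ((x * z) * y) + x * A - s * (x * B)"
    using assms(1) by (auto simp: algebra_simps)
  also have "s * ((x * z) * y) = z * (x * y) + s * (C * y) - D * y"
    unfolding assms(3) using assms(1) by (auto simp: algebra_simps)
  finally show ?thesis .
qed

text \<open>The hypothesis \<open>rel\<close> is the bracket of matrix units in gl(n|m). Moving
  \<open>D k l\<close> through a summand of the Casimir element leaves four correction terms, which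
  cancel in pairs only after summation.\<close>

lemma casimir_central:
  fixes D :: "nat \<Rightarrow> nat \<Rightarrow> 'r::ring_1"
  assumes rel: "\<And>i j k l. \<lbrakk>i < K; j < K; k < K; l < K\<rbrakk> \<Longrightarrow>
      D i j * D k l = sg ((par i + par j) * (par k + par l)) * (D k l * D i j)
        + (if j = k then D i l else 0)
        - sg ((par i + par j) * (par k + par l)) * (if i = l then D k j else 0)"
    and kl: "k < K" "l < K"
  shows "(\<Sum>i<K. \<Sum>j<K. sg (par j) * (D i j * D j i)) * D k l
       = D k l * (\<Sum>i<K. \<Sum>j<K. sg (par j) * (D i j * D j i))"
proof -
  define s where "s i j = (sg ((par i + par j) * (par k + par l)) :: 'r)" for i j
  \<comment> \<open>Once the delta conditions have fixed one index, the second and third correction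
    become the same sum over j, and the first and fourth become the same sum over i up to the signs
    compared in \<open>sgn\<close>.\<close>
  have pointwise: "sg (par j) * (D i j * D j i) * D k l = D k l * (sg (par j) * (D i j * D j i))
      + (if j = k then sg (par k) * s i k * (D i l * D k i) else 0)
      - (if i = l then sg (par j) * (D k j * D j l) else 0)
      + (if i = k then sg (par j) * (D k j * D j l) else 0)
      - (if j = l then sg (par l) * s i l * (D i l * D k i) else 0)" if "i < K" "j < K" for i j
  proof -
    have s: "s i j = 1 \<or> s i j = - 1" unfolding s_def by (rule sg_cases)
    have 1: "D j i * D k l = s i j * (D k l * D j i) + (if i = k then D j l else 0)
        - s i j * (if j = l then D k i else 0)"
      unfolding s_def add.commute[of "par i" "par j"] by (rule rel[OF that(2,1) kl])
    have 2: "D i j * D k l = s i j * (D k l * D i j) + (if j = k then D i l else 0)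
        - s i j * (if i = l then D k j else 0)"
      unfolding s_def by (rule rel[OF that kl])
    have "sg (par j) * (D i j * D j i) * D k l = sg (par j) * (D i j * D j i * D k l)"
      by (simp only: mult.assoc)
    also have "\<dots> = D k l * (sg (par j) * (D i j * D j i))
      + sg (par j) * (s i j * ((if j = k then D i l else 0) * D j i))
      - sg (par j) * ((if i = l then D k j else 0) * D j i)
      + sg (par j) * (D i j * (if i = k then D j l else 0))
      - sg (par j) * (s i j * (D i j * (if j = l then D k i else 0)))"
      unfolding swap_past_product[OF s 1 2] distrib_left right_diff_distrib
      by (simp only: mult.assoc sg_comm[of "par j" "D k l", THEN arg_cong[where f = "\<lambda>x. x * _"], unfolded mult.assoc])
    also have "\<dots> = D k l * (sg (par j) * (D i j * D j i))
      + (if j = k then sg (par k) * s i k * (D i l * D k i) else 0)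
      - (if i = l then sg (par j) * (D k j * D j l) else 0)
      + (if i = k then sg (par j) * (D k j * D j l) else 0)
      - (if j = l then sg (par l) * s i l * (D i l * D k i) else 0)"
      by (intro arg_cong2[where f = "(+)"] arg_cong2[where f = "(-)"] refl)
        (auto simp: mult.assoc)
    finally show ?thesis .
  qed
  \<comment> \<open>In the field with two elements, (i + k)(k + l) + (i + l)(k + l) = (k + l)^2 = k
    + l, where the letters stand for the parities.\<close>
  have sgn: "sg (par k) * s i k = sg (par l) * s i l" for i
    unfolding s_def
    by (cases "par i"; cases "par k"; cases "par l") (simp_all add: sg_def)
  have "(\<Sum>i<K. \<Sum>j<K. sg (par j) * (D i j * D j i)) * D k l
      = (\<Sum>i<K. \<Sum>j<K. sg (par j) * (D i j * D j i) * D k l)"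
    by (simp only: sum_distrib_right)
  also have "\<dots> = (\<Sum>i<K. \<Sum>j<K. D k l * (sg (par j) * (D i j * D j i))
      + (if j = k then sg (par k) * s i k * (D i l * D k i) else 0)
      - (if i = l then sg (par j) * (D k j * D j l) else 0)
      + (if i = k then sg (par j) * (D k j * D j l) else 0)
      - (if j = l then sg (par l) * s i l * (D i l * D k i) else 0))"
    by (intro sum.cong refl pointwise) auto
  also have "\<dots> = (\<Sum>i<K. \<Sum>j<K. D k l * (sg (par j) * (D i j * D j i)))
      + (\<Sum>i<K. \<Sum>j<K. if j = k then sg (par k) * s i k * (D i l * D k i) else 0)
      - (\<Sum>j<K. \<Sum>i<K. if i = l then sg (par j) * (D k j * D j l) else 0)
      + (\<Sum>j<K. \<Sum>i<K. if i = k then sg (par j) * (D k j * D j l) else 0)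
      - (\<Sum>i<K. \<Sum>j<K. if j = l then sg (par l) * s i l * (D i l * D k i) else 0)"
    unfolding sum.distrib sum_subtractf
    by (intro arg_cong2[where f = "(+)"] arg_cong2[where f = "(-)"] refl sum.swap)
  also have "\<dots> = (\<Sum>i<K. \<Sum>j<K. D k l * (sg (par j) * (D i j * D j i)))"
    using kl by (simp add: sgn)
  finally show ?thesis by (simp only: sum_distrib_left)
qed

text \<open>The factors \<open>D i j\<close> and \<open>D j i\<close> have the same parity, so the
  two signs picked up on the way past \<open>x\<close> multiply to 1.\<close>

lemma casimir_commute:
  fixes D D' :: "nat \<Rightarrow> nat \<Rightarrow> 'r::ring_1"
  assumes rel: "\<And>i j. \<lbrakk>i < K; j < K\<rbrakk> \<Longrightarrow> D i j * x = sg ((par i + par j) * q) * (x * D i j)"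
  shows "(\<Sum>i<K. \<Sum>j<K. sg (par j) * (D i j * D j i)) * x
       = x * (\<Sum>i<K. \<Sum>j<K. sg (par j) * (D i j * D j i))"
proof -
  have "sg (par j) * (D i j * D j i) * x = x * (sg (par j) * (D i j * D j i))"
    if "i < K" "j < K" for i j
  proof -
    let ?s = "sg ((par i + par j) * q) :: 'r"
    have "D i j * D j i * x = D i j * (?s * (x * D j i))"
      by (simp only: mult.assoc rel[OF that(2,1)] add.commute[of "par j" "par i"])
    also have "\<dots> = ?s * ((D i j * x) * D j i)"
      by (metis mult.assoc sg_comm)
    also have "\<dots> = x * (D i j * D j i)"
      unfolding rel[OF that] by (simp only: mult.assoc sg_square)
    finally show ?thesis by (metis mult.assoc sg_comm)
  qed
  then show ?thesis by (simp add: sum_distrib_left sum_distrib_right)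
qed

text \<open>Here \<open>e\<close> is the unit of a corner of the ring and \<open>a s i j\<close>
  plays the matrix unit E_ij acting in slot \<open>s\<close>: \<open>a_same\<close> is the bracket
  of gl(n|m), and \<open>a_diff\<close> says that different slots supercommute.\<close>

locale gl_slots =
  fixes K :: nat and par :: "nat \<Rightarrow> bit" and e :: "'r::ring_1"
    and a :: "'s \<Rightarrow> nat \<Rightarrow> nat \<Rightarrow> 'r" and Sl :: "'s set"
  assumes a_same: "\<lbrakk>s \<in> Sl; i < K; j < K; k < K; l < K\<rbrakk> \<Longrightarrow>
      a s i j * a s k l = sg ((par i + par j) * (par k + par l)) * (a s k l * a s i j)
        + (if j = k then a s i l else 0)
        - sg ((par i + par j) * (par k + par l)) * (if i = l then a s k j else 0)"
    and a_diff: "\<lbrakk>s \<in> Sl; t \<in> Sl; s \<noteq> t; i < K; j < K; k < K; l < K\<rbrakk> \<Longrightarrow>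
      a s i j * a t k l = sg ((par i + par j) * (par k + par l)) * (a t k l * a s i j)"
    and e_a: "e * a s i j = a s i j" and a_e: "a s i j * e = a s i j"
    and finite_Sl: "finite Sl"
begin

definition act :: "'s set \<Rightarrow> nat \<Rightarrow> nat \<Rightarrow> 'r" where
  "act S i j = (\<Sum>s\<in>S. a s i j)"

definition cas :: "'s set \<Rightarrow> 'r" where
  "cas S = (\<Sum>i<K. \<Sum>j<K. sg (par j) * (act S i j * act S j i))"

text \<open>The pairwise term \<Omega>(s, t) of the overview; for s = t it is the Casimir element of
  a single slot.\<close>

definition cas2 :: "'s \<Rightarrow> 's \<Rightarrow> 'r" where
  "cas2 s t = (\<Sum>i<K. \<Sum>j<K. sg (par j) * (a s i j * a t j i))"

text \<open>This expresses that the comultiplication respects brackets: pairs of different slots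
  contribute only the signed exchange, and the diagonal pairs supply the bracket.\<close>

lemma act_same:
  assumes S: "S \<subseteq> Sl" and ijkl: "i < K" "j < K" "k < K" "l < K"
  shows "act S i j * act S k l = sg ((par i + par j) * (par k + par l)) * (act S k l * act S i j)
        + (if j = k then act S i l else 0)
        - sg ((par i + par j) * (par k + par l)) * (if i = l then act S k j else 0)"
proof -
  let ?s = "sg ((par i + par j) * (par k + par l)) :: 'r"
  have fin: "finite S" using S finite_Sl by (rule finite_subset)
  have "act S i j * act S k l = (\<Sum>s\<in>S. \<Sum>t\<in>S. a s i j * a t k l)"
    by (simp add: act_def sum_product)
  also have "\<dots> = (\<Sum>s\<in>S. \<Sum>t\<in>S. ?s * (a t k l * a s i j)
      + (if t = s then (if j = k then a s i l else 0) - ?s * (if i = l then a s k j else 0) else 0))"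
  proof (intro sum.cong refl)
    fix s t assume st: "s \<in> S" "t \<in> S"
    show "a s i j * a t k l = ?s * (a t k l * a s i j)
      + (if t = s then (if j = k then a s i l else 0) - ?s * (if i = l then a s k j else 0) else 0)"
    proof (cases "t = s")
      case True
      then show ?thesis
        using a_same[OF subsetD[OF S st(1)] ijkl] by (simp only: refl if_True add_diff_eq)
    next
      case False
      then show ?thesis
        using a_diff[OF subsetD[OF S st(1)] subsetD[OF S st(2)] _ ijkl]
        by (simp only: if_False add_0_right) metis
    qed
  qed
  also have "\<dots> = ?s * (\<Sum>s\<in>S. \<Sum>t\<in>S. a t k l * a s i j)
      + (\<Sum>s\<in>S. (if j = k then a s i l else 0) - ?s * (if i = l then a s k j else 0))"
    using fin by (simp add: sum.distrib sum_distrib_left)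
  also have "(\<Sum>s\<in>S. \<Sum>t\<in>S. a t k l * a s i j) = act S k l * act S i j"
    unfolding act_def sum_product by (rule sum.swap)
  also have "(\<Sum>s\<in>S. (if j = k then a s i l else 0) - ?s * (if i = l then a s k j else 0))
      = (if j = k then act S i l else 0) - ?s * (if i = l then act S k j else 0)"
    by (simp add: act_def sum_subtractf sum_distrib_left)
  finally show ?thesis by (simp add: algebra_simps)
qed

lemma act_diff:
  assumes "S \<subseteq> Sl" "T \<subseteq> Sl" "S \<inter> T = {}" "i < K" "j < K" "k < K" "l < K"
  shows "act S i j * act T k l = sg ((par i + par j) * (par k + par l)) * (act T k l * act S i j)"
proof -
  let ?s = "sg ((par i + par j) * (par k + par l)) :: 'r"
  have "act S i j * act T k l = (\<Sum>s\<in>S. \<Sum>t\<in>T. a s i j * a t k l)"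
    by (simp add: act_def sum_product)
  also have "\<dots> = (\<Sum>s\<in>S. \<Sum>t\<in>T. ?s * (a t k l * a s i j))"
    using assms by (intro sum.cong refl a_diff) auto
  also have "\<dots> = ?s * (\<Sum>t\<in>T. \<Sum>s\<in>S. a t k l * a s i j)"
    by (subst sum.swap) (simp add: sum_distrib_left)
  finally show ?thesis by (simp add: act_def sum_product)
qed

text \<open>The action on \<open>T\<close> splits into the action on \<open>S\<close>, where the
  Casimir element is central, and the action on \<open>T - S\<close>, past which its even summands
  move without a sign.\<close>

lemma cas_act:
  assumes "S \<subseteq> T" "T \<subseteq> Sl" "k < K" "l < K"
  shows "cas S * act T k l = act T k l * cas S"
proof -
  have fin: "finite T" using assms(2) finite_Sl by (rule finite_subset)
  have "act T k l = act S k l + act (T - S) k l"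
    using sum.subset_diff[OF assms(1) fin, of "\<lambda>s. a s k l"] by (simp add: act_def add.commute)
  moreover have "cas S * act S k l = act S k l * cas S"
    unfolding cas_def using assms by (intro casimir_central act_same) auto
  moreover have "cas S * act (T - S) k l = act (T - S) k l * cas S"
    unfolding cas_def
    using assms by (intro casimir_commute[where q = "par k + par l"] act_diff) auto
  ultimately show ?thesis by (simp add: algebra_simps)
qed

lemma cas_commutes_cas:
  assumes "\<And>k l. \<lbrakk>k < K; l < K\<rbrakk> \<Longrightarrow> cas S * act T k l = act T k l * cas S"
  shows "cas S * cas T = cas T * cas S"
proof -
  have "cas S * (sg p * (act T i j * act T j i)) = sg p * (act T i j * act T j i) * cas S"
    if "i < K" "j < K" for i j p
    using assms[OF that] assms[OF that(2,1)] by (metis mult.assoc sg_comm)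
  then show ?thesis
    unfolding cas_def[of T] sum_distrib_left sum_distrib_right by (intro sum.cong refl) auto
qed

lemma cas_cas:
  assumes "S \<subseteq> T" "T \<subseteq> Sl"
  shows "cas S * cas T = cas T * cas S"
  using assms by (intro cas_commutes_cas cas_act)

lemma cas_disjoint:
  assumes "S \<subseteq> Sl" "T \<subseteq> Sl" "S \<inter> T = {}"
  shows "cas S * cas T = cas T * cas S"
proof (rule cas_commutes_cas)
  show "cas S * act T k l = act T k l * cas S" if "k < K" "l < K" for k l
    unfolding cas_def
    using assms that by (intro casimir_commute[where q = "par k + par l"] act_diff) auto
qed

lemma e_act: "e * act S i j = act S i j" "act S i j * e = act S i j"
  by (simp_all add: act_def sum_distrib_left sum_distrib_right e_a a_e)

lemma cas2_e: "e * cas2 s t = cas2 s t" "cas2 s t * e = cas2 s t"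
proof -
  have "e * (sg p * (a s i j * a t j i)) = sg p * (a s i j * a t j i)" for i j p
    by (metis mult.assoc sg_comm e_a)
  then show "e * cas2 s t = cas2 s t" by (simp add: cas2_def sum_distrib_left)
  show "cas2 s t * e = cas2 s t" by (simp add: cas2_def sum_distrib_right a_e mult.assoc)
qed

lemma cas_eq: "cas S = (\<Sum>s\<in>S. \<Sum>t\<in>S. cas2 s t)"
proof -
  have "cas S = (\<Sum>i<K. \<Sum>j<K. \<Sum>s\<in>S. \<Sum>t\<in>S. sg (par j) * (a s i j * a t j i))"
    unfolding cas_def act_def sum_product by (simp only: sum_distrib_left)
  also have "\<dots> = (\<Sum>i<K. \<Sum>s\<in>S. \<Sum>j<K. \<Sum>t\<in>S. sg (par j) * (a s i j * a t j i))"
    by (intro sum.cong refl sum.swap)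
  also have "\<dots> = (\<Sum>s\<in>S. \<Sum>i<K. \<Sum>j<K. \<Sum>t\<in>S. sg (par j) * (a s i j * a t j i))"
    by (rule sum.swap)
  also have "\<dots> = (\<Sum>s\<in>S. \<Sum>i<K. \<Sum>t\<in>S. \<Sum>j<K. sg (par j) * (a s i j * a t j i))"
    by (intro sum.cong refl sum.swap)
  also have "\<dots> = (\<Sum>s\<in>S. \<Sum>t\<in>S. cas2 s t)"
    unfolding cas2_def by (intro sum.cong refl sum.swap)
  finally show ?thesis .
qed

lemma cas_e: "e * cas S = cas S" "cas S * e = cas S"
  by (simp_all add: cas_eq sum_distrib_left sum_distrib_right cas2_e)

text \<open>Exchanging two odd factors costs exactly the sign that turns the weight of
  \<open>j\<close> into the weight of \<open>i\<close>, and renaming the summation indices does the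
  rest.\<close>

lemma cas2_sym:
  assumes "s \<in> Sl" "t \<in> Sl" "s \<noteq> t"
  shows "cas2 s t = cas2 t s"
proof -
  have "sg (par j) * (a s i j * a t j i) = sg (par i) * (a t j i * a s i j)"
    if "i < K" "j < K" for i j
  proof -
    have "sg (par j) * sg ((par i + par j) * (par j + par i)) = (sg (par i) :: 'r)"
      by (cases "par i"; cases "par j") (simp_all add: sg_def)
    then show ?thesis
      unfolding a_diff[OF assms that that(2,1)] by (metis mult.assoc)
  qed
  then have "cas2 s t = (\<Sum>i<K. \<Sum>j<K. sg (par i) * (a t j i * a s i j))"
    unfolding cas2_def by (intro sum.cong refl) auto
  also have "\<dots> = cas2 t s" unfolding cas2_def by (rule sum.swap)
  finally show ?thesis .
qed

text \<open>The two off-diagonal sums agree by symmetry. This factor 2 is what the 1/2 in the images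
  of the generators undoes.\<close>

lemma cas_insert:
  assumes "insert t S \<subseteq> Sl" "t \<notin> S"
  shows "cas (insert t S) = cas S + 2 * (\<Sum>s\<in>S. cas2 s t) + cas2 t t"
proof -
  have fin: "finite S" using assms finite_Sl finite_subset by auto
  have "(\<Sum>s\<in>S. cas2 t s) = (\<Sum>s\<in>S. cas2 s t)"
    using assms by (intro sum.cong refl cas2_sym) auto
  then show ?thesis
    using assms(2) fin by (simp add: cas_eq sum.distrib algebra_simps mult_2)
qed

end


section \<open>The relations of the braid algebra\<close>

lemma fscale_fbasis: "fscale c (fbasis g) = Poly_Mapping.single g c"
  by (rule poly_mapping_eqI) (simp add: fscale_lookup fbasis_def lookup_single when_def)

text \<open>A named predicate lets \<open>commute_intros\<close> take an expression apart by
  introduction rules until only pairs of Casimir elements remain.\<close>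

definition commute :: "'r::ring_1 \<Rightarrow> 'r \<Rightarrow> bool" where
  "commute x y \<longleftrightarrow> x * y = y * x"

lemma commute_refl: "commute x x"
  by (simp add: commute_def)

lemma commute_sym: "commute x y \<Longrightarrow> commute y x"
  by (simp add: commute_def)

lemma commute_add:
  "commute x z \<Longrightarrow> commute y z \<Longrightarrow> commute (x + y) z" "commute z x \<Longrightarrow> commute z y \<Longrightarrow> commute z (x + y)"
  by (simp_all add: commute_def algebra_simps)

lemma commute_diff:
  "commute x z \<Longrightarrow> commute y z \<Longrightarrow> commute (x - y) z" "commute z x \<Longrightarrow> commute z y \<Longrightarrow> commute z (x - y)"
  by (simp_all add: commute_def algebra_simps)

lemma commute_mult:
  "commute x z \<Longrightarrow> commute y z \<Longrightarrow> commute (x * y) z" "commute z x \<Longrightarrow> commute z y \<Longrightarrow> commute z (x * y)"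
  unfolding commute_def by (metis mult.assoc)+

lemmas commute_intros = commute_add commute_diff commute_mult commute_refl

fun slot_perm :: "(nat \<Rightarrow> nat) \<Rightarrow> slot \<Rightarrow> slot" where
  "slot_perm \<pi> SlotM = SlotM"
| "slot_perm \<pi> SlotN = SlotN"
| "slot_perm \<pi> (SlotV k) = SlotV (\<pi> k)"

lemma finite_slots [simp]: "finite (MV_slots i)" "finite (NV_slots i)" "finite (MNV_slots i)"
  by (simp_all add: MV_slots_def NV_slots_def MNV_slots_def)

lemma slots_mono:
  assumes "i \<le> j"
  shows "MV_slots i \<subseteq> MV_slots j" "NV_slots i \<subseteq> NV_slots j" "MNV_slots i \<subseteq> MNV_slots j"
    "MV_slots i \<subseteq> MNV_slots j" "NV_slots i \<subseteq> MNV_slots j"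
  using assms by (auto simp: MV_slots_def NV_slots_def MNV_slots_def)

lemma slots_Suc:
  "MV_slots (Suc i) = insert (SlotV (Suc i)) (MV_slots i)"
  "NV_slots (Suc i) = insert (SlotV (Suc i)) (NV_slots i)"
  "MNV_slots (Suc i) = insert (SlotV (Suc i)) (MNV_slots i)"
  by (auto simp: MV_slots_def NV_slots_def MNV_slots_def atLeastAtMostSuc_conv)

lemma SlotV_in_slots [simp]:
  "SlotV k \<in> MV_slots i \<longleftrightarrow> 1 \<le> k \<and> k \<le> i" "SlotV k \<in> NV_slots i \<longleftrightarrow> 1 \<le> k \<and> k \<le> i"
  "SlotV k \<in> MNV_slots i \<longleftrightarrow> 1 \<le> k \<and> k \<le> i"
  by (auto simp: MV_slots_def NV_slots_def MNV_slots_def)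

abbreviation adj :: "nat \<Rightarrow> nat \<Rightarrow> nat" where
  "adj i \<equiv> Transposition.transpose i (Suc i)"

lemma slot_perm_involutive: "slot_perm (adj i) (slot_perm (adj i) s) = s"
  by (cases s) simp_all

lemma inj_slot_perm: "inj_on (slot_perm (adj i)) S"
  by (metis inj_onI slot_perm_involutive)

text \<open>The transposition of j and j + 1 preserves the first i positions unless it exchanges the
  last of them with the next one, that is, unless j = i. The bound on \<open>j\<close> keeps
  position 0 out of play.\<close>

lemma slot_perm_slots:
  assumes "i \<noteq> j" "1 \<le> j"
  shows "slot_perm (adj j) ` MV_slots i = MV_slots i" "slot_perm (adj j) ` NV_slots i = NV_slots i"
    "slot_perm (adj j) ` MNV_slots i = MNV_slots i"
proof -
  have V: "adj j k \<in> {1..i}" if "k \<in> {1..i}" for k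
    using that assms by (auto simp: Transposition.transpose_def)
  have img: "slot_perm (adj j) ` S = S" if "slot_perm (adj j) ` S \<subseteq> S" for S
    using that by (metis (no_types, lifting) image_subset_iff slot_perm_involutive subsetI
        subset_antisym rev_image_eqI)
  show "slot_perm (adj j) ` MV_slots i = MV_slots i" "slot_perm (adj j) ` NV_slots i = NV_slots i"
    "slot_perm (adj j) ` MNV_slots i = MNV_slots i"
    by (intro img; use V in \<open>auto simp: MV_slots_def NV_slots_def MNV_slots_def\<close>)+
qed

text \<open>The braid relations are derived from these axioms alone, without mention of tensors. The
  facts \<open>cas2_adj\<close> and \<open>cas2_V\<close> are where the natural module enters;
  \<open>Pm_adj\<close> moves an operator to the permuted slot.\<close>

locale braid_slots = gl_slots K par e a "MNV_slots d"
  for K and par :: "nat \<Rightarrow> bit" and e :: "'r::ring_1" and a :: "slot \<Rightarrow> nat \<Rightarrow> nat \<Rightarrow> 'r" and d +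
  fixes scal :: "complex \<Rightarrow> 'r" and Pm :: "(nat \<Rightarrow> nat) \<Rightarrow> 'r" and kV :: complex
  assumes scal_add: "scal (c + c') = scal c + scal c'" and scal_mult: "scal (c * c') = scal c * scal c'"
    and scal_one: "scal 1 = 1" and scal_comm: "scal c * x = x * scal c"
    and Pm_id: "Pm id = e"
    and Pm_comp: "\<lbrakk>\<pi> permutes {1..d}; \<pi>' permutes {1..d}\<rbrakk> \<Longrightarrow> Pm \<pi> * Pm \<pi>' = Pm (\<pi> \<circ> \<pi>')"
    and Pm_e: "e * Pm \<pi> = Pm \<pi>" "Pm \<pi> * e = Pm \<pi>"
    and Pm_adj: "\<lbrakk>i \<in> {1..<d}; s \<in> MNV_slots d; k < K; l < K\<rbrakk>
      \<Longrightarrow> Pm (adj i) * a s k l = a (slot_perm (adj i) s) k l * Pm (adj i)"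
    and cas2_adj: "i \<in> {1..<d} \<Longrightarrow> cas2 (SlotV i) (SlotV (Suc i)) = Pm (adj i)"
    and cas2_V: "k \<in> {1..d} \<Longrightarrow> cas2 (SlotV k) (SlotV k) = scal kV * e"
begin

section \<open>Conjugation of Casimir terms by transpositions\<close>

lemma scal_zero: "scal 0 = 0"
  using scal_add[of 0 0] by simp

lemma half: "scal (1/2) * (2 * x) = x"
proof -
  have "scal (1/2) * (2 * x) = (scal (1/2) + scal (1/2)) * x"
    by (simp add: mult_2 algebra_simps)
  also have "\<dots> = x" by (simp add: scal_one flip: scal_add)
  finally show ?thesis .
qed

lemma commute_scal: "commute (scal c) x" "commute x (scal c)"
  by (simp_all add: commute_def scal_comm)

lemma adj_permutes: "i \<in> {1..<d} \<Longrightarrow> adj i permutes {1..d}"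
  by (intro permutes_swap_id) auto

lemma Pm_adj_square: "i \<in> {1..<d} \<Longrightarrow> Pm (adj i) * Pm (adj i) = e"
  using Pm_comp[OF adj_permutes adj_permutes, of i i] by (simp add: Pm_id)

lemma Pm_cas2:
  assumes "i \<in> {1..<d}" "s \<in> MNV_slots d" "t \<in> MNV_slots d"
  shows "Pm (adj i) * cas2 s t = cas2 (slot_perm (adj i) s) (slot_perm (adj i) t) * Pm (adj i)"
proof -
  have "Pm (adj i) * (sg p * (a s k l * a t l k))
      = sg p * (a (slot_perm (adj i) s) k l * a (slot_perm (adj i) t) l k) * Pm (adj i)"
    if "k < K" "l < K" for p k l
    using Pm_adj[OF assms(1,2) that] Pm_adj[OF assms(1,3) that(2,1)]
    by (metis mult.assoc sg_comm)
  then show ?thesis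
    unfolding cas2_def sum_distrib_left sum_distrib_right by (intro sum.cong refl) auto
qed

lemma conj_cas2:
  assumes "i \<in> {1..<d}" "s \<in> MNV_slots d" "t \<in> MNV_slots d"
  shows "Pm (adj i) * cas2 s t * Pm (adj i) = cas2 (slot_perm (adj i) s) (slot_perm (adj i) t)"
  by (simp add: Pm_cas2[OF assms] mult.assoc Pm_adj_square[OF assms(1)] cas2_e)

lemma Pm_cas:
  assumes "i \<in> {1..<d}" "S \<subseteq> MNV_slots d"
  shows "Pm (adj i) * cas S = cas (slot_perm (adj i) ` S) * Pm (adj i)"
proof -
  have "cas (slot_perm (adj i) ` S) * Pm (adj i)
      = (\<Sum>s\<in>S. \<Sum>t\<in>S. cas2 (slot_perm (adj i) s) (slot_perm (adj i) t) * Pm (adj i))"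
    by (simp add: cas_eq sum.reindex[OF inj_slot_perm] sum_distrib_right)
  also have "\<dots> = (\<Sum>s\<in>S. \<Sum>t\<in>S. Pm (adj i) * cas2 s t)"
    by (intro sum.cong refl) (simp only: Pm_cas2[OF assms(1)] subsetD[OF assms(2)])
  finally show ?thesis by (simp add: cas_eq sum_distrib_left)
qed

lemma commute_cas:
  assumes "S \<subseteq> T \<or> T \<subseteq> S \<or> S \<inter> T = {}" "S \<subseteq> MNV_slots d" "T \<subseteq> MNV_slots d"
  shows "commute (cas S) (cas T)"
  unfolding commute_def using assms cas_cas[of S T] cas_cas[of T S] cas_disjoint[of S T] by metis

lemma commute_e: "commute e (cas S)" "commute (cas S) e" "commute e (Pm \<pi>)" "commute (Pm \<pi>) e"
  by (simp_all add: commute_def cas_e Pm_e)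

text \<open>Only adjacent positions are covered by an axiom. Conjugation by \<open>adj l\<close>
  carries slot l to slot l + 1 and the transposition (k l) to (k l+1), which drives an induction on
  the distance.\<close>

lemma cas2_transpose:
  assumes "1 \<le> k" "k < l" "l \<le> d"
  shows "cas2 (SlotV k) (SlotV l) = Pm (Transposition.transpose k l)"
  using Suc_leI[OF \<open>k < l\<close>] \<open>l \<le> d\<close>
proof (induction l rule: dec_induct[of "Suc k"])
  case base
  then show ?case using assms by (intro cas2_adj) auto
next
  case (step l)
  have l: "l \<in> {1..<d}" using step.hyps step.prems assms by auto
  have tr: "adj l \<circ> Transposition.transpose k l \<circ> adj l = Transposition.transpose k (Suc l)"
    using step.hyps by (auto simp: fun_eq_iff Transposition.transpose_def)
  have p: "Transposition.transpose k l permutes {1..d}"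
    using l assms(1) step.hyps by (intro permutes_swap_id) auto
  have "cas2 (SlotV k) (SlotV (Suc l)) = Pm (adj l) * cas2 (SlotV k) (SlotV l) * Pm (adj l)"
    using l assms(1) step.hyps by (subst conj_cas2) (auto simp: Transposition.transpose_def)
  also have "\<dots> = Pm (adj l \<circ> Transposition.transpose k l \<circ> adj l)"
    unfolding step.IH[OF Suc_leD[OF step.prems]] Pm_comp[OF adj_permutes[OF l] p]
      Pm_comp[OF permutes_compose[OF p adj_permutes[OF l]] adj_permutes[OF l]] ..
  finally show ?case by (simp only: tr)
qed

text \<open>The constant \<kappa>_V is multiplied by \<open>e\<close> because the unit of the corner
  is \<open>e\<close>. The index 0 needs its own branch for z, since there \<open>i - 1\<close> is
  truncated.\<close>

fun gen :: "braid_gen \<Rightarrow> 'r" where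
  "gen (GenX i) = scal (1/2) * (cas (MV_slots i) - cas (MV_slots (i - 1)))"
| "gen (GenY i) = scal (1/2) * (cas (NV_slots i) - cas (NV_slots (i - 1)))"
| "gen (GenZ i) = (if i = 0 then scal (1/2) * (cas (MNV_slots 0) - cas (MV_slots 0) - cas (NV_slots 0))
     else scal (1/2) * (cas (MNV_slots i) - cas (MNV_slots (i - 1)) + scal kV * e))"
| "gen (GenP \<pi>) = Pm \<pi>"

lemma e_idem: "e * e = e"
  using Pm_e(1)[of id] by (simp add: Pm_id)

lemma gen_e: "e * gen g = gen g" "gen g * e = gen g"
proof -
  have sc: "e * (scal c * x) = scal c * (e * x)" for c x
    by (metis mult.assoc scal_comm)
  have "e * gen g = gen g \<and> gen g * e = gen g"
    by (cases g) (auto simp: sc mult.assoc algebra_simps cas_e Pm_e e_idem)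
  then show "e * gen g = gen g" "gen g * e = gen g" by auto
qed

text \<open>In \<open>cas_insert\<close> the 1/2 cancels the factor 2, and the term of the new slot
  with itself contributes \<kappa>_V/2. For z the shift in the definition adds a second
  \<kappa>_V/2.\<close>

lemma gen_eq:
  assumes "i \<in> {1..d}"
  shows "gen (GenX i) = (\<Sum>s\<in>MV_slots (i - 1). cas2 s (SlotV i)) + scal (kV/2) * e"
    "gen (GenY i) = (\<Sum>s\<in>NV_slots (i - 1). cas2 s (SlotV i)) + scal (kV/2) * e"
    "gen (GenZ i) = (\<Sum>s\<in>MNV_slots (i - 1). cas2 s (SlotV i)) + scal kV * e"
proof -
  obtain k where k: "i = Suc k" "k < d" using assms by (cases i) auto
  have h: "scal (1/2) * (scal kV * e) = scal (kV/2) * e"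
    by (simp flip: mult.assoc scal_mult)
  have hh: "scal (kV/2) * e + scal (kV/2) * e = scal kV * e"
    by (simp flip: distrib_right scal_add)
  have V: "cas2 (SlotV i) (SlotV i) = scal kV * e"
    using assms by (rule cas2_V)
  have sub: "insert (SlotV i) (MV_slots k) \<subseteq> MNV_slots d" "insert (SlotV i) (NV_slots k) \<subseteq> MNV_slots d"
    "insert (SlotV i) (MNV_slots k) \<subseteq> MNV_slots d"
    using slots_mono[of k d] k by auto
  have ins: "scal (1/2) * (cas (insert (SlotV i) S) - cas S)
      = (\<Sum>s\<in>S. cas2 s (SlotV i)) + scal (kV/2) * e"
    if "insert (SlotV i) S \<subseteq> MNV_slots d" "SlotV i \<notin> S" for S
    unfolding cas_insert[OF that] V by (simp add: distrib_left half h)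
  show "gen (GenX i) = (\<Sum>s\<in>MV_slots (i - 1). cas2 s (SlotV i)) + scal (kV/2) * e"
    using ins[OF sub(1)] k by (simp add: slots_Suc)
  show "gen (GenY i) = (\<Sum>s\<in>NV_slots (i - 1). cas2 s (SlotV i)) + scal (kV/2) * e"
    using ins[OF sub(2)] k by (simp add: slots_Suc)
  show "gen (GenZ i) = (\<Sum>s\<in>MNV_slots (i - 1). cas2 s (SlotV i)) + scal kV * e"
    using ins[OF sub(3)] k
    by (simp add: slots_Suc distrib_left[of _ "_ - _"] h hh add.assoc)
qed

text \<open>Conjugation by \<open>adj i\<close> turns every \<Omega>(s, i) into \<Omega>(s, i+1),
  since it fixes the earlier slots \<open>s\<close>. The image of the next generator has just one
  more summand, \<Omega>(i, i+1), which is the transposition itself.\<close>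

lemma conj_gen:
  assumes "i \<in> {1..<d}"
  shows "gen (GenX (Suc i)) - Pm (adj i) * gen (GenX i) * Pm (adj i) = Pm (adj i)"
    "gen (GenY (Suc i)) - Pm (adj i) * gen (GenY i) * Pm (adj i) = Pm (adj i)"
proof -
  obtain k where k: "i = Suc k" using assms by (cases i) auto
  have i: "i \<in> {1..d}" "Suc i \<in> {1..d}" using assms by auto
  have sc: "Pm (adj i) * (scal c * e) * Pm (adj i) = scal c * e" for c
    by (metis Pm_adj_square Pm_e(1) assms mult.assoc scal_comm)
  have fixed: "slot_perm (adj i) s = s" if "s \<in> MV_slots k \<union> NV_slots k" for s
    using that k by (auto simp: MV_slots_def NV_slots_def Transposition.transpose_def)
  have conj: "Pm (adj i) * ((\<Sum>s\<in>S. cas2 s (SlotV i)) + scal (kV/2) * e) * Pm (adj i)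
      = (\<Sum>s\<in>S. cas2 s (SlotV (Suc i))) + scal (kV/2) * e" if "S \<subseteq> MV_slots k \<union> NV_slots k" for S
  proof -
    have "Pm (adj i) * (\<Sum>s\<in>S. cas2 s (SlotV i)) * Pm (adj i) = (\<Sum>s\<in>S. cas2 s (SlotV (Suc i)))"
      unfolding sum_distrib_left sum_distrib_right
    proof (intro sum.cong refl)
      fix s assume "s \<in> S"
      then have s: "s \<in> MV_slots k \<union> NV_slots k" using that by auto
      moreover have "s \<in> MNV_slots d"
        using s slots_mono[of k d] k assms by auto
      ultimately show "Pm (adj i) * cas2 s (SlotV i) * Pm (adj i) = cas2 s (SlotV (Suc i))"
        using conj_cas2[OF assms, of s "SlotV i"] i by (simp add: fixed)
    qed
    then show ?thesis by (simp add: distrib_left distrib_right sc)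
  qed
  show "gen (GenX (Suc i)) - Pm (adj i) * gen (GenX i) * Pm (adj i) = Pm (adj i)"
    unfolding gen_eq(1)[OF i(1)] gen_eq(1)[OF i(2)] using k cas2_adj[OF assms] conj[of "MV_slots k"]
    by (simp add: slots_Suc algebra_simps)
  show "gen (GenY (Suc i)) - Pm (adj i) * gen (GenY i) * Pm (adj i) = Pm (adj i)"
    unfolding gen_eq(2)[OF i(1)] gen_eq(2)[OF i(2)] using k cas2_adj[OF assms] conj[of "NV_slots k"]
    by (simp add: slots_Suc algebra_simps)
qed

text \<open>By \<open>conj_gen\<close>, relation (R4) becomes this identity of permutations. The
  nesting to the right is the normal form of \<open>mult.assoc\<close>.\<close>

lemma braid_relation:
  assumes "i \<in> {1..<d}" "Suc i \<in> {1..<d}"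
  shows "Pm (adj i) * (Pm (adj (Suc i)) * (Pm (adj i) * (Pm (adj (Suc i)) * Pm (adj i)))) = Pm (adj (Suc i))"
proof -
  note p = adj_permutes[OF assms(1)] adj_permutes[OF assms(2)]
  have "adj i \<circ> (adj (Suc i) \<circ> (adj i \<circ> (adj (Suc i) \<circ> adj i))) = adj (Suc i)"
    by (auto simp: fun_eq_iff Transposition.transpose_def)
  then show ?thesis
    using p by (simp only: Pm_comp permutes_compose)
qed

section \<open>Evaluation of noncommutative polynomials in the corner\<close>

definition Phi :: "braid_poly \<Rightarrow> 'r" where
  "Phi p = (\<Sum>w\<in>Poly_Mapping.keys p. scal (Poly_Mapping.lookup p w) * (e * prod_list (map gen w)))"

lemma Phi_superset:
  assumes "finite A" "Poly_Mapping.keys p \<subseteq> A"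
  shows "Phi p = (\<Sum>w\<in>A. scal (Poly_Mapping.lookup p w) * (e * prod_list (map gen w)))"
  unfolding Phi_def
  by (rule sum.mono_neutral_left) (use assms in \<open>auto simp: in_keys_iff scal_zero\<close>)

lemma Phi_add: "Phi (p + q) = Phi p + Phi q"
proof -
  let ?A = "Poly_Mapping.keys p \<union> Poly_Mapping.keys q"
  have "Phi r = (\<Sum>w\<in>?A. scal (Poly_Mapping.lookup r w) * (e * prod_list (map gen w)))"
    if "r \<in> {p, q, p + q}" for r
    using that keys_add[of p q] by (intro Phi_superset) auto
  then show ?thesis
    by (simp add: lookup_add scal_add distrib_right sum.distrib)
qed

lemma Phi_zero: "Phi 0 = 0"
  by (simp add: Phi_def)

lemma Phi_diff: "Phi (p - q) = Phi p - Phi q"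
  using Phi_add[of "p - q" q] by (simp add: algebra_simps)

lemma Phi_sum: "Phi (sum f A) = (\<Sum>x\<in>A. Phi (f x))"
  by (induction A rule: infinite_finite_induct) (simp_all add: Phi_add Phi_zero)

lemma Phi_fscale: "Phi (fscale c p) = scal c * Phi p"
proof -
  have "Phi (fscale c p) = (\<Sum>w\<in>Poly_Mapping.keys p.
      scal (Poly_Mapping.lookup (fscale c p) w) * (e * prod_list (map gen w)))"
    by (intro Phi_superset keys_fscale) simp
  then show ?thesis
    by (simp add: Phi_def fscale_lookup scal_mult sum_distrib_left mult.assoc)
qed

lemma Phi_single: "Phi (Poly_Mapping.single w c) = scal c * (e * prod_list (map gen w))"
proof -
  have "Phi (Poly_Mapping.single w c)
      = (\<Sum>v\<in>{w}. scal (Poly_Mapping.lookup (Poly_Mapping.single w c) v) * (e * prod_list (map gen v)))"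
    by (intro Phi_superset) auto
  then show ?thesis by simp
qed

text \<open>The factor \<open>e\<close> in front of every word serves this case: the empty product
  is the unit of the ring, but the unit of the corner is wanted.\<close>

lemma Phi_one: "Phi 1 = e"
  using Phi_single[of 0 1] by (simp add: scal_one zero_list_def flip: single_one)

lemma Phi_gen: "Phi (fbasis [g]) = gen g"
  by (simp add: fbasis_def Phi_single scal_one gen_e)

text \<open>This makes \<open>Phi\<close> multiplicative: the \<open>e\<close> in front of the
  second of two words is absorbed by the last generator of the first, or by its leading
  \<open>e\<close> if that word is empty.\<close>

lemma e_prod_list: "e * prod_list (map gen w) * e = e * prod_list (map gen w)"
  by (induction w rule: rev_induct) (simp_all add: e_idem mult.assoc gen_e)

lemma Phi_mult: "Phi (p * q) = Phi p * Phi q"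
proof -
  have decomp: "r = (\<Sum>w\<in>Poly_Mapping.keys r. Poly_Mapping.single w (Poly_Mapping.lookup r w))"
    for r :: braid_poly
    using flift_fbasis_id[of r] by (simp add: flift_def fscale_fbasis)
  have single: "Phi (Poly_Mapping.single v c * Poly_Mapping.single w c')
      = Phi (Poly_Mapping.single v c) * Phi (Poly_Mapping.single w c')" for v w c c'
  proof -
    have "(scal c * (e * prod_list (map gen v))) * (scal c' * (e * prod_list (map gen w)))
        = scal c * scal c' * ((e * prod_list (map gen v) * e) * prod_list (map gen w))"
      by (metis mult.assoc scal_comm)
    then show ?thesis
      unfolding e_prod_list
      by (simp add: mult_single Phi_single plus_list_def scal_mult mult.assoc)
  qed
  have "Phi (p * q) = (\<Sum>v\<in>Poly_Mapping.keys p. \<Sum>w\<in>Poly_Mapping.keys q.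
      Phi (Poly_Mapping.single v (Poly_Mapping.lookup p v) * Poly_Mapping.single w (Poly_Mapping.lookup q w)))"
    by (subst (1) decomp[of p], subst (1) decomp[of q]) (simp add: sum_product Phi_sum)
  also have "\<dots> = Phi (\<Sum>v\<in>Poly_Mapping.keys p. Poly_Mapping.single v (Poly_Mapping.lookup p v))
      * Phi (\<Sum>w\<in>Poly_Mapping.keys q. Poly_Mapping.single w (Poly_Mapping.lookup q w))"
    by (simp only: single Phi_sum sum_product)
  finally show ?thesis by (simp only: decomp[symmetric])
qed

lemma Phi_generators [simp]:
  "Phi (xg i) = gen (GenX i)" "Phi (yg i) = gen (GenY i)" "Phi (zg i) = gen (GenZ i)"
  "Phi (pg \<pi>) = Pm \<pi>" "Phi (tg i) = Pm (adj i)" "Phi (tt i j) = Pm (Transposition.transpose i j)"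
  unfolding xg_def yg_def zg_def tg_def tt_def pg_def Phi_gen by simp_all

lemma Phi_mm:
  assumes "1 \<le> i" "i < j" "j \<le> d"
  shows "Phi (mm i j) = Pm (Transposition.transpose i j)"
proof -
  obtain k where k: "j = Suc k" "k \<in> {1..<d}" using assms by (cases j) auto
  have s: "Phi (xg j - tg (j - 1) * xg (j - 1) * tg (j - 1)) = Pm (adj k)"
    using conj_gen(1)[OF k(2)] k(1) by (simp add: Phi_diff Phi_mult)
  show ?thesis
  proof (cases "j = i + 1")
    case True
    then show ?thesis using s k by (simp add: mm_def)
  next
    case False
    have tr: "Transposition.transpose i k \<circ> adj k \<circ> Transposition.transpose i k
        = Transposition.transpose i (Suc k)"
      using False assms k by (auto simp: fun_eq_iff Transposition.transpose_def)
    have p: "Transposition.transpose i k permutes {1..d}"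
      using k assms by (intro permutes_swap_id) auto
    have "Phi (mm i j) = Pm (Transposition.transpose i k) * Pm (adj k) * Pm (Transposition.transpose i k)"
      using False k(1) s by (simp add: mm_def Phi_mult)
    also have "\<dots> = Pm (Transposition.transpose i k \<circ> adj k \<circ> Transposition.transpose i k)"
      using Pm_comp[OF p adj_permutes[OF k(2)]]
        Pm_comp[OF permutes_compose[OF adj_permutes[OF k(2)] p] p] by simp
    finally show ?thesis by (simp only: tr k(1))
  qed
qed

lemma Phi_mg:
  assumes "j \<in> {1..d}"
  shows "Phi (mg j) = (\<Sum>k\<in>{1..<j}. cas2 (SlotV k) (SlotV j))"
  unfolding mg_def Phi_sum using assms
  by (intro sum.cong refl) (auto simp: Phi_mm cas2_transpose)

text \<open>The Casimir elements of the intermediate levels telescope. Relation (R2) thereby reduces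
  to commutation with three Casimir elements and a central multiple of \<open>e\<close>.\<close>

lemma sum_gen_Z:
  assumes "i \<le> d"
  shows "(\<Sum>k\<in>{0..i}. gen (GenZ k))
    = scal (1/2) * (cas (MNV_slots i) - cas (MV_slots 0) - cas (NV_slots 0)) + scal (of_nat i * kV / 2) * e"
  using assms
proof (induction i)
  case 0
  then show ?case by (simp add: scal_zero)
next
  case (Suc i)
  have "scal (1/2) * (scal kV * e) = scal (kV/2) * e"
    by (simp flip: mult.assoc scal_mult)
  moreover have "scal (of_nat (Suc i) * kV / 2) = scal (of_nat i * kV / 2) + scal (kV / 2)"
    by (simp add: algebra_simps add_divide_distrib flip: scal_add)
  ultimately show ?case
    using Suc by (simp add: algebra_simps)
qed


text \<open>The image of x_i involves the Casimir elements of levels i and i - 1, and the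
  alternatives list ways for \<open>S\<close> to be nested with, or disjoint from, both slot sets.
  The image of z_0 involves three Casimir elements, whose slot sets all lie in
  \<open>MNV_slots 0\<close>.\<close>

lemma commute_gen:
  assumes S: "S \<subseteq> MNV_slots d" and i: "i \<le> d"
  shows "MV_slots i \<subseteq> S \<or> S \<subseteq> MV_slots (i - 1) \<or> S \<inter> MV_slots i = {} \<Longrightarrow> commute (cas S) (gen (GenX i))"
    and "NV_slots i \<subseteq> S \<or> S \<subseteq> NV_slots (i - 1) \<or> S \<inter> NV_slots i = {} \<Longrightarrow> commute (cas S) (gen (GenY i))"
    and "MNV_slots i \<subseteq> S \<or> S \<subseteq> MNV_slots (i - 1) \<and> 0 < i \<Longrightarrow> commute (cas S) (gen (GenZ i))"
proof -
  note sub = slots_mono[of "i - 1" i] slots_mono[OF i] slots_mono[of "i - 1" d]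
    slots_mono(4,5)[of i i] slots_mono(4,5)[of 0 i]
  show "MV_slots i \<subseteq> S \<or> S \<subseteq> MV_slots (i - 1) \<or> S \<inter> MV_slots i = {} \<Longrightarrow> commute (cas S) (gen (GenX i))"
    unfolding gen.simps using S sub(1,4,7,9,12) i
    by (intro commute_intros commute_scal commute_cas) auto
  show "NV_slots i \<subseteq> S \<or> S \<subseteq> NV_slots (i - 1) \<or> S \<inter> NV_slots i = {} \<Longrightarrow> commute (cas S) (gen (GenY i))"
    unfolding gen.simps using S sub i
    by (intro commute_intros commute_scal commute_cas) auto
  show "MNV_slots i \<subseteq> S \<or> S \<subseteq> MNV_slots (i - 1) \<and> 0 < i \<Longrightarrow> commute (cas S) (gen (GenZ i))"
    unfolding gen.simps using S sub i
    by (auto intro!: commute_intros commute_scal commute_cas commute_e)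
qed

lemma commute_e_gen: "commute e (gen g)"
  by (simp add: commute_def gen_e)

text \<open>As i is neither j nor j + 1, the levels i and i - 1 both differ from j, so
  \<open>adj j\<close> preserves every slot set that occurs in the generator.\<close>

lemma commute_Pm_gen:
  assumes "j \<in> {1..<d}" "i \<le> d" "i \<noteq> j" "i \<noteq> j + 1"
  shows "1 \<le> i \<Longrightarrow> commute (Pm (adj j)) (gen (GenX i))" "1 \<le> i \<Longrightarrow> commute (Pm (adj j)) (gen (GenY i))"
    "commute (Pm (adj j)) (gen (GenZ i))"
proof -
  have cm: "commute (Pm (adj j)) (cas S)" if "slot_perm (adj j) ` S = S" "S \<subseteq> MNV_slots d" for S
    unfolding commute_def Pm_cas[OF assms(1) that(2)] that(1) ..
  have ne: "i - 1 \<noteq> j" "0 \<noteq> j" "1 \<le> j" using assms by auto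
  note fixed = slot_perm_slots[OF assms(3) ne(3)] slot_perm_slots[OF ne(1,3)] slot_perm_slots[OF ne(2,3)]
  have "i - 1 \<le> d" using assms by auto
  note sub = slots_mono[OF assms(2)] slots_mono[OF this] slots_mono[of 0 d, OF le0]
  show "commute (Pm (adj j)) (gen (GenX i))" "commute (Pm (adj j)) (gen (GenY i))"
    unfolding gen.simps by (intro commute_intros commute_scal cm fixed sub)+
  show "commute (Pm (adj j)) (gen (GenZ i))"
    unfolding gen.simps
    by (split if_split) (intro conjI impI commute_intros commute_scal commute_e cm fixed sub)
qed

text \<open>The Casimir element of level i, the one level that \<open>adj i\<close> does not
  preserve, cancels in the sum of the two generators.\<close>

lemma commute_Pm_sum:
  assumes "i \<in> {1..<d}"
  shows "commute (Pm (adj i)) (gen (GenX i) + gen (GenX (i + 1)))"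
    "commute (Pm (adj i)) (gen (GenY i) + gen (GenY (i + 1)))"
proof -
  have cm: "commute (Pm (adj i)) (cas S)" if "slot_perm (adj i) ` S = S" "S \<subseteq> MNV_slots d" for S
    unfolding commute_def Pm_cas[OF assms that(2)] that(1) ..
  have ne: "i - 1 \<noteq> i" "i + 1 \<noteq> i" "1 \<le> i" using assms by auto
  note fixed = slot_perm_slots[OF ne(1,3)] slot_perm_slots[OF ne(2,3)]
  have sub: "i - 1 \<le> d" "i + 1 \<le> d" using assms by auto
  note sub = slots_mono[OF sub(1)] slots_mono[OF sub(2)]
  have X: "gen (GenX i) + gen (GenX (i + 1)) = scal (1/2) * (cas (MV_slots (i + 1)) - cas (MV_slots (i - 1)))"
    and Y: "gen (GenY i) + gen (GenY (i + 1)) = scal (1/2) * (cas (NV_slots (i + 1)) - cas (NV_slots (i - 1)))"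
    by (simp_all add: algebra_simps)
  show "commute (Pm (adj i)) (gen (GenX i) + gen (GenX (i + 1)))"
    "commute (Pm (adj i)) (gen (GenY i) + gen (GenY (i + 1)))"
    unfolding X Y by (intro commute_intros commute_scal cm fixed sub)+
qed

text \<open>The images of x_i and y_i each contain the terms \<Omega>(k, i) with the earlier copies
  of V, so one set of them has to be subtracted; the two halves of \<kappa>_V add up to the constant
  of z_i.\<close>

lemma gen_ZXY:
  assumes "i \<in> {1..d}"
  shows "gen (GenZ i) = gen (GenX i) + gen (GenY i) - (\<Sum>k\<in>{1..<i}. cas2 (SlotV k) (SlotV i))"
proof -
  let ?f = "\<lambda>s. cas2 s (SlotV i)"
  have V: "sum ?f (SlotV ` {1..i - 1}) = (\<Sum>k\<in>{1..<i}. cas2 (SlotV k) (SlotV i))"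
    using assms by (subst sum.reindex) (auto simp: inj_on_def intro!: sum.cong)
  note V
  moreover have "sum ?f (MNV_slots (i - 1)) = ?f SlotM + (?f SlotN + sum ?f (SlotV ` {1..i - 1}))"
    unfolding MNV_slots_def by (simp add: image_iff)
  moreover have "sum ?f (MV_slots (i - 1)) = ?f SlotM + sum ?f (SlotV ` {1..i - 1})"
    unfolding MV_slots_def by (simp add: image_iff)
  moreover have "sum ?f (NV_slots (i - 1)) = ?f SlotN + sum ?f (SlotV ` {1..i - 1})"
    unfolding NV_slots_def by (simp add: image_iff)
  moreover have "scal (kV/2) * e + scal (kV/2) * e = scal kV * e"
    by (simp flip: distrib_right scal_add)
  ultimately show ?thesis
    unfolding gen_eq[OF assms] by (simp add: algebra_simps)
qed

lemma Phi_rel: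
  assumes "braid_rel d p q"
  shows "Phi p = Phi q"
  using assms
proof cases
  case group_one
  then show ?thesis by (simp add: Phi_one Pm_id)
next
  case (group_mult \<pi> \<pi>')
  then show ?thesis by (simp add: Phi_mult Pm_comp)
next
  case (xx i j)
  \<comment> \<open>For i < j both slot sets in the image of x_i lie in level j - 1, which is the
    middle alternative of \<open>commute_gen\<close>.\<close>
  have "commute (gen (GenX i)) (gen (GenX j))" if "i \<le> j" "j \<le> d" "1 \<le> i" for i j
  proof (cases "i = j")
    case False
    then have "i \<le> j - 1" "i \<le> d" "i - 1 \<le> j - 1" "i - 1 \<le> d" using that by auto
    note sub = this[THEN slots_mono(1)] this[THEN slots_mono(4)]
    show ?thesis unfolding gen.simps(1)[of i]
      using sub that by (intro commute_intros commute_scal commute_gen(1)) auto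
  qed (simp add: commute_refl)
  then have "commute (gen (GenX i)) (gen (GenX j))"
    using xx by (cases "i \<le> j") (auto simp del: gen.simps intro: commute_sym)
  then show ?thesis using xx by (simp add: Phi_mult commute_def)
next
  case (yy i j)
  have "commute (gen (GenY i)) (gen (GenY j))" if "i \<le> j" "j \<le> d" "1 \<le> i" for i j
  proof (cases "i = j")
    case False
    then have "i \<le> j - 1" "i \<le> d" "i - 1 \<le> j - 1" "i - 1 \<le> d" using that by auto
    note sub = this[THEN slots_mono(2)] this[THEN slots_mono(5)]
    show ?thesis unfolding gen.simps(2)[of i]
      using sub that by (intro commute_intros commute_scal commute_gen(2)) auto
  qed (simp add: commute_refl)
  then have "commute (gen (GenY i)) (gen (GenY j))"
    using yy by (cases "i \<le> j") (auto simp del: gen.simps intro: commute_sym)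
  then show ?thesis using yy by (simp add: Phi_mult commute_def)
next
  case (zz i j)
  have "commute (gen (GenZ i)) (gen (GenZ j))" if "i \<le> j" "j \<le> d" for i j
  proof (cases "i = j")
    case False
    \<comment> \<open>The bounds for level 0 serve the case i = 0, where the Casimir elements of M
      alone and of N alone occur.\<close>
    then have "i \<le> j - 1" "i \<le> d" "i - 1 \<le> j - 1" "i - 1 \<le> d" "0 \<le> j - 1" "0 \<le> d" using that by auto
    note sub = this[THEN slots_mono(3)] this[THEN slots_mono(4)] this[THEN slots_mono(5)]
    show ?thesis unfolding gen.simps(3)[of i] using sub that False
      by (split if_split) (intro conjI impI commute_intros commute_scal commute_gen(3) commute_e_gen; auto)
  qed (simp add: commute_refl)
  then have "commute (gen (GenZ i)) (gen (GenZ j))"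
    using zz by (cases "i \<le> j") (auto simp del: gen.simps intro: commute_sym)
  then show ?thesis using zz by (simp add: Phi_mult commute_def)
next
  case (xt i j)
  then show ?thesis using commute_Pm_gen(1)[of j i] by (simp add: Phi_mult commute_def)
next
  case (yt i j)
  then show ?thesis using commute_Pm_gen(2)[of j i] by (simp add: Phi_mult commute_def)
next
  case (zt i j)
  then show ?thesis using commute_Pm_gen(3)[of j i] by (simp add: Phi_mult commute_def)
next
  case (zx j i)
  \<comment> \<open>Each Casimir element uses a different alternative of \<open>commute_gen\<close>:
    the slots of level i contain those of x_j, the slot of M lies below level j, and the slot of N
    is disjoint from them.\<close>
  have "commute (\<Sum>k\<in>{0..i}. gen (GenZ k)) (gen (GenX j))"
    using zx slots_mono(1)[of 0 "j - 1"] slots_mono(4)[of j i] slots_mono[of 0 d] slots_mono[of i d]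
    unfolding sum_gen_Z[OF \<open>i \<in> {j..d}\<close>[unfolded atLeastAtMost_iff, THEN conjunct2]]
    by (intro commute_intros commute_scal commute_gen(1) commute_e_gen)
      (auto, auto simp: MV_slots_def NV_slots_def)
  then show ?thesis using zx by (simp add: Phi_mult Phi_sum commute_def)
next
  case (zy j i)
  have "commute (\<Sum>k\<in>{0..i}. gen (GenZ k)) (gen (GenY j))"
    using zy slots_mono(2)[of 0 "j - 1"] slots_mono(5)[of j i] slots_mono[of 0 d] slots_mono[of i d]
    unfolding sum_gen_Z[OF \<open>i \<in> {j..d}\<close>[unfolded atLeastAtMost_iff, THEN conjunct2]]
    by (intro commute_intros commute_scal commute_gen(2) commute_e_gen)
      (auto, auto simp: MV_slots_def NV_slots_def)
  then show ?thesis using zy by (simp add: Phi_mult Phi_sum commute_def)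
next
  case (tx i)
  then show ?thesis using commute_Pm_sum(1)[of i] by (simp add: Phi_mult Phi_add commute_def)
next
  case (ty i)
  then show ?thesis using commute_Pm_sum(2)[of i] by (simp add: Phi_mult Phi_add commute_def)
next
  case (ttx i)
  then have i: "i \<in> {1..<d}" "Suc i \<in> {1..<d}" by auto
  show ?thesis unfolding ttx(1,2)
    using conj_gen(1)[OF i(1)] conj_gen(1)[OF i(2)] braid_relation[OF i]
    by (simp add: Phi_mult Phi_diff mult.assoc)
next
  case (tty i)
  then have i: "i \<in> {1..<d}" "Suc i \<in> {1..<d}" by auto
  show ?thesis unfolding tty(1,2)
    using conj_gen(2)[OF i(1)] conj_gen(2)[OF i(2)] braid_relation[OF i]
    by (simp add: Phi_mult Phi_diff mult.assoc)
next
  case (xy i)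
  then show ?thesis using conj_gen[of i] by (simp add: Phi_mult Phi_diff)
next
  case (zm i)
  then show ?thesis using gen_ZXY[of i] Phi_mg[of i] by (simp add: Phi_add Phi_diff)
qed

end


section \<open>Signs of permutations of homogeneous factors\<close>

definition pairs :: "nat \<Rightarrow> (nat \<times> nat) set" where
  "pairs d = {(a, b). a \<in> {1..d} \<and> b \<in> {1..d} \<and> a < b}"

text \<open>The inversion is written as a comparison of two orders, not as an ordered inequality, so
  that the value depends only on the unordered pair of different positions; the reindexing below
  relies on this.\<close>

definition inv_sign :: "(nat \<Rightarrow> nat) \<Rightarrow> (nat \<Rightarrow> bit) \<Rightarrow> nat \<Rightarrow> nat \<Rightarrow> complex" where
  "inv_sign \<pi> c a b = (if c a = 1 \<and> c b = 1 \<and> (a < b) \<noteq> (\<pi> a < \<pi> b) then - 1 else 1)"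

text \<open>The Koszul sign of moving a factor of parity \<open>c i\<close> from position i to
  position \<open>\<pi> i\<close>: it counts the inversions among odd factors.\<close>

definition perm_sign :: "nat \<Rightarrow> (nat \<Rightarrow> nat) \<Rightarrow> (nat \<Rightarrow> bit) \<Rightarrow> complex" where
  "perm_sign d \<pi> c = (\<Prod>(a, b)\<in>pairs d. inv_sign \<pi> c a b)"

lemma finite_pairs: "finite (pairs d)"
  by (rule finite_subset[of _ "{1..d} \<times> {1..d}"]) (auto simp: pairs_def)

text \<open>A permutation acts bijectively on unordered pairs of positions. Pairs are represented in
  increasing order, so the witnesses sort the image again.\<close>

lemma prod_pairs_permute:
  fixes F :: "nat \<Rightarrow> nat \<Rightarrow> complex"
  assumes p: "p permutes {1..d}"
    and sym: "\<And>a b. \<lbrakk>a \<in> {1..d}; b \<in> {1..d}; a \<noteq> b\<rbrakk> \<Longrightarrow> F a b = F b a"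
  shows "(\<Prod>(a, b)\<in>pairs d. F (p a) (p b)) = (\<Prod>(a, b)\<in>pairs d. F a b)"
proof (rule prod.reindex_bij_witness[where
      i = "\<lambda>(a, b). if Hilbert_Choice.inv p a < Hilbert_Choice.inv p b then (Hilbert_Choice.inv p a, Hilbert_Choice.inv p b) else (Hilbert_Choice.inv p b, Hilbert_Choice.inv p a)"
      and j = "\<lambda>(a, b). if p a < p b then (p a, p b) else (p b, p a)"])
  note mem = permutes_in_image[OF p] permutes_in_image[OF permutes_inv[OF p]]
  have inj: "p a = p b \<longleftrightarrow> a = b" "Hilbert_Choice.inv p a = Hilbert_Choice.inv p b \<longleftrightarrow> a = b" for a b
    using permutes_inj[OF p] permutes_inj[OF permutes_inv[OF p]] by (auto dest: injD)
  fix x assume x: "x \<in> pairs d"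
  obtain a b where ab: "x = (a, b)" "a \<in> {1..d}" "b \<in> {1..d}" "a < b"
    using x by (auto simp: pairs_def)
  have ne: "p a \<noteq> p b" "Hilbert_Choice.inv p a \<noteq> Hilbert_Choice.inv p b" using ab by (auto simp: inj)
  show "(\<lambda>(a, b). if Hilbert_Choice.inv p a < Hilbert_Choice.inv p b then (Hilbert_Choice.inv p a, Hilbert_Choice.inv p b) else (Hilbert_Choice.inv p b, Hilbert_Choice.inv p a))
      ((\<lambda>(a, b). if p a < p b then (p a, p b) else (p b, p a)) x) = x"
    using ab by (auto simp: permutes_inverses[OF p])
  show "(\<lambda>(a, b). if p a < p b then (p a, p b) else (p b, p a)) x \<in> pairs d"
    using ab ne mem by (auto simp: pairs_def simp del: atLeastAtMost_iff)
  show "(\<lambda>(a, b). if p a < p b then (p a, p b) else (p b, p a))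
      ((\<lambda>(a, b). if Hilbert_Choice.inv p a < Hilbert_Choice.inv p b then (Hilbert_Choice.inv p a, Hilbert_Choice.inv p b) else (Hilbert_Choice.inv p b, Hilbert_Choice.inv p a)) x) = x"
    using ab by (auto simp: permutes_inverses[OF p])
  show "(\<lambda>(a, b). if Hilbert_Choice.inv p a < Hilbert_Choice.inv p b then (Hilbert_Choice.inv p a, Hilbert_Choice.inv p b) else (Hilbert_Choice.inv p b, Hilbert_Choice.inv p a)) x \<in> pairs d"
    using ab ne mem by (auto simp: pairs_def simp del: atLeastAtMost_iff)
  show "(case (\<lambda>(a, b). if p a < p b then (p a, p b) else (p b, p a)) x of (a, b) \<Rightarrow> F a b)
      = (case x of (a, b) \<Rightarrow> F (p a) (p b))"
    using ab ne mem sym[of "p a" "p b"] by (auto simp del: atLeastAtMost_iff)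
qed

text \<open>The composite inverts a pair precisely when one, but not both, of \<open>\<pi>'\<close>
  on the pair and \<open>\<pi>\<close> on its image does so. After \<open>\<pi>'\<close> the
  parities sit at new positions, hence the composition with its inverse.\<close>

lemma perm_sign_comp:
  assumes p: "\<pi> permutes {1..d}" "\<pi>' permutes {1..d}"
  shows "perm_sign d (\<pi> \<circ> \<pi>') c = perm_sign d \<pi>' c * perm_sign d \<pi> (c \<circ> Hilbert_Choice.inv \<pi>')"
proof -
  have "perm_sign d (\<pi> \<circ> \<pi>') c
      = (\<Prod>(a, b)\<in>pairs d. inv_sign \<pi>' c a b * inv_sign \<pi> (c \<circ> Hilbert_Choice.inv \<pi>') (\<pi>' a) (\<pi>' b))"
    unfolding perm_sign_def
  proof (intro prod.cong refl)
    fix x assume "x \<in> pairs d"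
    then obtain a b where x: "x = (a, b)" "a < b" by (auto simp: pairs_def)
    then have ne: "\<pi>' a \<noteq> \<pi>' b" using permutes_inj[OF p(2)] by (auto dest: injD)
    show "(case x of (a, b) \<Rightarrow> inv_sign (\<pi> \<circ> \<pi>') c a b)
      = (case x of (a, b) \<Rightarrow> inv_sign \<pi>' c a b * inv_sign \<pi> (c \<circ> Hilbert_Choice.inv \<pi>') (\<pi>' a) (\<pi>' b))"
      using x(2) ne by (auto simp: x(1) inv_sign_def permutes_inverses[OF p(2)])
  qed
  also have "\<dots> = perm_sign d \<pi>' c
      * (\<Prod>(a, b)\<in>pairs d. inv_sign \<pi> (c \<circ> Hilbert_Choice.inv \<pi>') (\<pi>' a) (\<pi>' b))"
    by (simp add: perm_sign_def prod.distrib case_prod_unfold)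
  also have "(\<Prod>(a, b)\<in>pairs d. inv_sign \<pi> (c \<circ> Hilbert_Choice.inv \<pi>') (\<pi>' a) (\<pi>' b)) = perm_sign d \<pi> (c \<circ> Hilbert_Choice.inv \<pi>')"
    unfolding perm_sign_def
  proof (rule prod_pairs_permute[OF p(2)])
    fix a b :: nat assume "a \<noteq> b"
    then show "inv_sign \<pi> (c \<circ> Hilbert_Choice.inv \<pi>') a b = inv_sign \<pi> (c \<circ> Hilbert_Choice.inv \<pi>') b a"
      using permutes_inj[OF p(1)] unfolding inv_sign_def
      by (metis injD linorder_neqE_nat order_less_asym)
  qed
  finally show ?thesis .
qed

lemma perm_sign_id: "perm_sign d id c = 1"
  by (auto simp: perm_sign_def inv_sign_def intro!: prod.neutral)

text \<open>An adjacent transposition inverts a single pair, so only that factor of the product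
  differs from 1.\<close>

lemma perm_sign_adj:
  assumes "i \<in> {1..<d}"
  shows "perm_sign d (adj i) c = ksgn (c i * c (Suc i))"
proof -
  have mono: "adj i a < adj i b" if "a < b" "(a, b) \<noteq> (i, Suc i)" for a b
    using that by (auto simp: Transposition.transpose_def)
  have "perm_sign d (adj i) c = (\<Prod>(a, b)\<in>{(i, Suc i)}. inv_sign (adj i) c a b)"
    unfolding perm_sign_def
  proof (intro prod.mono_neutral_right finite_pairs)
    show "{(i, Suc i)} \<subseteq> pairs d" using assms by (auto simp: pairs_def)
    show "\<forall>x\<in>pairs d - {(i, Suc i)}. (case x of (a, b) \<Rightarrow> inv_sign (adj i) c a b) = 1"
    proof
      fix x assume "x \<in> pairs d - {(i, Suc i)}"
      then obtain a b where "x = (a, b)" "a < b" "(a, b) \<noteq> (i, Suc i)" by (auto simp: pairs_def)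
      then show "(case x of (a, b) \<Rightarrow> inv_sign (adj i) c a b) = 1"
        using mono[of a b] by (simp add: inv_sign_def)
    qed
  qed
  then show ?thesis
    by (cases "c i"; cases "c (Suc i)") (simp_all add: inv_sign_def ksgn_def)
qed


section \<open>The tensor product as the image of a projector\<close>

interpretation fs_pair: vector_space_pair fscale fscale
  by unfold_locales

text \<open>A basis of \<open>U\<close> is extended to one of the whole space; \<open>g\<close>
  kills the former and fixes the added vectors. The complement exists by choice, and no
  compatibility with gradings is claimed.\<close>

lemma projector_exists:
  fixes U C :: "('g \<Rightarrow>\<^sub>0 complex) set"
  assumes U: "fs.subspace U" "U \<subseteq> C" and C: "C = {f. Poly_Mapping.keys f \<subseteq> G}"
  shows "\<exists>e :: 'g endo. (\<forall>f\<in>U. app e f = 0) \<and> (\<forall>f\<in>C. app e f - f \<in> U) \<and> (\<forall>f. app e f \<in> C)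
    \<and> e * e = e"
proof -
  obtain B where B: "B \<subseteq> U" "fs.independent B" "U \<subseteq> fs.span B"
    by (rule fs.basis_exists)
  let ?B = "fs.extend_basis B"
  obtain g where g: "Vector_Spaces.linear fscale fscale g" "\<forall>b\<in>?B. g b = (if b \<in> B then 0 else b)"
    using fs_pair.linear_independent_extend[OF fs.independent_extend_basis[OF B(2)],
      of "\<lambda>b. if b \<in> B then 0 else b"] by blast
  interpret g: Vector_Spaces.linear fscale fscale g by fact
  have BB: "B \<subseteq> ?B" by (rule fs.extend_basis_superset[OF B(2)])
  have gU: "g f = 0" if "f \<in> U" for f
  proof -
    have "f \<in> fs.span B" using that B(3) by auto
    then show ?thesis
    proof (induction rule: fs.span_induct_alt)
      case (step c b v)
      then show ?case using g(2) BB by (auto simp: g.add g.scale)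
    qed simp
  qed
  have gd: "g f - f \<in> U" for f
  proof -
    have "f \<in> fs.span ?B" using fs.span_extend_basis[OF B(2)] by simp
    then show ?thesis
    proof (induction rule: fs.span_induct_alt)
      case base
      then show ?case by (simp add: fs.subspace_0[OF U(1)])
    next
      case (step c b v)
      have "g b - b \<in> U"
        using step(1) g(2) B(1) by (auto simp: fs.subspace_0[OF U(1)] fs.subspace_neg[OF U(1)])
      then have "fscale c (g b - b) + (g v - v) \<in> U"
        using step by (intro fs.subspace_add[OF U(1)] fs.subspace_scale[OF U(1)])
      then show ?case by (simp add: g.add g.scale fs.scale_right_diff_distrib algebra_simps)
    qed
  qed
  \<comment> \<open>This discards everything outside \<open>G\<close>. Afterwards \<open>g\<close>
    cannot leave \<open>C\<close>, because it moves vectors only by elements of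
    \<open>U\<close>.\<close>
  define r :: "'g endo" where "r = efl (\<lambda>x. if x \<in> G then fbasis x else 0)"
  have rC: "app r f \<in> C" for f
  proof -
    have "Poly_Mapping.lookup (app r f) x = 0" if "x \<notin> G" for x
      unfolding r_def app_efl flift_def lookup_sum
      using that by (intro sum.neutral) (auto simp: fscale_lookup fbasis_def lookup_single when_def)
    then show ?thesis unfolding C by (auto simp: in_keys_iff)
  qed
  have rid: "app r f = f" if "f \<in> C" for f
  proof -
    have "app r f = flift fbasis f"
      unfolding r_def app_efl flift_def using that C by (intro sum.cong) auto
    then show ?thesis by (simp add: flift_fbasis_id)
  qed
  have app: "app (Endo g) f = g f" for f
    by (simp add: Endo_inverse g(1))
  have "app (Endo g * r) f \<in> C" for f
  proof -
    have "app (Endo g * r) f = (g (app r f) - app r f) + app r f" by (simp add: app)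
    moreover have "g (app r f) - app r f \<in> C" using gd U(2) by auto
    ultimately show ?thesis
      using rC[of f] C keys_add_sub(1)[of "g (app r f) - app r f" G "app r f"] by simp
  qed
  moreover have "app (Endo g * r) f = 0" if "f \<in> U" for f
    using that U(2) by (auto simp: app rid gU)
  moreover have "app (Endo g * r) f - f \<in> U" if "f \<in> C" for f
    using that gd by (simp add: app rid)
  moreover have "Endo g * r * (Endo g * r) = Endo g * r"
  proof (rule endo_eqI)
    fix x
    have "app (Endo g * r) (fbasis x) \<in> C" by fact
    then have "app r (g (app r (fbasis x))) = g (app r (fbasis x))" by (intro rid) (simp add: app)
    moreover have "g (g y) = g y" for y using gU[OF gd[of y]] by (simp add: g.diff)
    ultimately show "app (Endo g * r * (Endo g * r)) (fbasis x) = app (Endo g * r) (fbasis x)"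
      by (simp add: app)
  qed
  ultimately show ?thesis by blast
qed

locale tensor_product =
  M: gl_supermodule n m M + N: gl_supermodule n m N
  for n m :: nat and M :: "'a::ab_group_add gl_smod" and N :: "'b::ab_group_add gl_smod" +
  fixes d :: nat
begin

abbreviation "K \<equiv> n + m"
abbreviation "par \<equiv> idx_parity n"
abbreviation "pures \<equiv> pure_tensors n m d :: ('a, 'b) pure set"
abbreviation "null \<equiv> null_tensors n m d M N"

definition C :: "(('a, 'b) pure \<Rightarrow>\<^sub>0 complex) set" where
  "C = {f. Poly_Mapping.keys f \<subseteq> pures}"

lemma subspace_C: "fs.subspace C"
  unfolding fs.subspace_def C_def
  by (simp add: keys_add_sub(1)) (meson keys_fscale order_trans)

lemma fbasis_C [simp]: "fbasis g \<in> C \<longleftrightarrow> g \<in> pures"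
  by (simp add: C_def fbasis_def)

lemma C_eq_span: "C = fs.span (fbasis ` pures)"
proof
  show "fs.span (fbasis ` pures) \<subseteq> C"
    by (rule fs.span_minimal) (auto simp: subspace_C)
  show "C \<subseteq> fs.span (fbasis ` pures)"
  proof
    fix f assume f: "f \<in> C"
    have "flift fbasis f \<in> fs.span (fbasis ` pures)"
      unfolding flift_def using f
      by (intro fs.span_sum fs.span_scale fs.span_base) (auto simp: C_def)
    then show "f \<in> fs.span (fbasis ` pures)" by (simp add: flift_fbasis_id)
  qed
qed

lemma subspace_null: "fs.subspace null"
  by (simp add: null_tensors_def)

lemma pures_iff: "(u, w, vs) \<in> pures \<longleftrightarrow> length vs = d \<and> set vs \<subseteq> carrier_vec K"
  by (simp add: pure_tensors_def)

lemma pures_update: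
  "(u, w, vs) \<in> pures \<Longrightarrow> v \<in> carrier_vec K \<Longrightarrow> (u', w', vs[k := v]) \<in> pures"
  using set_update_subset_insert[of vs k v] by (auto simp: pures_iff)

lemma multilin_rels_C: "multilin_rels n m d M N \<subseteq> C"
  unfolding multilin_rels_def
  by (intro Un_least subsetI; clarify;
      intro fs.subspace_diff[OF subspace_C] fs.subspace_scale[OF subspace_C];
      simp add: pures_update; simp add: pures_iff)

lemma null_C: "null \<subseteq> C"
  unfolding null_tensors_def by (intro fs.span_minimal multilin_rels_C subspace_C)

text \<open>
  Cosets cannot carry the type class structure of a ring of operators, so the quotient is replaced
  by a complement of the relations: \<open>proj\<close> kills exactly the relations, and \<open>hat F\<close> below
  represents the operator induced by F.
\<close>

definition proj :: "('a, 'b) pure endo" where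
  "proj = (SOME e. (\<forall>f\<in>null. app e f = 0) \<and> (\<forall>f\<in>C. app e f - f \<in> null) \<and> (\<forall>f. app e f \<in> C)
    \<and> e * e = e)"

lemma proj:
  shows proj_null: "f \<in> null \<Longrightarrow> app proj f = 0"
    and proj_diff: "f \<in> C \<Longrightarrow> app proj f - f \<in> null"
    and proj_C: "app proj f \<in> C"
    and proj_idem: "proj * proj = proj"
proof -
  have "(\<forall>f\<in>null. app proj f = 0) \<and> (\<forall>f\<in>C. app proj f - f \<in> null) \<and> (\<forall>f. app proj f \<in> C)
      \<and> proj * proj = proj"
    unfolding proj_def by (rule someI_ex, rule projector_exists[OF subspace_null null_C C_def])
  then show "f \<in> null \<Longrightarrow> app proj f = 0" "f \<in> C \<Longrightarrow> app proj f - f \<in> null" "app proj f \<in> C"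
    "proj * proj = proj"
    by auto
qed

lemma proj_proj [simp]: "app proj (app proj f) = app proj f"
  by (metis app_ops(4) proj_idem)

lemma proj_eqI: "f - g \<in> null \<Longrightarrow> app proj f = app proj g"
  using proj_null[of "f - g"] by simp

lemma proj_eq_iff: "f \<in> C \<Longrightarrow> g \<in> C \<Longrightarrow> app proj f = app proj g \<longleftrightarrow> f - g \<in> null"
proof
  assume C: "f \<in> C" "g \<in> C" and eq: "app proj f = app proj g"
  have "(app proj g - g) - (app proj f - f) \<in> null"
    by (intro fs.subspace_diff[OF subspace_null] proj_diff C)
  then show "f - g \<in> null" by (simp add: eq)
qed (rule proj_eqI)

definition descends :: "('a, 'b) pure endo \<Rightarrow> bool" where
  "descends G \<longleftrightarrow> (\<forall>f\<in>C. app G f \<in> C) \<and> (\<forall>f\<in>null. app G f \<in> null)"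

lemma descends_add: "descends F \<Longrightarrow> descends G \<Longrightarrow> descends (F + G)"
  by (simp add: descends_def fs.subspace_add[OF subspace_C] fs.subspace_add[OF subspace_null])

lemma descends_diff: "descends F \<Longrightarrow> descends G \<Longrightarrow> descends (F - G)"
  by (simp add: descends_def fs.subspace_diff[OF subspace_C] fs.subspace_diff[OF subspace_null])

lemma descends_mult: "descends F \<Longrightarrow> descends G \<Longrightarrow> descends (F * G)"
  by (simp add: descends_def)

lemma descends_sc: "descends (sc c)"
  by (simp add: descends_def fs.subspace_scale[OF subspace_C] fs.subspace_scale[OF subspace_null])

lemma descends_zero: "descends 0"
  by (simp add: descends_def fs.subspace_0[OF subspace_C] fs.subspace_0[OF subspace_null])

lemma descends_sum: "(\<And>s. s \<in> S \<Longrightarrow> descends (F s)) \<Longrightarrow> descends (sum F S)"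
  by (induction S rule: infinite_finite_induct) (simp_all add: descends_zero descends_add)

lemma descends_proj: "descends proj"
  by (simp add: descends_def proj_C proj_null fs.subspace_0[OF subspace_null])

lemmas descends_intros = descends_add descends_diff descends_mult descends_sc descends_zero descends_sum descends_proj

definition hat :: "('a, 'b) pure endo \<Rightarrow> ('a, 'b) pure endo" where
  "hat F = proj * F * proj"

lemma proj_hat [simp]: "proj * hat F = hat F" "hat F * proj = hat F"
  by (simp_all add: hat_def mult.assoc proj_idem) (simp_all add: proj_idem flip: mult.assoc)

lemma descends_hat: "descends F \<Longrightarrow> descends (hat F)"
  unfolding hat_def by (intro descends_intros)

text \<open>The inner projector changes a vector of \<open>C\<close> only by a relation, which
  \<open>F\<close> maps to a relation and the outer projector kills. This makes \<open>hat\<close>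
  multiplicative.\<close>

lemma descends_app_proj: "descends F \<Longrightarrow> f \<in> C \<Longrightarrow> app proj (app F (app proj f)) = app proj (app F f)"
proof (rule proj_eqI)
  assume "descends F" "f \<in> C"
  then have "app F (app proj f - f) \<in> null" by (simp only: descends_def proj_diff)
  then show "app F (app proj f) - app F f \<in> null" by simp
qed

lemma hat_app: "descends F \<Longrightarrow> f \<in> C \<Longrightarrow> app (hat F) (app proj f) = app proj (app F f)"
  by (simp add: hat_def descends_app_proj)

lemma hat_sc: "hat (sc c * F) = sc c * hat F"
  by (rule endo_eqI) (simp add: hat_def)

lemma hat_sum: "hat (sum F S) = (\<Sum>s\<in>S. hat (F s))"
  by (simp add: hat_def sum_distrib_left sum_distrib_right)

text \<open>An operator that absorbs the projector on the right is determined by its values on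
  projected vectors, and every projected vector comes from \<open>C\<close>.\<close>

lemma corner_eqI:
  assumes X: "X * proj = X" and Y: "Y * proj = Y"
    and eq: "\<And>f. f \<in> C \<Longrightarrow> app X (app proj f) = app Y (app proj f)"
  shows "X = Y"
proof (rule endo_eqI)
  fix g :: "('a, 'b) pure"
  let ?f = "fbasis g"
  have "app (X * proj) (app proj ?f) = app (Y * proj) (app proj ?f)"
    unfolding X Y using eq[OF proj_C, of ?f] by simp
  then show "app X ?f = app Y ?f" by (simp flip: app_ops(4) add: mult.assoc proj_idem X Y)
qed

lemma hat_mult: "descends F \<Longrightarrow> descends G \<Longrightarrow> hat (F * G) = hat F * hat G"
proof (rule corner_eqI)
  fix f assume descends: "descends F" "descends G" and f: "f \<in> C"
  have "app G f \<in> C" using descends f by (simp add: descends_def)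
  then show "app (hat (F * G)) (app proj f) = app (hat F * hat G) (app proj f)"
    using descends f by (simp add: hat_app descends_mult)
qed (simp_all add: mult.assoc)

end


section \<open>Multilinear operators\<close>

text \<open>The default rewriting of parities to bit operations would block the field laws on which
  the sign computations rest.\<close>

declare add_bit_eq_xor [simp del] mult_bit_eq_and [simp del]

lemma UNIV_bit_eq: "UNIV = {0, 1 :: bit}"
  by (auto intro: bit.exhaust)

context gl_supermodule
begin

text \<open>The difference of two candidates is both even and odd, hence 0.\<close>

lemma hcomp_unique:
  assumes "w \<in> spart M p" "v - w \<in> spart M (p + 1)" "w' \<in> spart M p" "v - w' \<in> spart M (p + 1)"
  shows "w = w'"
proof -
  have "w - w' \<in> spart M p" by (rule subspace_diff[OF part_subspace assms(1,3)])
  moreover have "(v - w') - (v - w) \<in> spart M (p + 1)" by (rule subspace_diff[OF part_subspace assms(4,2)])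
  ultimately have "w - w' \<in> spart M 0 \<inter> spart M 1"
    by (cases p) simp_all
  then show ?thesis by (simp add: part_disjoint)
qed

lemma hcomp_eqI: "w \<in> spart M p \<Longrightarrow> v - w \<in> spart M (p + 1) \<Longrightarrow> hcomp M p v = w"
  unfolding hcomp_def by (rule the_equality) (auto intro: hcomp_unique)

lemma hcomp_in: "hcomp M p v \<in> spart M p" "v - hcomp M p v \<in> spart M (p + 1)"
proof -
  obtain v0 v1 where v: "v0 \<in> spart M 0" "v1 \<in> spart M 1" "v = v0 + v1"
    using part_sum by blast
  have "hcomp M p v = (if p = 0 then v0 else v1)"
    using v by (intro hcomp_eqI; cases p; simp)
  then show "hcomp M p v \<in> spart M p" "v - hcomp M p v \<in> spart M (p + 1)"
    using v by (cases p; simp)+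
qed

lemma hcomp_add: "hcomp M p (v + w) = hcomp M p v + hcomp M p w"
proof (rule hcomp_eqI)
  show "hcomp M p v + hcomp M p w \<in> spart M p"
    by (intro subspace_add part_subspace hcomp_in)
  have "(v - hcomp M p v) + (w - hcomp M p w) \<in> spart M (p + 1)"
    by (intro subspace_add part_subspace hcomp_in)
  then show "v + w - (hcomp M p v + hcomp M p w) \<in> spart M (p + 1)"
    by (simp add: algebra_simps)
qed

lemma hcomp_scale: "hcomp M p (sscale M c v) = sscale M c (hcomp M p v)"
proof (rule hcomp_eqI)
  show "sscale M c (hcomp M p v) \<in> spart M p"
    by (intro subspace_scale part_subspace hcomp_in)
  have "sscale M c (v - hcomp M p v) \<in> spart M (p + 1)"
    by (intro subspace_scale part_subspace hcomp_in)
  then show "sscale M c v - sscale M c (hcomp M p v) \<in> spart M (p + 1)"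
    by (simp add: scale_right_diff_distrib)
qed

lemma linear_koszul: "Vector_Spaces.linear (sscale M) (sscale M) (koszul M q)"
  by unfold_locales (simp_all add: koszul_def hcomp_add hcomp_scale scale_right_distrib sum.distrib
      scale_sum_right mult.commute)

lemma koszul_homogeneous:
  assumes "v \<in> spart M p"
  shows "koszul M q v = sscale M (ksgn (q * p)) v"
proof -
  have "hcomp M r v = (if r = p then v else 0)" for r
    using assms subspace_0[OF part_subspace]
    by (intro hcomp_eqI) (cases r; cases p; simp)+
  then show ?thesis by (cases p) (simp_all add: koszul_def UNIV_bit_eq)
qed

lemma linear_scale_id: "Vector_Spaces.linear (sscale M) (sscale M) (\<lambda>v. v)"
  by unfold_locales simp_all

end

lemma ksgn_add: "ksgn (p + q) = ksgn p * ksgn q"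
  by (cases p; cases q) (simp_all add: ksgn_def)

lemma ksgn_square [simp]: "ksgn p * ksgn p = 1" "ksgn p * (ksgn p * x) = x"
  by (simp_all add: ksgn_def)

lemma ksgn_zero [simp]: "ksgn 0 = 1"
  by (simp add: ksgn_def)

lemma ksgn_sum: "finite A \<Longrightarrow> ksgn (sum f A) = (\<Prod>x\<in>A. ksgn (f x))"
  by (induction A rule: finite_induct) (simp_all add: ksgn_add)

text \<open>Linear self-maps of the natural module, which is only a carrier inside the type of vectors.\<close>

definition vec_linear :: "nat \<Rightarrow> (complex vec \<Rightarrow> complex vec) \<Rightarrow> bool" where
  "vec_linear k F \<longleftrightarrow> (\<forall>v\<in>carrier_vec k. F v \<in> carrier_vec k
     \<and> (\<forall>v'\<in>carrier_vec k. F (v + v') = F v + F v') \<and> (\<forall>c. F (c \<cdot>\<^sub>v v) = c \<cdot>\<^sub>v F v))"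

lemma vec_linear_id: "vec_linear k (\<lambda>v. v)"
  by (simp add: vec_linear_def)

lemma vec_linear_mult: "x \<in> carrier_mat k k \<Longrightarrow> vec_linear k ((*\<^sub>v) x)"
  by (auto simp: vec_linear_def mult_add_distrib_mat_vec mult_mat_vec)

lemma vec_linear_vkoszul: "vec_linear k (vkoszul n p)"
  by (auto simp: vec_linear_def vkoszul_def algebra_simps)

lemma vec_linear_vcomp: "vec_linear k (vcomp n p)"
  by (auto simp: vec_linear_def vcomp_def algebra_simps)

context tensor_product
begin

text \<open>The pure tensor as an element of the complement, where multilinearity holds as an
  equation (\<open>pv_add\<close>).\<close>

definition pv :: "'a \<Rightarrow> 'b \<Rightarrow> complex vec list \<Rightarrow> (('a, 'b) pure \<Rightarrow>\<^sub>0 complex)" where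
  "pv u w vs = app proj (fbasis (u, w, vs))"

lemma rels_null: "multilin_rels n m d M N \<subseteq> null"
  unfolding null_tensors_def by (rule fs.span_superset)

lemma rel_null:
  assumes "(u, w, vs) \<in> pures"
  shows "fbasis (u + u', w, vs) - fbasis (u, w, vs) - fbasis (u', w, vs) \<in> null"
    and "fbasis (sscale M c u, w, vs) - fscale c (fbasis (u, w, vs)) \<in> null"
    and "fbasis (u, w + w', vs) - fbasis (u, w, vs) - fbasis (u, w', vs) \<in> null"
    and "fbasis (u, sscale N c w, vs) - fscale c (fbasis (u, w, vs)) \<in> null"
    and "\<lbrakk>k < d; v \<in> carrier_vec K; v' \<in> carrier_vec K\<rbrakk> \<Longrightarrow>
      fbasis (u, w, vs[k := v + v']) - fbasis (u, w, vs[k := v]) - fbasis (u, w, vs[k := v']) \<in> null"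
    and "\<lbrakk>k < d; v \<in> carrier_vec K\<rbrakk> \<Longrightarrow>
      fbasis (u, w, vs[k := c \<cdot>\<^sub>v v]) - fscale c (fbasis (u, w, vs[k := v])) \<in> null"
proof -
  let ?R = "multilin_rels n m d M N"
  have 1: "fbasis (u + u', w, vs) - fbasis (u, w, vs) - fbasis (u', w, vs) \<in> ?R"
    unfolding multilin_rels_def by (rule UnI1, rule UnI1, rule UnI1, rule UnI1, rule UnI1) (use assms in blast)
  have 2: "fbasis (sscale M c u, w, vs) - fscale c (fbasis (u, w, vs)) \<in> ?R"
    unfolding multilin_rels_def by (rule UnI1, rule UnI1, rule UnI1, rule UnI1, rule UnI2) (use assms in blast)
  have 3: "fbasis (u, w + w', vs) - fbasis (u, w, vs) - fbasis (u, w', vs) \<in> ?R"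
    unfolding multilin_rels_def by (rule UnI1, rule UnI1, rule UnI1, rule UnI2) (use assms in blast)
  have 4: "fbasis (u, sscale N c w, vs) - fscale c (fbasis (u, w, vs)) \<in> ?R"
    unfolding multilin_rels_def by (rule UnI1, rule UnI1, rule UnI2) (use assms in blast)
  have 5: "fbasis (u, w, vs[k := v + v']) - fbasis (u, w, vs[k := v]) - fbasis (u, w, vs[k := v']) \<in> ?R"
    if "k < d" "v \<in> carrier_vec K" "v' \<in> carrier_vec K"
    unfolding multilin_rels_def by (rule UnI1, rule UnI2) (use assms that in blast)
  have 6: "fbasis (u, w, vs[k := c \<cdot>\<^sub>v v]) - fscale c (fbasis (u, w, vs[k := v])) \<in> ?R"
    if "k < d" "v \<in> carrier_vec K"
    unfolding multilin_rels_def by (rule UnI2) (use assms that in blast)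
  note R = subsetD[OF rels_null]
  show "fbasis (u + u', w, vs) - fbasis (u, w, vs) - fbasis (u', w, vs) \<in> null" using 1 by (rule R)
  show "fbasis (sscale M c u, w, vs) - fscale c (fbasis (u, w, vs)) \<in> null" using 2 by (rule R)
  show "fbasis (u, w + w', vs) - fbasis (u, w, vs) - fbasis (u, w', vs) \<in> null" using 3 by (rule R)
  show "fbasis (u, sscale N c w, vs) - fscale c (fbasis (u, w, vs)) \<in> null" using 4 by (rule R)
  show "fbasis (u, w, vs[k := v + v']) - fbasis (u, w, vs[k := v]) - fbasis (u, w, vs[k := v']) \<in> null"
    if "k < d" "v \<in> carrier_vec K" "v' \<in> carrier_vec K" using 5[OF that] by (rule R)
  show "fbasis (u, w, vs[k := c \<cdot>\<^sub>v v]) - fscale c (fbasis (u, w, vs[k := v])) \<in> null"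
    if "k < d" "v \<in> carrier_vec K" using 6[OF that] by (rule R)
qed

lemma pv_add:
  assumes "(u, w, vs) \<in> pures"
  shows "pv (u + u') w vs = pv u w vs + pv u' w vs"
    and "pv (sscale M c u) w vs = fscale c (pv u w vs)"
    and "pv u (w + w') vs = pv u w vs + pv u w' vs"
    and "pv u (sscale N c w) vs = fscale c (pv u w vs)"
    and "\<lbrakk>k < d; v \<in> carrier_vec K; v' \<in> carrier_vec K\<rbrakk> \<Longrightarrow>
      pv u w (vs[k := v + v']) = pv u w (vs[k := v]) + pv u w (vs[k := v'])"
    and "\<lbrakk>k < d; v \<in> carrier_vec K\<rbrakk> \<Longrightarrow> pv u w (vs[k := c \<cdot>\<^sub>v v]) = fscale c (pv u w (vs[k := v]))"
proof -
  show "pv (u + u') w vs = pv u w vs + pv u' w vs"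
    using proj_null[OF rel_null(1)[OF assms]] by (simp add: pv_def diff_diff_eq)
  show "pv (sscale M c u) w vs = fscale c (pv u w vs)"
    using proj_null[OF rel_null(2)[OF assms]] by (simp add: pv_def)
  show "pv u (w + w') vs = pv u w vs + pv u w' vs"
    using proj_null[OF rel_null(3)[OF assms]] by (simp add: pv_def diff_diff_eq)
  show "pv u (sscale N c w) vs = fscale c (pv u w vs)"
    using proj_null[OF rel_null(4)[OF assms]] by (simp add: pv_def)
  show "pv u w (vs[k := v + v']) = pv u w (vs[k := v]) + pv u w (vs[k := v'])"
    if "k < d" "v \<in> carrier_vec K" "v' \<in> carrier_vec K"
    using proj_null[OF rel_null(5)[OF assms that]] by (simp add: pv_def diff_diff_eq)
  show "pv u w (vs[k := c \<cdot>\<^sub>v v]) = fscale c (pv u w (vs[k := v]))"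
    if "k < d" "v \<in> carrier_vec K"
    using proj_null[OF rel_null(6)[OF assms that]] by (simp add: pv_def)
qed

lemma linear_pv:
  assumes "length vs = d" "set vs \<subseteq> carrier_vec K"
  shows "Vector_Spaces.linear (sscale M) fscale (\<lambda>u. pv u w vs)"
    "Vector_Spaces.linear (sscale N) fscale (\<lambda>w. pv u w vs)"
  using assms by (unfold_locales; simp add: pures_iff pv_add)+

lemma pv_scale_list:
  assumes "\<And>l. l < d \<Longrightarrow> f l \<in> carrier_vec K"
  shows "pv u w (map (\<lambda>l. c l \<cdot>\<^sub>v f l) [0..<d]) = fscale (\<Prod>l<d. c l) (pv u w (map f [0..<d]))"
proof -
  \<comment> \<open>Only the first r positions of \<open>?L r\<close> carry their scalars, so that
    each induction step pulls out one scalar by multilinearity.\<close>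
  let ?L = "\<lambda>r. map (\<lambda>l. (if l < r then c l else 1) \<cdot>\<^sub>v f l) [0..<d]"
  have "pv u w (?L r) = fscale (\<Prod>l<r. c l) (pv u w (map f [0..<d]))" if "r \<le> d" for r
    using that
  proof (induction r)
    case 0
    have "?L 0 = map f [0..<d]" by (simp add: one_smult_vec)
    then show ?case by simp
  next
    case (Suc r)
    have p: "(u, w, ?L r) \<in> pures" using assms by (auto simp: pures_iff)
    have "?L (Suc r) = (?L r)[r := c r \<cdot>\<^sub>v f r]" "?L r = (?L r)[r := f r]"
      using Suc.prems by (auto simp: list_eq_iff_nth_eq nth_list_update)
    then have "pv u w (?L (Suc r)) = fscale (c r) (pv u w (?L r))"
      using pv_add(6)[OF p, of r "f r" "c r"] Suc.prems assms[of r] by simp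
    then show ?case using Suc by (simp add: mult.commute)
  qed
  note main = this
  have "?L d = map (\<lambda>l. c l \<cdot>\<^sub>v f l) [0..<d]" by simp
  from main[OF order_refl, unfolded this] show ?thesis .
qed

lemma efl_cong_C:
  assumes "\<And>g. g \<in> pures \<Longrightarrow> \<phi> g = \<psi> g" "f \<in> C"
  shows "app (efl \<phi>) f = app (efl \<psi>) f"
  unfolding app_efl flift_def using assms by (intro sum.cong) (auto simp: C_def)

text \<open>One format for slot actions and for permutations of the factors, so that passage to the
  quotient is verified only once. Position l of the result is computed from position
  \<open>\<rho> l\<close> of the argument.\<close>

definition factorwise :: "('a \<Rightarrow> 'a) \<Rightarrow> ('b \<Rightarrow> 'b) \<Rightarrow> (nat \<Rightarrow> complex vec \<Rightarrow> complex vec) \<Rightarrow> (nat \<Rightarrow> nat)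
    \<Rightarrow> ('a, 'b) pure \<Rightarrow> ('a, 'b) pure" where
  "factorwise A B F \<rho> = (\<lambda>(u, w, vs). (A u, B w, map (\<lambda>l. F l (vs ! \<rho> l)) [0..<d]))"

text \<open>Each relation is mapped to a relation of the same kind. A relation in position k
  reappears at the preimage of k under \<open>\<rho>\<close>, and by bijectivity no other position
  is affected.\<close>

lemma descends_factorwise:
  assumes A: "Vector_Spaces.linear (sscale M) (sscale M) A" and B: "Vector_Spaces.linear (sscale N) (sscale N) B"
    and F: "\<And>l. l < d \<Longrightarrow> vec_linear K (F l)" and \<rho>: "bij_betw \<rho> {..<d} {..<d}"
  shows "descends (efl (\<lambda>g. fbasis (factorwise A B F \<rho> g)))"
proof -
  let ?G = "efl (\<lambda>g. fbasis (factorwise A B F \<rho> g))"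
  interpret A: Vector_Spaces.linear "sscale M" "sscale M" A by fact
  interpret B: Vector_Spaces.linear "sscale N" "sscale N" B by fact
  have G: "app ?G (fbasis (u, w, vs)) = fbasis (A u, B w, map (\<lambda>l. F l (vs ! \<rho> l)) [0..<d])" for u w vs
    by (simp add: app_efl factorwise_def)
  have \<rho>d: "\<rho> l < d" if "l < d" for l using \<rho> that by (auto dest: bij_betwE)
  have pure: "(u', w', map (\<lambda>l. F l (vs ! \<rho> l)) [0..<d]) \<in> pures" if "(u, w, vs) \<in> pures" for u u' w w' vs
  proof -
    have "F l (vs ! \<rho> l) \<in> carrier_vec K" if "l < d" for l
    proof -
      have "vs ! \<rho> l \<in> carrier_vec K"
        using \<open>(u, w, vs) \<in> pures\<close> \<rho>d[OF that] by (simp add: pures_iff subset_code(1))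
      then show ?thesis using F[OF that] by (simp add: vec_linear_def)
    qed
    then show ?thesis by (auto simp: pures_iff)
  qed
  have "app ?G f \<in> null" if "f \<in> null" for f
    using that[unfolded null_tensors_def]
  proof (induction rule: fs.span_induct_alt)
    case base
    then show ?case by (simp add: fs.subspace_0[OF subspace_null])
  next
    case (step c b v)
    have upd: "map (\<lambda>l. F l (vs[k := v] ! \<rho> l)) [0..<d]
        = (map (\<lambda>l. F l (vs ! \<rho> l)) [0..<d])[inv_into {..<d} \<rho> k := F (inv_into {..<d} \<rho> k) v]"
      "inv_into {..<d} \<rho> k < d"
      if "k < d" "length vs = d" for vs k v
    proof -
      let ?k = "inv_into {..<d} \<rho> k"
      have k: "?k < d" "\<rho> ?k = k"
        using that inv_into_into[of k \<rho> "{..<d}"] f_inv_into_f[of k \<rho> "{..<d}"] bij_betw_imp_surj_on[OF \<rho>]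
        by simp_all
      have unique: "\<rho> l = k \<longleftrightarrow> l = ?k" if "l < d" for l
        using k \<rho> that by (auto simp: bij_betw_def inj_on_def)
      show "map (\<lambda>l. F l (vs[k := v] ! \<rho> l)) [0..<d] = (map (\<lambda>l. F l (vs ! \<rho> l)) [0..<d])[?k := F ?k v]"
      proof (rule nth_equalityI)
        fix l assume "l < length (map (\<lambda>l. F l (vs[k := v] ! \<rho> l)) [0..<d])"
        then have l: "l < d" by simp
        show "map (\<lambda>l. F l (vs[k := v] ! \<rho> l)) [0..<d] ! l
            = (map (\<lambda>l. F l (vs ! \<rho> l)) [0..<d])[?k := F ?k v] ! l"
        proof (cases "l = ?k")
          case True
          then show ?thesis using k(1) that by (simp add: k(2))
        next
          case False
          then have "\<rho> l \<noteq> k" using unique[OF l] by simp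
          then show ?thesis using False l by simp
        qed
      qed simp
      show "?k < d" by (rule k(1))
    qed
    have vl: "F l v \<in> carrier_vec K" "F l (v + v') = F l v + F l v'" "F l (c \<cdot>\<^sub>v v) = c \<cdot>\<^sub>v F l v"
      if "l < d" "v \<in> carrier_vec K" "v' \<in> carrier_vec K" for l v v' c
      using F[OF that(1)] that(2,3) by (auto simp: vec_linear_def)
    have "app ?G b \<in> null"
      using step(1) unfolding multilin_rels_def
    proof (elim UnE CollectE exE conjE, goal_cases)
      case (1 u u' w vs)
      then show ?case using rel_null(1)[OF pure[OF 1(2)]] by (simp add: G A.add)
    next
      case (2 c u w vs)
      then show ?case using rel_null(2)[OF pure[OF 2(2)]] by (simp add: G A.scale)
    next
      case (3 u w w' vs)
      then show ?case using rel_null(3)[OF pure[OF 3(2)]] by (simp add: G B.add)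
    next
      case (4 c u w vs)
      then show ?case using rel_null(4)[OF pure[OF 4(2)]] by (simp add: G B.scale)
    next
      case (5 u w vs k v v')
      then have "length vs = d" by (simp add: pures_iff)
      note upd = upd[OF 5(3) this]
      show ?case
        unfolding 5(1) app_linear G upd(1) vl(2)[OF upd(2) 5(4,5)]
        by (rule rel_null(5)[OF pure[OF 5(2)] upd(2) vl(1)[OF upd(2) 5(4,4)] vl(1)[OF upd(2) 5(5,5)]])
    next
      case (6 c u w vs k v)
      then have "length vs = d" by (simp add: pures_iff)
      note upd = upd[OF 6(3) this]
      show ?case
        unfolding 6(1) app_linear G upd(1) vl(3)[OF upd(2) 6(4,4)]
        by (rule rel_null(6)[OF pure[OF 6(2)] upd(2) vl(1)[OF upd(2) 6(4,4)]])
    qed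
    then have "fscale c (app ?G b) + app ?G v \<in> null"
      using step by (intro fs.subspace_add[OF subspace_null] fs.subspace_scale[OF subspace_null])
    then show ?case by simp
  qed
  moreover have "app ?G f \<in> C" if "f \<in> C" for f
    using that[unfolded C_eq_span]
  proof (induction rule: fs.span_induct_alt)
    case base
    then show ?case by (simp add: fs.subspace_0[OF subspace_C])
  next
    case (step c b v)
    then obtain u w vs where b: "b = fbasis (u, w, vs)" "(u, w, vs) \<in> pures" by auto
    then have "app ?G b \<in> C" using pure by (simp add: G)
    then have "fscale c (app ?G b) + app ?G v \<in> C"
      using step by (intro fs.subspace_add[OF subspace_C] fs.subspace_scale[OF subspace_C])
    then show ?case by simp
  qed
  ultimately show ?thesis by (simp add: descends_def)
qed

section \<open>Reduction to tensors of homogeneous vectors and unit vectors\<close>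

definition indices :: "nat list set" where
  "indices = {is. length is = d \<and> set is \<subseteq> {..<K}}"

abbreviation units :: "nat list \<Rightarrow> complex vec list" where
  "units is \<equiv> map (unit_vec K) is"

lemma units_pures: "is \<in> indices \<Longrightarrow> (u, w, units is) \<in> pures"
  by (auto simp: indices_def pures_iff)

text \<open>As \<open>S\<close> contains the relations, membership may be tested modulo them. Hence
  the entries in V may be expanded in coordinates, and those in M and N into homogeneous
  parts.\<close>

lemma C_induct:
  assumes S: "fs.subspace S" "null \<subseteq> S"
    and base: "\<And>u w is \<alpha> \<beta>. \<lbrakk>u \<in> spart M \<alpha>; w \<in> spart N \<beta>; is \<in> indices\<rbrakk> \<Longrightarrow> fbasis (u, w, units is) \<in> S"
  shows "C \<subseteq> S"
proof -
  note add = fs.subspace_add[OF S(1)] and scale = fs.subspace_scale[OF S(1)]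
  have cong: "x \<in> S" if "x - y \<in> null" "y \<in> S" for x y
    using add[OF subsetD[OF S(2) that(1)] that(2)] by simp
  \<comment> \<open>All positions from r on already hold unit vectors; one step of the induction
    expands the entry at position r.\<close>
  have hom: "fbasis (u, w, vs) \<in> S"
    if uw: "u \<in> spart M \<alpha>" "w \<in> spart N \<beta>" and vs: "(u, w, vs) \<in> pures"
      and r: "r \<le> d" "\<forall>l<d. r \<le> l \<longrightarrow> vs ! l \<in> unit_vec K ` {..<K}" for u w \<alpha> \<beta> vs r
    using vs r
  proof (induction r arbitrary: vs)
    case 0
    then have len: "length vs = d" by (simp add: pures_iff)
    obtain j where j: "\<And>l. l < d \<Longrightarrow> j l < K \<and> vs ! l = unit_vec K (j l)"
    proof -
      have "\<forall>l. \<exists>x. l < d \<longrightarrow> x < K \<and> vs ! l = unit_vec K x" using 0(3) by auto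
      then show thesis using that by metis
    qed
    have "vs = units (map j [0..<d])"
      using j len by (auto simp: list_eq_iff_nth_eq)
    moreover have "map j [0..<d] \<in> indices" using j by (auto simp: indices_def)
    ultimately show ?case using base[OF uw] by metis
  next
    case (Suc r)
    note IH = Suc.IH and prems = Suc.prems
    have len: "length vs = d" and r: "r < d" and vr: "vs ! r \<in> carrier_vec K"
      using prems by (auto simp: pures_iff)
    have part: "fbasis (u, w, vs[r := vec K (\<lambda>i. if i < k then vs ! r $ i else 0)]) \<in> S" if "k \<le> K" for k
      using that
    proof (induction k)
      case 0
      \<comment> \<open>Writing the zero vector as 0 times itself turns the vanishing of a tensor
        with a zero entry into an instance of the scaling relation.\<close>
      have z: "vec K (\<lambda>i. if i < 0 then vs ! r $ i else 0) = 0 \<cdot>\<^sub>v (0\<^sub>v K :: complex vec)" by auto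
      have "fbasis (u, w, vs[r := 0 \<cdot>\<^sub>v (0\<^sub>v K :: complex vec)]) - 0 \<in> null"
        using rel_null(6)[OF prems(1) r, of "0\<^sub>v K" 0] by simp
      then show ?case unfolding z by (rule cong) (rule fs.subspace_0[OF S(1)])
    next
      case (Suc k)
      let ?v = "vec K (\<lambda>i. if i < k then vs ! r $ i else 0)"
      let ?e = "unit_vec K k :: complex vec" and ?c = "vs ! r $ k"
      have eq: "vec K (\<lambda>i. if i < Suc k then vs ! r $ i else 0) = ?v + ?c \<cdot>\<^sub>v ?e"
        using \<open>Suc k \<le> K\<close> by (intro eq_vecI) (auto simp: less_Suc_eq)
      have "fbasis (u, w, vs[r := ?e]) \<in> S"
        using prems r len \<open>Suc k \<le> K\<close>
        by (intro IH pures_update[OF prems(1)]) (auto simp: nth_list_update)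
      then have "fbasis (u, w, vs[r := ?c \<cdot>\<^sub>v ?e]) \<in> S"
        by (intro cong[OF rel_null(6)[OF prems(1) r]] scale) simp_all
      then have "fbasis (u, w, vs[r := ?v]) + fbasis (u, w, vs[r := ?c \<cdot>\<^sub>v ?e]) \<in> S"
        using Suc by (intro add) simp_all
      moreover have "fbasis (u, w, vs[r := ?v + ?c \<cdot>\<^sub>v ?e])
          - (fbasis (u, w, vs[r := ?v]) + fbasis (u, w, vs[r := ?c \<cdot>\<^sub>v ?e])) \<in> null"
        using rel_null(5)[OF prems(1) r, of ?v "?c \<cdot>\<^sub>v ?e"] by (simp add: diff_diff_eq)
      ultimately show ?case unfolding eq by (rule cong[rotated])
    qed
    have "vec K (\<lambda>i. if i < K then vs ! r $ i else 0) = vs ! r" using vr by auto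
    then show ?case using part[of K] by simp
  qed
  have "fbasis (u, w, vs) \<in> S" if vs: "(u, w, vs) \<in> pures" for u w vs
  proof -
    have p: "(u', w', vs) \<in> pures" for u' w' using vs by (simp add: pures_iff)
    obtain u0 u1 w0 w1 where uw: "u = u0 + u1" "w = w0 + w1"
      "u0 \<in> spart M 0" "u1 \<in> spart M 1" "w0 \<in> spart N 0" "w1 \<in> spart N 1"
      using M.part_sum[of u] N.part_sum[of w] by blast
    have "fbasis (u', w, vs) \<in> S" if u': "u' \<in> spart M \<alpha>" for u' \<alpha>
    proof -
      have "fbasis (u', w0, vs) + fbasis (u', w1, vs) \<in> S"
        using hom[OF u' _ p order_refl] uw by (intro add) simp_all
      moreover have "fbasis (u', w, vs) - (fbasis (u', w0, vs) + fbasis (u', w1, vs)) \<in> null"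
        using rel_null(3)[OF p] uw by (simp add: diff_diff_eq)
      ultimately show ?thesis by (rule cong[rotated])
    qed
    then have "fbasis (u0, w, vs) + fbasis (u1, w, vs) \<in> S"
      using uw by (intro add)
    moreover have "fbasis (u, w, vs) - (fbasis (u0, w, vs) + fbasis (u1, w, vs)) \<in> null"
      using rel_null(1)[OF p] uw by (simp add: diff_diff_eq)
    ultimately show ?thesis by (rule cong[rotated])
  qed
  then show ?thesis
    unfolding C_eq_span by (intro fs.span_minimal S) auto
qed

abbreviation bt :: "'a \<Rightarrow> 'b \<Rightarrow> nat list \<Rightarrow> (('a, 'b) pure \<Rightarrow>\<^sub>0 complex)" where
  "bt u w is \<equiv> pv u w (units is)"

lemma corner_eqI_bt:
  assumes X: "X * proj = X" and Y: "Y * proj = Y"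
    and eq: "\<And>u w is \<alpha> \<beta>. \<lbrakk>u \<in> spart M \<alpha>; w \<in> spart N \<beta>; is \<in> indices\<rbrakk>
      \<Longrightarrow> app X (bt u w is) = app Y (bt u w is)"
  shows "X = Y"
proof (rule corner_eqI[OF X Y])
  let ?S = "{f. app X (app proj f) = app Y (app proj f)}"
  have "C \<subseteq> ?S"
  proof (rule C_induct)
    show "fs.subspace ?S" by (simp add: fs.subspace_def)
    show "null \<subseteq> ?S" by (auto simp: proj_null)
  qed (use eq in \<open>simp add: pv_def\<close>)
  then show "app X (app proj f) = app Y (app proj f)" if "f \<in> C" for f using that by auto
qed

end


section \<open>Matrix units acting on the tensor factors\<close>

lemma unit_mat_carrier [simp]:
  "unit_mat k i j \<in> carrier_mat k k" "dim_row (unit_mat k i j) = k" "dim_col (unit_mat k i j) = k"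
  by (simp_all add: unit_mat_def)

lemma unit_mat_mult:
  assumes "i < k" "j < k" "p < k" "q < k"
  shows "unit_mat k i j * unit_mat k p q = (if j = p then unit_mat k i q else 0\<^sub>m k k)"
proof (rule eq_matI)
  fix a b assume "a < dim_row (if j = p then unit_mat k i q else 0\<^sub>m k k)"
    "b < dim_col (if j = p then unit_mat k i q else 0\<^sub>m k k)"
  then have ab: "a < k" "b < k" by (auto simp: unit_mat_def split: if_splits)
  have "(unit_mat k i j * unit_mat k p q) $$ (a, b)
      = (\<Sum>c<k. (if a = i \<and> c = j then 1 else 0) * (if c = p \<and> b = q then 1 else 0))"
    using ab by (simp add: unit_mat_def times_mat_def scalar_prod_def lessThan_atLeast0)
  also have "\<dots> = (\<Sum>c<k. if c = j then (if a = i \<and> j = p \<and> b = q then 1 else 0) else 0)"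
    by (intro sum.cong) auto
  finally show "(unit_mat k i j * unit_mat k p q) $$ (a, b) = (if j = p then unit_mat k i q else 0\<^sub>m k k) $$ (a, b)"
    using ab assms by (auto simp: unit_mat_def)
qed (simp_all add: unit_mat_def)

context gl_supermodule
begin

lemma unit_mat_gl_part: "unit_mat (n + m) i j \<in> gl_part n m (idx_parity n i + idx_parity n j)"
  by (auto simp: gl_part_def gl_carrier_def unit_mat_def)

lemma unit_mat_gl_carrier: "unit_mat (n + m) i j \<in> gl_carrier n m"
  by (simp add: gl_carrier_def unit_mat_def)

lemma act_zero_mat: "sact M (0\<^sub>m (n + m) (n + m)) v = 0"
proof -
  have "sact M (0 \<cdot>\<^sub>m 0\<^sub>m (n + m) (n + m)) v = sscale M 0 (sact M (0\<^sub>m (n + m) (n + m)) v)"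
    by (rule act_smult) (simp add: gl_carrier_def)
  then show ?thesis by simp
qed

lemma act_unit_mats:
  assumes "i < n + m" "j < n + m" "p < n + m" "q < n + m"
  defines "s \<equiv> ksgn ((idx_parity n i + idx_parity n j) * (idx_parity n p + idx_parity n q))"
  shows "sact M (unit_mat (n + m) i j) (sact M (unit_mat (n + m) p q) v)
    = sscale M s (sact M (unit_mat (n + m) p q) (sact M (unit_mat (n + m) i j) v))
      + (if j = p then sact M (unit_mat (n + m) i q) v else 0)
      - sscale M s (if i = q then sact M (unit_mat (n + m) p j) v else 0)"
proof -
  let ?k = "n + m"
  let ?A = "if j = p then unit_mat ?k i q else 0\<^sub>m ?k ?k"
  let ?B = "if q = i then unit_mat ?k p j else 0\<^sub>m ?k ?k"
  have AB: "?A \<in> gl_carrier n m" "?B \<in> gl_carrier n m"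
    by (auto simp: gl_carrier_def unit_mat_def)
  have "sbracket (idx_parity n i + idx_parity n j) (idx_parity n p + idx_parity n q)
      (unit_mat ?k i j) (unit_mat ?k p q) = ?A + (- s) \<cdot>\<^sub>m ?B"
    using assms(1-4) AB by (auto simp: sbracket_def s_def unit_mat_mult gl_carrier_def intro!: eq_matI)
  then have "sact M (unit_mat ?k i j) (sact M (unit_mat ?k p q) v)
      - sscale M s (sact M (unit_mat ?k p q) (sact M (unit_mat ?k i j) v))
      = sact M (?A + (- s) \<cdot>\<^sub>m ?B) v"
    using act_bracket[OF unit_mat_gl_part[of i j] unit_mat_gl_part[of p q], of v] by (simp add: s_def)
  also have "\<dots> = sact M ?A v - sscale M s (sact M ?B v)"
    using AB by (subst act_add) (auto simp: gl_carrier_def act_smult)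
  also have "sact M ?A v = (if j = p then sact M (unit_mat ?k i q) v else 0)"
    by (simp add: act_zero_mat)
  also have "sact M ?B v = (if i = q then sact M (unit_mat ?k p j) v else 0)"
    by (simp add: act_zero_mat)
  finally show ?thesis by (simp only: diff_eq_eq) (simp add: algebra_simps)
qed

end

lemma sg_eq_sc: "sg p = sc (ksgn p)"
  by (rule endo_eqI) (simp add: sg_def ksgn_def fs.scale_minus_left)

lemma unit_mat_mult_unit_vec:
  assumes "i < k" "j < k" "l < k"
  shows "unit_mat k i j *\<^sub>v unit_vec k l = (if l = j then 1 else 0) \<cdot>\<^sub>v (unit_vec k i :: complex vec)"
  using assms by (auto simp: unit_mat_def mult_mat_vec_def intro!: eq_vecI)

lemma vkoszul_unit_vec: "l < k \<Longrightarrow> vkoszul n p (unit_vec k l) = ksgn (p * idx_parity n l) \<cdot>\<^sub>v unit_vec k l"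
  by (auto simp: vkoszul_def intro!: eq_vecI)

lemma vcomp_unit_vec: "l < k \<Longrightarrow> vcomp n p (unit_vec k l) = (if idx_parity n l = p then 1 else 0) \<cdot>\<^sub>v unit_vec k l"
  by (auto simp: vcomp_def intro!: eq_vecI)

context tensor_product
begin

definition slot_op :: "bit \<Rightarrow> complex mat \<Rightarrow> slot \<Rightarrow> ('a, 'b) pure endo" where
  "slot_op p x s = efl (\<lambda>g. fbasis (slot_act n M N p x s g))"

text \<open>The copies of V to the left contribute Koszul signs and those to the right are
  untouched. Slots are counted from 1 and list positions from 0, hence \<open>k - 1\<close>.\<close>

definition slot_vec :: "bit \<Rightarrow> complex mat \<Rightarrow> nat \<Rightarrow> nat \<Rightarrow> complex vec \<Rightarrow> complex vec" where
  "slot_vec p x k l = (if l < k - 1 then vkoszul n p else if l = k - 1 then (*\<^sub>v) x else (\<lambda>v. v))"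

lemma slot_act_factorwise:
  assumes "g \<in> pures"
  shows "slot_act n M N p x SlotM g = factorwise (sact M x) (\<lambda>w. w) (\<lambda>l v. v) (\<lambda>l. l) g"
    "slot_act n M N p x SlotN g = factorwise (koszul M p) (sact N x) (\<lambda>l v. v) (\<lambda>l. l) g"
    "k \<in> {1..d} \<Longrightarrow> slot_act n M N p x (SlotV k) g
      = factorwise (koszul M p) (koszul N p) (slot_vec p x k) (\<lambda>l. l) g"
proof -
  obtain u w vs where g: "g = (u, w, vs)" by (cases g)
  have len: "length vs = d" using assms by (simp add: g pures_iff)
  then have vs: "map ((!) vs) [0..<d] = vs" using map_nth[of vs] by simp
  show "slot_act n M N p x SlotM g = factorwise (sact M x) (\<lambda>w. w) (\<lambda>l v. v) (\<lambda>l. l) g"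
    "slot_act n M N p x SlotN g = factorwise (koszul M p) (sact N x) (\<lambda>l v. v) (\<lambda>l. l) g"
    by (simp_all add: g factorwise_def vs)
  assume k: "k \<in> {1..d}"
  have "map (vkoszul n p) (take (k - 1) vs) @ [x *\<^sub>v vs ! (k - 1)] @ drop k vs
      = map (\<lambda>l. slot_vec p x k l (vs ! l)) [0..<d]"
    using k len by (intro nth_equalityI) (auto simp: nth_append slot_vec_def)
  then show "slot_act n M N p x (SlotV k) g
      = factorwise (koszul M p) (koszul N p) (slot_vec p x k) (\<lambda>l. l) g"
    by (simp add: g factorwise_def)
qed

lemma slots_cases:
  assumes "s \<in> MNV_slots d"
  obtains "s = SlotM" | "s = SlotN" | k where "s = SlotV k" "k \<in> {1..d}"
  using assms by (auto simp: MNV_slots_def)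

lemma descends_cong:
  assumes "descends (efl \<psi>)" "\<And>g. g \<in> pures \<Longrightarrow> \<phi> g = \<psi> g"
  shows "descends (efl \<phi>)"
proof -
  have "app (efl \<phi>) f = app (efl \<psi>) f" if "f \<in> C" for f
    using assms(2) that by (rule efl_cong_C)
  then show ?thesis
    using assms(1) null_C by (auto simp: descends_def subset_iff)
qed

lemma vec_linear_slot_vec: "x \<in> gl_carrier n m \<Longrightarrow> vec_linear K (slot_vec p x k l)"
  by (simp add: slot_vec_def vec_linear_vkoszul vec_linear_mult vec_linear_id gl_carrier_def)

lemma descends_slot_op:
  assumes x: "x \<in> gl_carrier n m" and s: "s \<in> MNV_slots d"
  shows "descends (slot_op p x s)"
proof -
  note lin = M.act_linear[OF x] N.act_linear[OF x] M.linear_koszul N.linear_koszul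
    M.linear_scale_id N.linear_scale_id
  have id: "bij_betw (\<lambda>l. l) {..<d} {..<d}" by (simp add: bij_betw_def)
  show ?thesis using s
  proof (cases rule: slots_cases)
    case 1
    show ?thesis unfolding 1 slot_op_def
      by (rule descends_cong[OF descends_factorwise[OF lin(1,6) vec_linear_id id]]) (simp add: slot_act_factorwise)
  next
    case 2
    show ?thesis unfolding 2 slot_op_def
      by (rule descends_cong[OF descends_factorwise[OF lin(3,2) vec_linear_id id]]) (simp add: slot_act_factorwise)
  next
    case (3 k)
    show ?thesis unfolding 3(1) slot_op_def
      by (rule descends_cong[OF descends_factorwise[OF lin(3,4) vec_linear_slot_vec[OF x] id]])
        (simp only: slot_act_factorwise(3) 3(2))
  qed
qed

lemma hat_bt: "descends G \<Longrightarrow> is \<in> indices \<Longrightarrow> app (hat G) (bt u w is) = app proj (app G (fbasis (u, w, units is)))"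
  by (simp add: pv_def hat_app units_pures)

lemma slot_op_fbasis: "app (slot_op p x s) (fbasis g) = fbasis (slot_act n M N p x s g)"
  by (simp add: slot_op_def app_efl)

lemma bt_linear:
  assumes "is \<in> indices"
  shows "bt (u + u') w is = bt u w is + bt u' w is" "bt (u - u') w is = bt u w is - bt u' w is"
    "bt (sscale M c u) w is = fscale c (bt u w is)" "bt 0 w is = 0"
    "bt u (w + w') is = bt u w is + bt u w' is" "bt u (w - w') is = bt u w is - bt u w' is"
    "bt u (sscale N c w) is = fscale c (bt u w is)" "bt u 0 is = 0"
proof -
  have vs: "length (units is) = d" "set (units is) \<subseteq> carrier_vec K"
    using assms by (auto simp: indices_def)
  interpret L: Vector_Spaces.linear "sscale M" fscale "\<lambda>u. bt u w is" for w
    using vs by (rule linear_pv)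
  interpret R: Vector_Spaces.linear "sscale N" fscale "\<lambda>w. bt u w is" for u
    using vs by (rule linear_pv)
  show "bt (u + u') w is = bt u w is + bt u' w is" "bt (u - u') w is = bt u w is - bt u' w is"
    "bt (sscale M c u) w is = fscale c (bt u w is)" "bt 0 w is = 0"
    by (rule L.add L.diff L.scale L.zero)+
  show "bt u (w + w') is = bt u w is + bt u w' is" "bt u (w - w') is = bt u w is - bt u w' is"
    "bt u (sscale N c w) is = fscale c (bt u w is)" "bt u 0 is = 0"
    by (rule R.add R.diff R.scale R.zero)+
qed

text \<open>The total parity of the first k copies of V, over which an operator in the next copy has
  to pass.\<close>

definition pre :: "nat list \<Rightarrow> nat \<Rightarrow> bit" where
  "pre is k = (\<Sum>l<k. par (is ! l))"

definition a :: "slot \<Rightarrow> nat \<Rightarrow> nat \<Rightarrow> ('a, 'b) pure endo" where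
  "a s i j = hat (slot_op (par i + par j) (unit_mat K i j) s)"

lemma pv_units:
  assumes "is \<in> indices" "\<And>l. l < d \<Longrightarrow> f l = c l \<cdot>\<^sub>v unit_vec K (is ! l)"
  shows "pv u w (map f [0..<d]) = fscale (\<Prod>l<d. c l) (bt u w is)"
proof -
  have 1: "map f [0..<d] = map (\<lambda>l. c l \<cdot>\<^sub>v unit_vec K (is ! l)) [0..<d]"
    using assms(2) by simp
  have "map (\<lambda>l. unit_vec K (is ! l)) [0..<d] = units is"
    using assms(1) by (auto simp: indices_def list_eq_iff_nth_eq)
  then show ?thesis
    unfolding 1 using pv_scale_list[of "\<lambda>l. unit_vec K (is ! l)" u w c] by simp
qed

lemma indices_nth: "is \<in> indices \<Longrightarrow> l < d \<Longrightarrow> is ! l < K"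
  by (auto simp: indices_def dest: nth_mem)

lemma indices_length: "is \<in> indices \<Longrightarrow> length is = d"
  by (simp add: indices_def)

lemma indices_update: "is \<in> indices \<Longrightarrow> i < K \<Longrightarrow> is[l := i] \<in> indices"
  using set_update_subset_insert[of "is" l i] by (auto simp: indices_def)

text \<open>On these tensors a matrix unit produces at most one signed tensor. Every later identity
  of operators thereby becomes a comparison of indices and signs.\<close>

lemma a_bt:
  assumes "is \<in> indices" "i < K" "j < K"
  shows "app (a SlotM i j) (bt u w is) = bt (sact M (unit_mat K i j) u) w is"
    "u \<in> spart M \<alpha> \<Longrightarrow> app (a SlotN i j) (bt u w is)
      = fscale (ksgn ((par i + par j) * \<alpha>)) (bt u (sact N (unit_mat K i j) w) is)"
    "\<lbrakk>u \<in> spart M \<alpha>; w \<in> spart N \<beta>; k \<in> {1..d}\<rbrakk> \<Longrightarrow> app (a (SlotV k) i j) (bt u w is)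
      = fscale (ksgn ((par i + par j) * (\<alpha> + \<beta> + pre is (k - 1))))
          (if is ! (k - 1) = j then bt u w (is[k - 1 := i]) else 0)"
proof -
  let ?p = "par i + par j" and ?x = "unit_mat K i j"
  have slots: "SlotM \<in> MNV_slots d" "SlotN \<in> MNV_slots d" by (simp_all add: MNV_slots_def)
  note descends = descends_slot_op[OF M.unit_mat_gl_carrier]
  note app_a = hat_bt[OF descends assms(1), unfolded slot_op_fbasis, folded pv_def]
  show "app (a SlotM i j) (bt u w is) = bt (sact M (unit_mat K i j) u) w is"
    unfolding a_def using app_a[OF slots(1)] by (simp add: pv_def)
  show "app (a SlotN i j) (bt u w is) = fscale (ksgn (?p * \<alpha>)) (bt u (sact N ?x w) is)" if "u \<in> spart M \<alpha>"
    unfolding a_def using app_a[OF slots(2)] that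
    by (simp add: M.koszul_homogeneous bt_linear[OF assms(1)] flip: pv_def)
  assume u: "u \<in> spart M \<alpha>" and w: "w \<in> spart N \<beta>" and k: "k \<in> {1..d}"
  let ?js = "is[k - 1 := i]"
  let ?c = "\<lambda>l. if l < k - 1 then ksgn (?p * par (is ! l)) else if l = k - 1 then (if is ! l = j then 1 else 0) else 1"
  have js: "?js \<in> indices" using assms by (intro indices_update)
  have len: "length is = d" using assms by (simp add: indices_length)
  have f: "slot_vec ?p ?x k l (units is ! l) = ?c l \<cdot>\<^sub>v unit_vec K (?js ! l)" if "l < d" for l
    using that len indices_nth[OF assms(1) that] assms(2,3)
    by (auto simp: slot_vec_def vkoszul_unit_vec unit_mat_mult_unit_vec)
  have prod: "(\<Prod>l<d. ?c l) = ksgn (?p * pre is (k - 1)) * (if is ! (k - 1) = j then 1 else 0)"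
  proof -
    obtain k' where k': "k = Suc k'" using k by (cases k) auto
    have d: "{..<d} = {..<k'} \<union> insert k' {Suc k'..<d}" using k k' by auto
    have "(\<Prod>l<d. g l) = (\<Prod>l<k'. g l) * (g k' * (\<Prod>l\<in>{Suc k'..<d}. g l))" for g :: "nat \<Rightarrow> complex"
      unfolding d by (subst prod.union_disjoint) auto
    then have "(\<Prod>l<d. ?c l) = (\<Prod>l<k'. ?c l) * (?c k' * (\<Prod>l\<in>{Suc k'..<d}. ?c l))" .
    also have "(\<Prod>l<k'. ?c l) = ksgn (?p * pre is k')"
      by (simp add: pre_def sum_distrib_left ksgn_sum k')
    also have "(\<Prod>l\<in>{Suc k'..<d}. ?c l) = 1" by (intro prod.neutral) (auto simp: k')
    finally show ?thesis by (simp add: k')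
  qed
  have sV: "SlotV k \<in> MNV_slots d" using k by simp
  have "app (a (SlotV k) i j) (bt u w is)
      = pv (koszul M ?p u) (koszul N ?p w) (map (\<lambda>l. slot_vec ?p ?x k l (units is ! l)) [0..<d])"
    unfolding a_def app_a[OF sV] slot_act_factorwise(3)[OF units_pures[OF assms(1)] k]
    by (simp add: factorwise_def pv_def)
  also have "\<dots> = fscale (\<Prod>l<d. ?c l) (bt (koszul M ?p u) (koszul N ?p w) ?js)"
    using js f by (rule pv_units)
  also have "\<dots> = fscale (ksgn (?p * (\<alpha> + \<beta> + pre is (k - 1)))) (if is ! (k - 1) = j then bt u w ?js else 0)"
    unfolding prod using u w
    by (simp add: M.koszul_homogeneous N.koszul_homogeneous bt_linear[OF js[unfolded One_nat_def]] distrib_left ksgn_add)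
  finally show "app (a (SlotV k) i j) (bt u w is)
      = fscale (ksgn (?p * (\<alpha> + \<beta> + pre is (k - 1)))) (if is ! (k - 1) = j then bt u w ?js else 0)" .
qed

lemma a_proj [simp]: "proj * a s i j = a s i j" "a s i j * proj = a s i j"
  by (simp_all add: a_def)

end

lemma bit_add_self [simp]: "p + p = (0 :: bit)" "p + (p + q) = (q :: bit)"
  by (cases p; cases q; simp)+

lemma bit_mult_self [simp]: "p * p = (p :: bit)" "p * (p * q) = p * (q :: bit)"
  by (cases p; simp)+

text \<open>A normal form for signs: parities are multiplied out, \<open>ksgn\<close> turns sums
  into products, and the factors are sorted so that squares cancel.\<close>

lemmas ksgn_norm = distrib_left distrib_right ksgn_add mult.assoc mult.commute mult.left_commute

context tensor_product
begin

lemma app_sg [simp]: "app (sg p) f = fscale (ksgn p) f"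
  by (simp add: sg_eq_sc)

text \<open>Replacing an entry subtracts the old parity and adds the new one; over the field with
  two elements both are additions.\<close>

lemma pre_update:
  assumes "l < length is"
  shows "pre (is[l := i]) k = (if l < k then pre is k + (par (is ! l) + par i) else pre is k)"
proof -
  have ne: "pre (is[l := i]) k = pre is k" if "k \<le> l" for k
    unfolding pre_def using that by (intro sum.cong) auto
  have "pre (is[l := i]) (Suc l + r) = pre is (Suc l + r) + (par (is ! l) + par i)" for r
  proof (induction r)
    case 0
    have "pre (is[l := i]) (Suc l) = pre is l + par i"
      using ne[of l] assms by (simp add: pre_def)
    moreover have "pre is (Suc l) = pre is l + par (is ! l)" by (simp add: pre_def)
    ultimately show ?case by (simp add: add.assoc)
  next
    case (Suc r)
    then show ?case by (simp add: pre_def algebra_simps)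
  qed
  from this[of "k - Suc l"] ne[of k] show ?thesis by (auto simp: not_less)
qed

text \<open>Koszul signs multiply like the parities of the operators add, so each side passes over
  the left factors with the same total sign. What remains is the bracket axiom of M or N, or
  matching of indices in a copy of V.\<close>

lemma a_same:
  assumes s: "s \<in> MNV_slots d" and ijkl: "i < K" "j < K" "k < K" "l < K"
  shows "a s i j * a s k l = sg ((par i + par j) * (par k + par l)) * (a s k l * a s i j)
        + (if j = k then a s i l else 0)
        - sg ((par i + par j) * (par k + par l)) * (if i = l then a s k j else 0)"
    (is "?L = ?R")
proof (rule corner_eqI_bt)
  show "?L * proj = ?L" by (simp add: mult.assoc)
  show "?R * proj = ?R" by (simp add: algebra_simps)
  fix u w "is" \<alpha> \<beta> assume hom: "u \<in> spart M \<alpha>" "w \<in> spart N \<beta>" and "is": "is \<in> indices"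
  note bt = bt_linear[OF "is"] and act = a_bt[OF "is"]
  show "app ?L (bt u w is) = app ?R (bt u w is)"
    using s
  proof (cases rule: slots_cases)
    case 1
    show ?thesis
      unfolding 1 using ijkl by (simp add: act(1) M.act_unit_mats[OF ijkl] bt)
  next
    case 2
    show ?thesis
      unfolding 2 using ijkl hom
      by (simp add: act(2) N.act_unit_mats[OF ijkl] bt fs.scale_right_distrib fs.scale_right_diff_distrib
          ksgn_norm)
  next
    case (3 t)
    have t: "t - 1 < length is" using 3 indices_length[OF "is"] by auto
    show ?thesis
      unfolding 3(1) using ijkl hom 3(2) t
      by (simp add: a_bt "is" indices_update pre_update ksgn_norm)
  qed
qed


lemma M_act_part: "u \<in> spart M \<alpha> \<Longrightarrow> sact M (unit_mat K i j) u \<in> spart M (par i + par j + \<alpha>)"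
  by (rule M.act_parity[OF M.unit_mat_gl_part])

lemma N_act_part: "u \<in> spart N \<alpha> \<Longrightarrow> sact N (unit_mat K i j) u \<in> spart N (par i + par j + \<alpha>)"
  by (rule N.act_parity[OF N.unit_mat_gl_part])

text \<open>The slots are taken from left to right. The operator at \<open>t\<close> passes over the
  factor at \<open>s\<close>, whose parity the operator at \<open>s\<close> changes; this is the
  only difference between the two orders.\<close>

lemma a_anticommute:
  assumes ijkl: "i < K" "j < K" "k < K" "l < K"
    and st: "s = SlotM \<and> t = SlotN \<or> s = SlotM \<and> t \<in> SlotV ` {1..d} \<or> s = SlotN \<and> t \<in> SlotV ` {1..d}
      \<or> (\<exists>p q. s = SlotV p \<and> t = SlotV q \<and> 1 \<le> p \<and> p < q \<and> q \<le> d)"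
  shows "a s i j * a t k l = sg ((par i + par j) * (par k + par l)) * (a t k l * a s i j)"
    (is "?L = ?R")
proof (rule corner_eqI_bt)
  show "?L * proj = ?L" "?R * proj = ?R" by (simp_all add: mult.assoc)
  fix u w "is" \<alpha> \<beta> assume hom: "u \<in> spart M \<alpha>" "w \<in> spart N \<beta>" and "is": "is \<in> indices"
  note bt = bt_linear[OF "is"] and act = a_bt[OF "is"]
  consider "s = SlotM" "t = SlotN" | q where "s = SlotM" "t = SlotV q" "q \<in> {1..d}"
    | q where "s = SlotN" "t = SlotV q" "q \<in> {1..d}"
    | p q where "s = SlotV p" "t = SlotV q" "1 \<le> p" "p < q" "q \<le> d"
    using st by blast
  then show "app ?L (bt u w is) = app ?R (bt u w is)"
  proof cases
    case 1
    then show ?thesis using ijkl hom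
      by (simp add: act(1,2) act(2)[OF _ _ M_act_part] ksgn_norm)
  next
    case (2 q)
    then show ?thesis using ijkl hom
      by (simp add: a_bt "is" indices_update a_bt(3)[OF _ _ _ M_act_part] ksgn_norm)
  next
    case (3 q)
    then show ?thesis using ijkl hom
      by (simp add: a_bt "is" indices_update a_bt(3)[OF _ _ _ _ N_act_part] bt ksgn_norm)
  next
    case (4 p q)
    have len: "p - 1 < length is" "q - 1 < length is" using 4 indices_length[OF "is"] by auto
    have mem: "p \<in> {1..d}" "q \<in> {1..d}" and lt: "p - 1 < q - 1" using 4 by auto
    show ?thesis using ijkl hom 4(1,2) lt len mem
      by (simp add: a_bt[OF _ _ _] "is" indices_update pre_update ksgn_norm list_update_swap)
  qed
qed

text \<open>For slots in the opposite order the reversed equation is available, and it gives the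
  claim because a sign is its own inverse.\<close>

lemma a_diff:
  assumes s: "s \<in> MNV_slots d" and t: "t \<in> MNV_slots d" and ne: "s \<noteq> t"
    and ijkl: "i < K" "j < K" "k < K" "l < K"
  shows "a s i j * a t k l = sg ((par i + par j) * (par k + par l)) * (a t k l * a s i j)"
proof -
  have "?thesis \<or> a t k l * a s i j = sg ((par k + par l) * (par i + par j)) * (a s i j * a t k l)"
    using s t
  proof (cases rule: slots_cases[case_product slots_cases])
    case ("3_3" p q)
    then have "p \<noteq> q" using ne by auto
    then show ?thesis using "3_3" a_anticommute[OF ijkl, of s t] a_anticommute[OF ijkl(3,4,1,2), of t s] 
      by (cases "p < q") auto
  qed (use ne a_anticommute[OF ijkl, of s t] a_anticommute[OF ijkl(3,4,1,2), of t s] in auto)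
  then show ?thesis
    by (auto simp: mult.commute[of "par k + par l"])
qed

sublocale slots: gl_slots K par proj a "MNV_slots d"
  by unfold_locales (fact a_same a_diff a_proj | simp)+

end


section \<open>Signed permutations of the factors\<close>

lemma perm_sign_cong: "(\<And>i. i \<in> {1..d} \<Longrightarrow> c i = c' i) \<Longrightarrow> perm_sign d \<pi> c = perm_sign d \<pi> c'"
  unfolding perm_sign_def by (intro prod.cong refl) (auto simp: pairs_def inv_sign_def)

text \<open>Permutations act on the positions 1 to d, while list positions start from 0.\<close>

definition origin :: "(nat \<Rightarrow> nat) \<Rightarrow> nat \<Rightarrow> nat" where
  "origin \<pi> l = Hilbert_Choice.inv \<pi> (Suc l) - 1"

lemma origin_less: "\<pi> permutes {1..d} \<Longrightarrow> l < d \<Longrightarrow> origin \<pi> l < d"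
  using permutes_in_image[OF permutes_inv, of \<pi> "{1..d}" "Suc l"] by (auto simp: origin_def)

lemma Suc_origin: "\<pi> permutes {1..d} \<Longrightarrow> l < d \<Longrightarrow> Suc (origin \<pi> l) = Hilbert_Choice.inv \<pi> (Suc l)"
  using permutes_in_image[OF permutes_inv, of \<pi> "{1..d}" "Suc l"] by (auto simp: origin_def)

lemma bij_origin:
  assumes "\<pi> permutes {1..d}"
  shows "bij_betw (origin \<pi>) {..<d} {..<d}"
proof -
  have "inj_on (origin \<pi>) {..<d}"
    using Suc_origin[OF assms] by (intro inj_onI) (metis Suc_inject assms lessThan_iff permutes_inverses(1))
  moreover have "origin \<pi> ` {..<d} \<subseteq> {..<d}" using origin_less[OF assms] by auto
  ultimately show ?thesis
    by (simp add: bij_betw_def endo_inj_surj)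
qed

lemma origin_id: "origin id l = l"
  by (simp add: origin_def)

lemma origin_comp:
  assumes "\<pi> permutes {1..d}" "\<pi>' permutes {1..d}" "l < d"
  shows "origin (\<pi> \<circ> \<pi>') l = origin \<pi>' (origin \<pi> l)"
  unfolding origin_def[of "\<pi> \<circ> \<pi>'"] origin_def[of \<pi>'] Suc_origin[OF assms(1,3)]
  using permutes_bij[OF assms(1)] permutes_bij[OF assms(2)] by (simp add: o_inv_distrib)

lemma origin_adj:
  assumes "i \<in> {1..<d}" "l < d"
  shows "origin (adj i) l = (if l = i - 1 then i else if l = i then i - 1 else l)"
  using assms by (auto simp: origin_def Transposition.transpose_def)

context tensor_product
begin

lemma proj_pv [simp]: "app proj (pv u w vs) = pv u w vs"
  by (simp add: pv_def)

definition perm_op :: "(nat \<Rightarrow> nat) \<Rightarrow> (nat \<Rightarrow> bit) \<Rightarrow> ('a, 'b) pure endo" where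
  "perm_op \<pi> ps = efl (\<lambda>g. fbasis (factorwise (\<lambda>u. u) (\<lambda>w. w) (\<lambda>l. vcomp n (ps (origin \<pi> l))) (origin \<pi>) g))"

text \<open>The sign makes sense only on homogeneous factors, so the operator is assembled from all
  parity patterns \<open>ps\<close>, each selected by the component maps in \<open>perm_op\<close>.
  The shift to \<open>i - 1\<close> passes from positions to list indices.\<close>

definition pm :: "(nat \<Rightarrow> nat) \<Rightarrow> ('a, 'b) pure endo" where
  "pm \<pi> = (\<Sum>ps\<in>PiE {..<d} (\<lambda>_. UNIV). sc (perm_sign d \<pi> (\<lambda>i. ps (i - 1))) * hat (perm_op \<pi> ps))"

lemma descends_perm_op: "\<pi> permutes {1..d} \<Longrightarrow> descends (perm_op \<pi> ps)"
  unfolding perm_op_def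
  by (intro descends_factorwise M.linear_scale_id N.linear_scale_id vec_linear_vcomp bij_origin)

lemma sc_comm: "sc c * F = F * sc c"
  by (rule endo_eqI) simp

lemma pm_proj [simp]: "proj * pm \<pi> = pm \<pi>" "pm \<pi> * proj = pm \<pi>"
proof -
  have "proj * (sc c * hat F) = sc c * hat F" for c F
    by (metis mult.assoc proj_hat(1) sc_comm)
  then show "proj * pm \<pi> = pm \<pi>" "pm \<pi> * proj = pm \<pi>"
    by (simp_all add: pm_def sum_distrib_left sum_distrib_right mult.assoc)
qed

definition permute :: "(nat \<Rightarrow> nat) \<Rightarrow> nat list \<Rightarrow> nat list" where
  "permute \<pi> is = map (\<lambda>l. is ! origin \<pi> l) [0..<d]"

lemma permute_indices: "\<pi> permutes {1..d} \<Longrightarrow> is \<in> indices \<Longrightarrow> permute \<pi> is \<in> indices"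
  using origin_less indices_nth by (auto simp: permute_def indices_def)

lemma perm_op_bt:
  assumes \<pi>: "\<pi> permutes {1..d}" and "is": "is \<in> indices"
  shows "app (hat (perm_op \<pi> ps)) (bt u w is)
    = (if \<forall>l<d. ps l = par (is ! l) then bt u w (permute \<pi> is) else 0)"
proof -
  let ?js = "permute \<pi> is"
  have js: "?js \<in> indices" using assms by (rule permute_indices)
  let ?c = "\<lambda>l. if ps l = par (is ! l) then 1 else 0"
  have "app (hat (perm_op \<pi> ps)) (bt u w is)
      = pv u w (map (\<lambda>l. vcomp n (ps (origin \<pi> l)) (units is ! origin \<pi> l)) [0..<d])"
    unfolding hat_bt[OF descends_perm_op[OF \<pi>] "is"]
    by (simp add: perm_op_def app_efl factorwise_def pv_def)
  also have "\<dots> = fscale (\<Prod>l<d. ?c (origin \<pi> l)) (bt u w ?js)"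
  proof (rule pv_units[OF js])
    fix l assume l: "l < d"
    have b: "origin \<pi> l < d" using \<pi> l by (rule origin_less)
    then show "vcomp n (ps (origin \<pi> l)) (units is ! origin \<pi> l) = ?c (origin \<pi> l) \<cdot>\<^sub>v unit_vec K (?js ! l)"
      using l indices_length[OF "is"] indices_nth[OF "is" b]
      by (auto simp: permute_def vcomp_unit_vec)
  qed
  also have "(\<Prod>l<d. ?c (origin \<pi> l)) = (\<Prod>l<d. ?c l)"
    using prod.reindex_bij_betw[OF bij_origin[OF \<pi>], of ?c] by simp
  also have "\<dots> = (if \<forall>l<d. ps l = par (is ! l) then 1 else 0 :: complex)"
    by auto
  finally show ?thesis by auto
qed

lemma pm_bt:
  assumes \<pi>: "\<pi> permutes {1..d}" and "is": "is \<in> indices"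
  shows "app (pm \<pi>) (bt u w is) = fscale (perm_sign d \<pi> (\<lambda>i. par (is ! (i - 1)))) (bt u w (permute \<pi> is))"
proof -
  \<comment> \<open>This is the one pattern that does not annihilate the tensor; the restriction
    makes it a member of the index set of the sum.\<close>
  let ?qs = "restrict (\<lambda>l. par (is ! l)) {..<d}"
  have eq: "(\<forall>l<d. ps l = par (is ! l)) \<longleftrightarrow> ps = ?qs" if "ps \<in> PiE {..<d} (\<lambda>_. UNIV)" for ps
  proof
    assume "\<forall>l<d. ps l = par (is ! l)"
    then show "ps = ?qs" using that by (intro extensionalityI[of _ "{..<d}"]) (auto simp: PiE_def)
  qed auto
  have fin: "finite (PiE {..<d} (\<lambda>_. UNIV :: bit set))"
    by (intro finite_PiE) (auto simp: UNIV_bit_eq)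
  have "app (pm \<pi>) (bt u w is) = (\<Sum>ps\<in>PiE {..<d} (\<lambda>_. UNIV).
      fscale (perm_sign d \<pi> (\<lambda>i. ps (i - 1))) (if \<forall>l<d. ps l = par (is ! l) then bt u w (permute \<pi> is) else 0))"
    by (simp add: pm_def perm_op_bt[OF assms])
  also have "\<dots> = (\<Sum>ps\<in>PiE {..<d} (\<lambda>_. UNIV).
      if ps = ?qs then fscale (perm_sign d \<pi> (\<lambda>i. ?qs (i - 1))) (bt u w (permute \<pi> is)) else 0)"
  proof (intro sum.cong refl)
    fix ps :: "nat \<Rightarrow> bit" assume "ps \<in> PiE {..<d} (\<lambda>_. UNIV)"
    note eq[OF this]
    then show "fscale (perm_sign d \<pi> (\<lambda>i. ps (i - 1))) (if \<forall>l<d. ps l = par (is ! l) then bt u w (permute \<pi> is) else 0)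
      = (if ps = ?qs then fscale (perm_sign d \<pi> (\<lambda>i. ?qs (i - 1))) (bt u w (permute \<pi> is)) else 0)"
      by (cases "ps = ?qs") (simp_all only: if_True if_False refl fs.scale_zero_right)
  qed
  also have "\<dots> = fscale (perm_sign d \<pi> (\<lambda>i. ?qs (i - 1))) (bt u w (permute \<pi> is))"
    using fin by (simp add: sum.delta)
  also have "perm_sign d \<pi> (\<lambda>i. ?qs (i - 1)) = perm_sign d \<pi> (\<lambda>i. par (is ! (i - 1)))"
    by (rule perm_sign_cong) auto
  finally show ?thesis .
qed

lemma pm_id: "pm id = proj"
proof (rule corner_eqI_bt)
  fix u w "is" assume "is": "is \<in> indices"
  have "permute id is = is"
    using indices_length[OF "is"] map_nth[of "is"] by (simp add: permute_def origin_id)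
  then show "app (pm id) (bt u w is) = app proj (bt u w is)"
    by (simp add: pm_bt[OF permutes_id "is"] perm_sign_id)
qed (simp_all add: proj_idem)

lemma pm_comp:
  assumes \<pi>: "\<pi> permutes {1..d}" "\<pi>' permutes {1..d}"
  shows "pm \<pi> * pm \<pi>' = pm (\<pi> \<circ> \<pi>')"
proof (rule corner_eqI_bt)
  fix u w "is" assume "is": "is \<in> indices"
  have 1: "permute \<pi> (permute \<pi>' is) = permute (\<pi> \<circ> \<pi>') is"
    using assms origin_less[OF \<pi>(1)] by (auto simp: permute_def origin_comp)
  \<comment> \<open>The factor found at position i after \<open>\<pi>'\<close> came from the inverse
    image of i, which is the shift of parities required by \<open>perm_sign_comp\<close>.\<close>
  have "perm_sign d \<pi> (\<lambda>i. par (permute \<pi>' is ! (i - 1)))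
      = perm_sign d \<pi> ((\<lambda>i. par (is ! (i - 1))) \<circ> Hilbert_Choice.inv \<pi>')"
  proof (rule perm_sign_cong)
    fix i assume "i \<in> {1..d}"
    then have "i - 1 < d" "Suc (i - 1) = i" by auto
    then show "par (permute \<pi>' is ! (i - 1)) = ((\<lambda>i. par (is ! (i - 1))) \<circ> Hilbert_Choice.inv \<pi>') i"
      by (simp add: permute_def origin_def)
  qed
  then show "app (pm \<pi> * pm \<pi>') (bt u w is) = app (pm (\<pi> \<circ> \<pi>')) (bt u w is)"
    using "is"
    by (simp add: pm_bt[OF \<pi>(2)] pm_bt[OF \<pi>(1)] pm_bt[OF permutes_compose[OF \<pi>(2,1)]]
        permute_indices[OF \<pi>(2)] perm_sign_comp[OF \<pi>] 1)
qed (simp_all add: mult.assoc)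

lemma pm_adj_bt:
  assumes "i \<in> {1..<d}" "is \<in> indices"
  shows "app (pm (adj i)) (bt u w is) = fscale (ksgn (par (is ! (i - 1)) * par (is ! i)))
    (bt u w (is[i - 1 := is ! i, i := is ! (i - 1)]))"
proof -
  have "permute (adj i) is = is[i - 1 := is ! i, i := is ! (i - 1)]"
    using assms indices_length[OF assms(2)]
    by (intro nth_equalityI) (auto simp: permute_def origin_adj nth_list_update)
  then show ?thesis
    using pm_bt[OF permutes_swap_id, of i "Suc i" "is" u w] assms perm_sign_adj[OF assms(1)] by auto
qed

text \<open>If the operator acts beyond both swapped copies, it passes over them in either order. If
  it acts on one of them, it gains or loses the sign of passing the other, and the sign of the swap
  changes accordingly, since the operator has changed a parity.\<close>

lemma pm_adj:
  assumes i: "i \<in> {1..<d}" and s: "s \<in> MNV_slots d" and kl: "k < K" "l < K"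
  shows "pm (adj i) * a s k l = a (slot_perm (adj i) s) k l * pm (adj i)"
    (is "?L = ?R")
proof (rule corner_eqI_bt)
  show "?L * proj = ?L" "?R * proj = ?R" by (simp_all add: mult.assoc)
  fix u w "is" \<alpha> \<beta> assume hom: "u \<in> spart M \<alpha>" "w \<in> spart N \<beta>" and "is": "is \<in> indices"
  obtain i' where i': "i = Suc i'" using i by (cases i) auto
  let ?js = "is[i' := is ! Suc i', Suc i' := is ! i']"
  have len: "length is = d" using "is" by (rule indices_length)
  have id: "i < d" "i' < d" using i i' by auto
  have js: "?js \<in> indices" using "is" id i' by (intro indices_update indices_nth) auto
  note act = a_bt pm_adj_bt indices_update[OF "is"] i'
  show "app ?L (bt u w is) = app ?R (bt u w is)"
    using s
  proof (cases rule: slots_cases)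
    case 1
    then show ?thesis using kl i by (simp add: act "is" js)
  next
    case 2
    then show ?thesis using kl hom i by (simp add: act "is" js mult.commute)
  next
    case (3 t)
    obtain t' where t': "t = Suc t'" "t' < d" using 3 by (cases t) auto
    have adj: "adj i t \<in> {1..d}"
      using 3(2) i permutes_in_image[OF permutes_swap_id, of i "{1..d}" "Suc i" t] by auto
    have pre_Suc: "pre is (Suc r) = pre is r + par (is ! r)" for r by (simp add: pre_def)
    note pre = pre_update pre_Suc
    consider "t = i" | "t = Suc i" | "t < i" | "Suc i < t" by linarith
    then show ?thesis
    proof cases
      case 1
      then show ?thesis using kl hom i 3 adj len id t'
        by (simp add: act "is" js pre ksgn_norm list_update_swap)
    next
      case 2
      then show ?thesis using kl hom i 3 adj len id t'
        by (simp add: act "is" js pre ksgn_norm list_update_swap)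
    next
      case 3
      then show ?thesis using kl hom i \<open>s = _\<close> \<open>t \<in> _\<close> adj len id t'
        by (simp add: act "is" js pre ksgn_norm list_update_swap Transposition.transpose_def)
    next
      case 4
      then show ?thesis using kl hom i \<open>s = _\<close> \<open>t \<in> _\<close> adj len id t'
        by (simp add: act "is" js pre ksgn_norm list_update_swap Transposition.transpose_def)
    qed
  qed
qed


text \<open>Of all pairs of matrix units exactly one acts nontrivially: it writes the index of each
  copy into the other. The weight of the summand and the Koszul signs combine to the sign of the
  swap.\<close>

lemma cas2_adj:
  assumes i: "i \<in> {1..<d}"
  shows "slots.cas2 (SlotV i) (SlotV (Suc i)) = pm (adj i)"
proof (rule corner_eqI_bt)
  show "slots.cas2 (SlotV i) (SlotV (Suc i)) * proj = slots.cas2 (SlotV i) (SlotV (Suc i))"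
    by (rule slots.cas2_e)
  fix u w "is" \<alpha> \<beta> assume hom: "u \<in> spart M \<alpha>" "w \<in> spart N \<beta>" and "is": "is \<in> indices"
  obtain i' where i': "i = Suc i'" using i by (cases i) auto
  have len: "length is = d" using "is" by (rule indices_length)
  have id: "Suc i' < d" "i' < d" using i i' by auto
  have K: "is ! i' < K" "is ! Suc i' < K" using id by (simp_all add: indices_nth[OF "is"])
  have pre_Suc: "pre is (Suc r) = pre is r + par (is ! r)" for r by (simp add: pre_def)
  let ?X = "bt u w (is[i' := is ! Suc i', Suc i' := is ! i'])"
  let ?s = "fscale (ksgn (par (is ! i') * par (is ! Suc i'))) ?X"
  have "app (sg (par l) * (a (SlotV i) k l * a (SlotV (Suc i)) l k)) (bt u w is)
      = (if l = is ! i' then if k = is ! Suc i' then ?s else 0 else 0)" if "k < K" "l < K" for k l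
    using that id hom K len
    by (auto simp: i' a_bt "is" indices_update[OF "is"] pre_update pre_Suc ksgn_norm list_update_swap)
  then have "app (slots.cas2 (SlotV i) (SlotV (Suc i))) (bt u w is)
      = (\<Sum>k<K. \<Sum>l<K. if l = is ! i' then if k = is ! Suc i' then ?s else 0 else 0)"
    unfolding slots.cas2_def app_sum by (intro sum.cong refl) auto
  also have "\<dots> = ?s"
    using K by simp
  finally show "app (slots.cas2 (SlotV i) (SlotV (Suc i))) (bt u w is) = app (pm (adj i)) (bt u w is)"
    using "is" i by (simp add: i' pm_adj_bt)
qed simp

text \<open>Since E_ij E_ji = E_ii, the Casimir element acts by the signed count of indices, which
  is n - m. The scalar is obtained by choice, so it must be tested on a nonzero vector, and this
  requires a positive dimension.\<close>

lemma kappa_V_eq: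
  assumes "0 < K"
  shows "kappa_V n m = (\<Sum>j<K. ksgn (par j))"
proof -
  define c0 where "c0 = (\<Sum>j<K. ksgn (par j))"
  define T where "T v = vec K (\<lambda>r. \<Sum>i<K. \<Sum>j<K. ksgn (par j) * (unit_mat K i j *\<^sub>v (unit_mat K j i *\<^sub>v v)) $ r)"
    for v :: "complex vec"
  have entry: "(unit_mat K i j *\<^sub>v (unit_mat K j i *\<^sub>v v)) $ r = (if r = i then v $ i else 0)"
    if "i < K" "j < K" "r < K" "v \<in> carrier_vec K" for i j r and v :: "complex vec"
  proof -
    have "unit_mat K i j *\<^sub>v (unit_mat K j i *\<^sub>v v) = unit_mat K i i *\<^sub>v v"
      using that by (simp add: unit_mat_mult flip: assoc_mult_mat_vec[of _ K K _ K])
    then show ?thesis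
      using that by (auto simp: unit_mat_def scalar_prod_def if_distrib[of "\<lambda>x. x * _"] sum.delta cong: if_cong)
  qed
  have T: "T v = c0 \<cdot>\<^sub>v v" if "v \<in> carrier_vec K" for v
  proof (rule eq_vecI)
    fix r assume "r < dim_vec (c0 \<cdot>\<^sub>v v)"
    then have r: "r < K" using that by simp
    have "T v $ r = (\<Sum>i<K. \<Sum>j<K. if r = i then ksgn (par j) * v $ i else 0)"
      unfolding T_def index_vec[OF r]
    proof (intro sum.cong refl)
      fix i j assume "i \<in> {..<K}" "j \<in> {..<K}"
      then have "(unit_mat K i j *\<^sub>v (unit_mat K j i *\<^sub>v v)) $ r = (if r = i then v $ i else 0)"
        using r that by (intro entry) auto
      then show "ksgn (par j) * (unit_mat K i j *\<^sub>v (unit_mat K j i *\<^sub>v v)) $ r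
          = (if r = i then ksgn (par j) * v $ i else 0)"
        by (simp only: if_distrib[of "(*) _"] mult_zero_right)
    qed
    also have "\<dots> = (\<Sum>j<K. \<Sum>i<K. if r = i then ksgn (par j) * v $ i else 0)"
      by (rule sum.swap)
    also have "\<dots> = c0 * v $ r" using r by (simp add: c0_def sum_distrib_right)
    finally show "T v $ r = (c0 \<cdot>\<^sub>v v) $ r" using r that by simp
  qed (use that in \<open>simp add: T_def\<close>)
  have "\<forall>v\<in>carrier_vec K. T v = kappa_V n m \<cdot>\<^sub>v v"
    unfolding kappa_V_def T_def[symmetric] by (rule someI[of _ c0]) (simp add: T)
  then have "kappa_V n m \<cdot>\<^sub>v unit_vec K 0 = c0 \<cdot>\<^sub>v (unit_vec K 0 :: complex vec)"
    using T by simp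
  then have "(kappa_V n m \<cdot>\<^sub>v unit_vec K 0) $ 0 = (c0 \<cdot>\<^sub>v (unit_vec K 0 :: complex vec)) $ 0"
    by simp
  then show ?thesis using assms by (simp add: c0_def)
qed

text \<open>Both operators act in the same copy of V, so the Koszul signs from the left cancel. Only
  i equal to the current index survives, and the sum over j is the scalar computed in
  \<open>kappa_V_eq\<close>.\<close>

lemma cas2_V:
  assumes k: "k \<in> {1..d}"
  shows "slots.cas2 (SlotV k) (SlotV k) = sc (kappa_V n m) * proj"
proof (rule corner_eqI_bt)
  show "slots.cas2 (SlotV k) (SlotV k) * proj = slots.cas2 (SlotV k) (SlotV k)"
    by (rule slots.cas2_e)
  fix u w "is" \<alpha> \<beta> assume hom: "u \<in> spart M \<alpha>" "w \<in> spart N \<beta>" and "is": "is \<in> indices"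
  obtain k' where k': "k = Suc k'" using k by (cases k) auto
  have len: "length is = d" using "is" by (rule indices_length)
  have kd: "k' < d" using k k' by auto
  have K: "is ! k' < K" using kd by (simp add: indices_nth[OF "is"])
  have "app (sg (par j) * (a (SlotV k) i j * a (SlotV k) j i)) (bt u w is)
      = (if i = is ! k' then fscale (ksgn (par j)) (bt u w is) else 0)" if "i < K" "j < K" for i j
    using that hom kd len
    by (auto simp: k' a_bt "is" indices_update[OF "is"] pre_update ksgn_norm)
  then have "app (slots.cas2 (SlotV k) (SlotV k)) (bt u w is)
      = (\<Sum>i<K. \<Sum>j<K. if i = is ! k' then fscale (ksgn (par j)) (bt u w is) else 0)"
    unfolding slots.cas2_def app_sum by (intro sum.cong refl) auto
  also have "\<dots> = (\<Sum>j<K. \<Sum>i<K. if i = is ! k' then fscale (ksgn (par j)) (bt u w is) else 0)"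
    by (rule sum.swap)
  also have "\<dots> = (\<Sum>j<K. fscale (ksgn (par j)) (bt u w is))"
    using K by simp
  also have "\<dots> = fscale (kappa_V n m) (bt u w is)"
  proof -
    \<comment> \<open>A tensor with a copy of V has an index below K, which is the nondegeneracy
      that \<open>kappa_V_eq\<close> needs.\<close>
    have "0 < K" using K by auto
    show ?thesis unfolding kappa_V_eq[OF \<open>0 < K\<close>] by (rule fs.scale_sum_left[symmetric])
  qed
  finally show "app (slots.cas2 (SlotV k) (SlotV k)) (bt u w is) = app (sc (kappa_V n m) * proj) (bt u w is)"
    by simp
qed (simp add: mult.assoc proj_idem)

lemma sc_add: "sc (c + c') = sc c + sc c'"
  by (rule endo_eqI) (simp add: fs.scale_left_distrib)

lemma sc_mult: "sc (c * c') = sc c * sc c'"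
  by (rule endo_eqI) simp

lemma sc_one: "sc 1 = 1"
  by (rule endo_eqI) simp

sublocale braid: braid_slots K par proj a d sc pm "kappa_V n m"
  by unfold_locales (rule sc_add sc_mult sc_one sc_comm pm_id pm_comp pm_proj pm_adj cas2_adj cas2_V; assumption)+

end


section \<open>Induced operators on the quotient\<close>

context tensor_product
begin

abbreviation tclass :: "(('a, 'b) pure \<Rightarrow>\<^sub>0 complex) \<Rightarrow> (('a, 'b) pure \<Rightarrow>\<^sub>0 complex) set" where
  "tclass \<equiv> tensor_class n m d M N"

abbreviation "T \<equiv> tensor_space n m d M N"

lemma mem_tclass: "h \<in> tclass f \<longleftrightarrow> h - f \<in> null"
proof -
  have "h \<in> tclass f \<longleftrightarrow> (\<exists>g\<in>null. h = g + f)"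
    by (simp add: tensor_class_def a_r_coset_def' free_module_def)
  also have "\<dots> \<longleftrightarrow> h - f \<in> null" by (metis add_diff_cancel_right' diff_add_cancel)
  finally show ?thesis .
qed

lemma tclass_eq_iff: "tclass f = tclass g \<longleftrightarrow> f - g \<in> null"
proof
  assume "tclass f = tclass g"
  then have "f \<in> tclass g" by (metis mem_tclass diff_self fs.subspace_0[OF subspace_null])
  then show "f - g \<in> null" by (simp add: mem_tclass)
next
  assume fg: "f - g \<in> null"
  have "h - f \<in> null \<longleftrightarrow> h - g \<in> null" for h
    using fs.subspace_add[OF subspace_null fg, of "h - f"] fs.subspace_diff[OF subspace_null _ fg, of "h - g"]
    by (auto simp: algebra_simps)
  then show "tclass f = tclass g" by (auto simp: mem_tclass)
qed

lemma tclass_self: "f \<in> tclass f"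
  by (simp add: mem_tclass fs.subspace_0[OF subspace_null])

lemma carrier_T: "carrier T = tclass ` C"
  by (auto simp: tensor_space_def A_RCOSETS_def' tensor_class_def free_module_def C_def)

lemma zero_T: "\<zero>\<^bsub>T\<^esub> = tclass 0" 
  by (auto simp: tensor_space_def mem_tclass)

lemma add_T: "tclass f \<oplus>\<^bsub>T\<^esub> tclass g = tclass (f + g)"
proof (intro Set.set_eqI iffI)
  fix h assume "h \<in> tclass f \<oplus>\<^bsub>T\<^esub> tclass g"
  then obtain f' g' where "f' \<in> tclass f" "g' \<in> tclass g" "h = f' + g'"
    by (auto simp: tensor_space_def set_add_def' free_module_def)
  then show "h \<in> tclass (f + g)"
    using fs.subspace_add[OF subspace_null, of "f' - f" "g' - g"] by (simp add: mem_tclass algebra_simps)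
next
  fix h assume "h \<in> tclass (f + g)"
  then have "h - g \<in> tclass f" by (simp add: mem_tclass algebra_simps)
  then have "(h - g) + g \<in> {f' + g' | f' g'. f' \<in> tclass f \<and> g' \<in> tclass g}"
    using tclass_self[of g] by blast
  then show "h \<in> tclass f \<oplus>\<^bsub>T\<^esub> tclass g"
    by (auto simp: tensor_space_def set_add_def' free_module_def)
qed

text \<open>Induced maps and scalar multiples are formed as unions over all representatives; when
  the choice does not matter, the union is that of a constant family.\<close>

lemma UN_tclass:
  assumes "\<And>f'. f' - f \<in> null \<Longrightarrow> F f' - F f \<in> null"
  shows "(\<Union>f'\<in>tclass f. tclass (F f')) = tclass (F f)"
proof -
  have "(\<Union>f'\<in>tclass f. tclass (F f')) = (\<Union>f'\<in>tclass f. tclass (F f))"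
    using assms by (intro SUP_cong refl) (simp add: mem_tclass tclass_eq_iff)
  also have "\<dots> = tclass (F f)" using tclass_self[of f] by auto
  finally show ?thesis .
qed

lemma smult_T: "c \<odot>\<^bsub>T\<^esub> tclass f = tclass (fscale c f)"
proof -
  have "fscale c f' - fscale c f \<in> null" if "f' - f \<in> null" for f'
    using fs.subspace_scale[OF subspace_null that, of c] by (simp add: fs.scale_right_diff_distrib)
  then show ?thesis by (simp add: tensor_space_def UN_tclass)
qed

definition ind :: "('a, 'b) pure endo \<Rightarrow> (('a, 'b) pure \<Rightarrow>\<^sub>0 complex) set \<Rightarrow> (('a, 'b) pure \<Rightarrow>\<^sub>0 complex) set" where
  "ind G = induced n m d M N (app G)"

lemma ind_tclass:
  assumes "descends G" "f \<in> C"
  shows "ind G (tclass f) = tclass (app G f)"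
proof -
  have "app G f' - app G f \<in> null" if "f' - f \<in> null" for f'
    using assms(1) that by (simp add: descends_def flip: app_linear(2))
  then show ?thesis
    using assms(2) by (simp add: ind_def induced_def carrier_T UN_tclass)
qed

lemma ind_extensional: "ind G \<in> extensional (carrier T)"
  by (simp add: ind_def induced_def)

lemma T_ext:
  assumes "F \<in> extensional (carrier T)" "G \<in> extensional (carrier T)"
    and "\<And>f. f \<in> C \<Longrightarrow> F (tclass f) = G (tclass f)"
  shows "F = G"
  using assms by (intro extensionalityI[of _ "carrier T"]) (auto simp: carrier_T)

text \<open>The way back from ring identities in the corner to maps of the quotient.\<close>

lemma ind_eqI:
  assumes "descends F" "descends G" "hat F = hat G"
  shows "ind F = ind G"
proof (rule T_ext[OF ind_extensional ind_extensional])
  fix f assume f: "f \<in> C"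
  have "app proj (app F f) = app proj (app G f)"
    using assms f hat_app by metis
  moreover have "app F f \<in> C" "app G f \<in> C" using assms f by (auto simp: descends_def)
  ultimately show "ind F (tclass f) = ind G (tclass f)"
    using assms f by (simp add: ind_tclass tclass_eq_iff proj_eq_iff)
qed

lemma hat_hat: "hat (hat F) = hat F"
  by (metis hat_def proj_hat)

lemma ind_hat: "descends F \<Longrightarrow> ind (hat F) = ind F"
  by (rule ind_eqI[OF descends_hat]) (simp_all add: hat_hat)

lemma induced_eq_ind:
  assumes "\<And>f. f \<in> C \<Longrightarrow> F f = app G f"
  shows "induced n m d M N F = ind G"
proof -
  have "f' \<in> C" if "f' \<in> tclass f" "f \<in> C" for f f'
    using that null_C fs.subspace_add[OF subspace_C, of "f' - f" f] by (auto simp: mem_tclass)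
  then show ?thesis
    using assms unfolding ind_def induced_def by (intro restrict_ext) (auto simp: carrier_T)
qed

text \<open>The left side is built from raw slot actions, the right side from projected ones. Both
  give the same element of the corner because \<open>hat\<close> is multiplicative on operators that
  descend.\<close>

lemma casimir_eq:
  assumes S: "S \<subseteq> MNV_slots d"
  shows "casimir n m d M N S = ind (slots.cas S)"
proof -
  let ?A = "\<lambda>i j. \<Sum>s\<in>S. slot_op (par i + par j) (unit_mat K i j) s"
  let ?G = "\<Sum>i<K. \<Sum>j<K. sc (ksgn (par j)) * (?A i j * ?A j i)"
  have descends_op: "descends (slot_op p (unit_mat K i j) s)" if "s \<in> S" for p i j s
    using that S by (intro descends_slot_op M.unit_mat_gl_carrier) auto
  then have descends: "descends ?G" by (intro descends_sum descends_mult descends_sc)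
  have "hat (?A i j * ?A j i) = slots.act S i j * slots.act S j i" for i j
    by (simp add: hat_mult descends_sum descends_op hat_sum slots.act_def a_def)
  then have "hat ?G = slots.cas S"
    unfolding slots.cas_def hat_sum hat_sc by (simp only: sg_eq_sc)
  then have "ind (slots.cas S) = ind ?G"
    using ind_hat[OF descends] by simp
  moreover have "casimir n m d M N S = ind ?G"
    unfolding casimir_def 
    by (rule induced_eq_ind) (simp only: slots_act_def slot_op_def app_sum app_ops app_sc app_efl)
  ultimately show ?thesis by simp
qed

lemma app_eq_C:
  assumes "\<And>g. g \<in> pures \<Longrightarrow> app F (fbasis g) = app G (fbasis g)" "f \<in> C"
  shows "app F f = app G f"
  using assms(2)[unfolded C_eq_span]
  by (induction rule: fs.span_induct_alt) (auto simp: assms(1))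

text \<open>The swap separates parities only in the two positions concerned, whereas
  \<open>pm\<close> does so in all of them; on tensors of unit vectors both produce the same signed
  term.\<close>

lemma signed_swap_eq:
  assumes i: "i \<in> {1..<d}"
  shows "signed_swap n m d M N i = ind (pm (adj i))"
proof -
  \<comment> \<open>Position i - 1 receives the factor from position i, whose parity is q, and vice
    versa.\<close>
  define F where "F p q = (\<lambda>l. if l = i - 1 then vcomp n q else if l = i then vcomp n p else (\<lambda>v. v))" for p q
  define G where "G p q = efl (\<lambda>g. fbasis (factorwise (\<lambda>u. u) (\<lambda>w. w) (F p q) (origin (adj i)) g))" for p q
  let ?G = "\<Sum>p\<in>UNIV. \<Sum>q\<in>UNIV. sc (ksgn (p * q)) * G p q"
  obtain i' where i': "i = Suc i'" using i by (cases i) auto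
  have perm: "adj i permutes {1..d}" using i by (intro permutes_swap_id) auto
  have descends_G: "descends (G p q)" for p q
    unfolding G_def F_def
    by (intro descends_factorwise M.linear_scale_id N.linear_scale_id bij_origin[OF perm])
      (simp add: vec_linear_vcomp vec_linear_id)
  then have descends: "descends ?G" by (intro descends_sum descends_mult descends_sc)
  have G: "app (G p q) (fbasis (u, w, vs)) = fbasis (u, w, vs[i - 1 := vcomp n q (vs ! i), i := vcomp n p (vs ! (i - 1))])"
    if "(u, w, vs) \<in> pures" for p q u w vs
  proof -
    have "map (\<lambda>l. F p q l (vs ! origin (adj i) l)) [0..<d]
        = vs[i - 1 := vcomp n q (vs ! i), i := vcomp n p (vs ! (i - 1))]"
      using i that by (intro nth_equalityI) (auto simp: F_def origin_adj pures_iff nth_list_update)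
    then show ?thesis by (simp add: G_def app_efl factorwise_def)
  qed
  have "signed_swap n m d M N i = ind ?G"
    unfolding signed_swap_def
  proof (rule induced_eq_ind, unfold app_efl[symmetric], rule app_eq_C)
    fix g :: "('a, 'b) pure" assume "g \<in> pures"
    then show "app (efl (\<lambda>(u, w, vs). \<Sum>p\<in>UNIV. \<Sum>q\<in>UNIV. fscale (ksgn (p * q))
        (fbasis (u, w, vs[i - 1 := vcomp n q (vs ! i), i := vcomp n p (vs ! (i - 1))])))) (fbasis g)
        = app ?G (fbasis g)"
      by (cases g) (simp add: app_efl G)
  qed
  also have "\<dots> = ind (hat ?G)" by (rule ind_hat[OF descends, symmetric])
  also have "hat ?G = pm (adj i)"
  proof (rule corner_eqI_bt)
    fix u w "is" assume "is": "is \<in> indices"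
    have len: "length is = d" using "is" by (rule indices_length)
    have id: "Suc i' < d" "i' < d" using i i' by auto
    have K: "is ! i' < K" "is ! Suc i' < K" using id by (simp_all add: indices_nth[OF "is"])
    let ?js = "is[i' := is ! Suc i', Suc i' := is ! i']"
    let ?c = "\<lambda>b. if b then 1 else 0 :: complex"
    have hatG: "app (hat (G p q)) (bt u w is)
        = fscale (?c (par (is ! i') = p)) (fscale (?c (par (is ! Suc i') = q)) (bt u w ?js))" for p q
    proof -
      let ?e = "\<lambda>l. unit_vec K (is ! l)"
      let ?cp = "?c (par (is ! i') = p)" and ?cq = "?c (par (is ! Suc i') = q)"
      have p1: "(u, w, (units is)[i' := ?cq \<cdot>\<^sub>v ?e (Suc i')]) \<in> pures"
        by (intro pures_update[OF units_pures[OF "is"]]) simp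
      have p2: "(u, w, (units is)[Suc i' := ?e i']) \<in> pures"
        by (intro pures_update[OF units_pures[OF "is"]]) simp
      have "app (hat (G p q)) (bt u w is)
          = pv u w ((units is)[i' := ?cq \<cdot>\<^sub>v ?e (Suc i'), Suc i' := ?cp \<cdot>\<^sub>v ?e i'])"
        unfolding hat_bt[OF descends_G "is"] G[OF units_pures[OF "is"]] using K id len
        by (simp add: pv_def i' vcomp_unit_vec)
      also have "\<dots> = fscale ?cp (pv u w ((units is)[i' := ?cq \<cdot>\<^sub>v ?e (Suc i'), Suc i' := ?e i']))"
        by (rule pv_add(6)[OF p1 id(1)]) simp
      \<comment> \<open>The two updates are exchanged because \<open>pv_add(6)\<close> extracts a
        scalar only from the last one.\<close>
      also have "(units is)[i' := ?cq \<cdot>\<^sub>v ?e (Suc i'), Suc i' := ?e i']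
          = (units is)[Suc i' := ?e i', i' := ?cq \<cdot>\<^sub>v ?e (Suc i')]"
        by (rule list_update_swap) simp
      also have "pv u w \<dots> = fscale ?cq (pv u w ((units is)[Suc i' := ?e i', i' := ?e (Suc i')]))"
        by (rule pv_add(6)[OF p2 id(2)]) simp
      also have "(units is)[Suc i' := ?e i', i' := ?e (Suc i')] = units ?js"
        by (simp add: map_update list_update_swap[of "Suc i'" i'])
      finally show ?thesis .
    qed
    have "app (hat ?G) (bt u w is) = fscale (ksgn (par (is ! i') * par (is ! Suc i'))) (bt u w ?js)"
      unfolding hat_sum hat_sc
      by (cases "par (is ! i')"; cases "par (is ! Suc i')") (simp_all add: hatG UNIV_bit_eq)
    then show "app (hat ?G) (bt u w is) = app (pm (adj i)) (bt u w is)"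
      using pm_adj_bt[OF i "is", of u w] by (simp add: i')
  qed simp_all
  finally show ?thesis .
qed

end


section \<open>Even operators commuting with the Lie superalgebra\<close>

lemma sum_list_nth: "length xs = length ys \<Longrightarrow> sum_list (xs :: bit list) = (\<Sum>k<length ys. xs ! k)"
  by (simp add: sum_list_sum_nth lessThan_atLeast0)

context tensor_product
begin

definition hom_pures :: "bit \<Rightarrow> ('a, 'b) pure set" where
  "hom_pures p = {(u, w, vs) | u w vs. \<exists>\<alpha> \<beta> ps. u \<in> spart M \<alpha> \<and> w \<in> spart N \<beta>
     \<and> length vs = d \<and> length ps = d \<and> (\<forall>k<d. vs ! k \<in> vpart n m (ps ! k)) \<and> p = \<alpha> + \<beta> + sum_list ps}"

lemma hom_puresI:
  "\<lbrakk>u \<in> spart M \<alpha>; w \<in> spart N \<beta>; length vs = d; length ps = d; \<And>k. k < d \<Longrightarrow> vs ! k \<in> vpart n m (ps ! k);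
    p = \<alpha> + \<beta> + sum_list ps\<rbrakk> \<Longrightarrow> (u, w, vs) \<in> hom_pures p"
  unfolding hom_pures_def by blast

definition H :: "bit \<Rightarrow> (('a, 'b) pure \<Rightarrow>\<^sub>0 complex) set" where
  "H p = fs.span (fbasis ` hom_pures p)"

lemma tensor_part_eq: "tensor_part n m d M N p = tclass ` H p"
proof -
  have "fbasis ` hom_pures p = {fbasis (u, w, vs) | u w vs. \<exists>a b ps. u \<in> spart M a \<and> w \<in> spart N b
        \<and> length vs = d \<and> length ps = d \<and> (\<forall>k<d. vs ! k \<in> vpart n m (ps ! k))
        \<and> p = a + b + sum_list ps}"
    unfolding hom_pures_def by blast
  then show ?thesis by (simp add: tensor_part_def H_def)
qed

lemma hom_pures_subset: "hom_pures p \<subseteq> pures"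
proof
  fix g assume "g \<in> hom_pures p"
  then obtain u w vs ps where "g = (u, w, vs)" "length vs = d" "\<forall>k<d. vs ! k \<in> vpart n m (ps ! k)"
    unfolding hom_pures_def by blast
  then show "g \<in> pures"
    by (auto simp: pures_iff vpart_def in_set_conv_nth)
qed

lemma H_C: "H p \<subseteq> C"
  unfolding H_def
proof (intro fs.span_minimal subspace_C image_subsetI)
  show "fbasis g \<in> C" if "g \<in> hom_pures p" for g
    using subsetD[OF hom_pures_subset that] by simp
qed

lemma subspace_H: "fs.subspace (H p)"
  by (simp add: H_def)

text \<open>Homogeneity is demanded only modulo relations, because the chosen projector need not
  preserve the parts \<open>H p\<close>.\<close>

definition graded :: "bit \<Rightarrow> ('a, 'b) pure endo \<Rightarrow> bool" where
  "graded q G \<longleftrightarrow> (\<forall>p. \<forall>f\<in>H p. \<exists>h\<in>H (p + q). app G f - h \<in> null)"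

lemma gradedI:
  assumes "\<And>p g. g \<in> hom_pures p \<Longrightarrow> app G (fbasis g) \<in> H (p + q)"
  shows "graded q G"
proof -
  have "app G f \<in> H (p + q)" if "f \<in> H p" for p f
    using that[unfolded H_def]
  proof (induction rule: fs.span_induct_alt)
    case (step c b v)
    then have "app G b \<in> H (p + q)" using assms by auto
    then show ?case
      using step by (simp add: fs.subspace_add[OF subspace_H] fs.subspace_scale[OF subspace_H])
  qed (simp add: fs.subspace_0[OF subspace_H])
  then show ?thesis
    unfolding graded_def by (metis diff_self fs.subspace_0[OF subspace_null])
qed

lemma graded_add:
  assumes "graded q F" "graded q G"
  shows "graded q (F + G)"
  unfolding graded_def
proof (intro allI ballI)
  fix p f assume "f \<in> H p"
  then obtain h h' where "h \<in> H (p + q)" "app F f - h \<in> null" "h' \<in> H (p + q)" "app G f - h' \<in> null"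
    using assms unfolding graded_def by blast
  then have "h + h' \<in> H (p + q)" "(app F f - h) + (app G f - h') \<in> null"
    by (auto intro: fs.subspace_add[OF subspace_H] fs.subspace_add[OF subspace_null])
  then show "\<exists>h\<in>H (p + q). app (F + G) f - h \<in> null"
    by (intro bexI[of _ "h + h'"]) (simp_all add: algebra_simps)
qed

lemma graded_sc: "graded 0 (sc c)"
  by (rule gradedI) (auto simp: H_def intro: fs.span_scale fs.span_base)

lemma graded_zero: "graded q 0"
  by (rule gradedI) (simp add: fs.subspace_0[OF subspace_H])

lemma graded_sum: "(\<And>s. s \<in> S \<Longrightarrow> graded q (F s)) \<Longrightarrow> graded q (sum F S)"
  by (induction S rule: infinite_finite_induct) (simp_all add: graded_zero graded_add)

text \<open>The error made by \<open>G\<close> is a relation, and it remains one under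
  \<open>F\<close> because \<open>F\<close> descends.\<close>

lemma graded_mult:
  assumes "graded q F" "graded r G" "descends F"
  shows "graded (q + r) (F * G)"
  unfolding graded_def
proof (intro allI ballI)
  fix p f assume "f \<in> H p"
  then obtain h where h: "h \<in> H (p + r)" "app G f - h \<in> null"
    using assms unfolding graded_def by blast
  then obtain h' where h': "h' \<in> H (p + r + q)" "app F h - h' \<in> null"
    using assms unfolding graded_def by blast
  have "app F (app G f - h) + (app F h - h') \<in> null"
    using assms(3) h h' by (intro fs.subspace_add[OF subspace_null]) (auto simp: descends_def simp del: app_linear)
  then have "app (F * G) f - h' \<in> null" by (simp add: algebra_simps)
  moreover have "h' \<in> H (p + (q + r))"
    using h'(1) by (simp only: add.assoc add.commute[of q])
  ultimately show "\<exists>h\<in>H (p + (q + r)). app (F * G) f - h \<in> null"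
    by blast
qed

lemma graded_proj: "graded 0 proj"
  unfolding graded_def using H_C proj_diff by (auto intro!: bexI)

lemma graded_hat: "graded q G \<Longrightarrow> descends G \<Longrightarrow> graded q (hat G)"
  unfolding hat_def
  using graded_mult[OF graded_mult[OF graded_proj _ descends_proj, of q G] graded_proj descends_mult[OF descends_proj]]
  by simp

lemma graded_slot_op:
  assumes x: "x \<in> gl_part n m q" and s: "s \<in> MNV_slots d"
  shows "graded q (slot_op q x s)"
proof (rule gradedI)
  fix p g assume g: "g \<in> hom_pures p"
  then obtain u w vs \<alpha> \<beta> ps where h: "g = (u, w, vs)" "u \<in> spart M \<alpha>" "w \<in> spart N \<beta>"
    "length vs = d" "length ps = d" "\<And>k. k < d \<Longrightarrow> vs ! k \<in> vpart n m (ps ! k)" "p = \<alpha> + \<beta> + sum_list ps"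
    unfolding hom_pures_def by blast
  have kz: "koszul M q u \<in> spart M \<alpha>" "koszul N q w \<in> spart N \<beta>"
    using h(2,3) by (simp_all add: M.koszul_homogeneous N.koszul_homogeneous
        M.subspace_scale[OF M.part_subspace] N.subspace_scale[OF N.part_subspace])
  have act: "sact M x u \<in> spart M (q + \<alpha>)" "sact N x w \<in> spart N (q + \<beta>)"
    using M.act_parity[OF x h(2)] N.act_parity[OF x h(3)] by auto
  have "slot_act n M N q x s g \<in> hom_pures (p + q)"
    using s
  proof (cases rule: slots_cases)
    case 1
    then show ?thesis
      using h act by (simp add: hom_puresI[of _ "q + \<alpha>" _ \<beta> _ ps] ac_simps)
  next
    case 2
    then show ?thesis
      using h act kz by (simp add: hom_puresI[of _ \<alpha> _ "q + \<beta>" _ ps] ac_simps)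
  next
    case (3 k)
    obtain k' where k': "k = Suc k'" "k' < d" using 3(2) by (cases k) auto
    \<comment> \<open>Acting by x shifts only the parity of the k-th copy; the Koszul signs leave
      the other parities unchanged.\<close>
    let ?ps = "ps[k' := ps ! k' + q]"
    have v1: "vkoszul n q v \<in> vpart n m r" if "v \<in> vpart n m r" for v r
      using that by (auto simp: vpart_def vkoszul_def)
    have v2: "x *\<^sub>v v \<in> vpart n m (r + q)" if v: "v \<in> vpart n m r" for v r
    proof -
      have "x $$ (i, j) * v $ j = 0" if "i < K" "j < K" "par i \<noteq> r + q" for i j
      proof (cases "par j = r")
        case True
        then have "par i + par j \<noteq> q" using that(3) by (metis add.commute bit_add_self(2))
        then show ?thesis using x that by (simp add: gl_part_def)
      next
        case False
        then show ?thesis using v that by (simp add: vpart_def)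
      qed
      then show ?thesis
        using v x by (auto simp: vpart_def gl_part_def gl_carrier_def scalar_prod_def intro!: sum.neutral)
    qed
    have "(map (vkoszul n q) (take (k - 1) vs) @ [x *\<^sub>v vs ! (k - 1)] @ drop k vs) ! l \<in> vpart n m (?ps ! l)"
      if "l < d" for l
      using that k' h(4-6) v1 v2 by (auto simp: nth_append nth_list_update not_less dest!: le_neq_implies_less)
    moreover have "sum_list ?ps = sum_list ps + q"
    proof -
      have "sum_list ?ps = (\<Sum>l<d. ps ! l + (if l = k' then q else 0))"
        using h(5) by (simp add: sum_list_nth[of _ "?ps"]) (intro sum.cong refl, auto simp: nth_list_update)
      then show ?thesis using k'(2) h(5) by (simp add: sum.distrib sum_list_nth[of ps ps])
    qed
    ultimately show ?thesis
      using h kz k' 3(1) by (simp add: hom_puresI[of _ \<alpha> _ \<beta> _ ?ps] ac_simps)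
  qed
  then show "app (slot_op q x s) (fbasis g) \<in> H (p + q)"
    by (simp add: slot_op_fbasis H_def fs.span_base)
qed

lemma graded_a: "s \<in> MNV_slots d \<Longrightarrow> graded (par i + par j) (a s i j)" 
  unfolding a_def
  by (intro graded_hat graded_slot_op M.unit_mat_gl_part descends_slot_op M.unit_mat_gl_carrier)

lemma descends_a: "s \<in> MNV_slots d \<Longrightarrow> descends (a s i j)" 
  unfolding a_def by (intro descends_hat descends_slot_op M.unit_mat_gl_carrier)

text \<open>The conditions on a ring element under which it induces an even endomorphism. For an
  even operator supercommutation is plain commutation, and matrix units suffice by linearity
  (\<open>hat_slot_op\<close>).\<close>

definition invariant :: "('a, 'b) pure endo \<Rightarrow> bool" where
  "invariant X \<longleftrightarrow> descends X \<and> graded 0 X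
     \<and> (\<forall>k<K. \<forall>l<K. commute X (slots.act (MNV_slots d) k l))"

lemma invariant_sc: "invariant (sc c)"
  by (simp add: invariant_def descends_sc graded_sc braid.commute_scal)

lemma invariant_add: "invariant X \<Longrightarrow> invariant Y \<Longrightarrow> invariant (X + Y)"
  by (simp add: invariant_def descends_add graded_add commute_add)

lemma invariant_mult: "invariant X \<Longrightarrow> invariant Y \<Longrightarrow> invariant (X * Y)"
  using graded_mult[of 0 X 0 Y] by (simp add: invariant_def descends_mult commute_mult)

lemma invariant_uminus: "invariant X \<Longrightarrow> invariant (- X)"
proof -
  have "- X = sc (- 1) * X" by (rule endo_eqI) simp
  then show "invariant X \<Longrightarrow> invariant (- X)" by (simp only: invariant_mult invariant_sc)
qed

lemma invariant_diff: "invariant X \<Longrightarrow> invariant Y \<Longrightarrow> invariant (X - Y)"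
  using invariant_add[OF _ invariant_uminus] by (metis add_uminus_conv_diff)

lemma invariant_zero: "invariant 0"
proof -
  have "sc 0 = (0 :: ('a, 'b) pure endo)" by (rule endo_eqI) simp
  then show ?thesis using invariant_sc[of 0] by simp
qed

lemma invariant_one: "invariant 1"
  using invariant_sc[of 1] by (simp add: sc_one)

lemma invariant_sum: "(\<And>s. s \<in> S \<Longrightarrow> invariant (F s)) \<Longrightarrow> invariant (sum F S)"
  by (induction S rule: infinite_finite_induct) (simp_all add: invariant_zero invariant_add)

lemma invariant_proj: "invariant proj"
  by (simp add: invariant_def descends_proj graded_proj commute_def slots.e_act)

text \<open>Commutation follows by polarisation: for s \<noteq> t the pairwise term is half of the
  Casimir element of both slots minus those of the single slots, and each of these commutes with the
  full action.\<close>

lemma invariant_cas2: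
  assumes s: "s \<in> MNV_slots d" and t: "t \<in> MNV_slots d"
  shows "invariant (slots.cas2 s t)"
proof -
  have descends: "descends (slots.cas2 s t)"
    unfolding slots.cas2_def sg_eq_sc using s t by (intro descends_sum descends_mult descends_sc descends_a)
  have gr: "graded 0 (sc c * (a s i j * a t j i))" for c i j
  proof -
    have "graded (0 + ((par i + par j) + (par j + par i))) (sc c * (a s i j * a t j i))"
      using s t by (intro graded_mult graded_sc graded_a descends_sc descends_a)
    then show ?thesis by (simp add: add.commute[of "par j"])
  qed
  have graded: "graded 0 (slots.cas2 s t)"
    unfolding slots.cas2_def sg_eq_sc by (intro graded_sum gr)
  have cas: "commute (slots.cas S) (slots.act (MNV_slots d) k l)" if "S \<subseteq> MNV_slots d" "k < K" "l < K" for S k l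
    unfolding commute_def using that by (intro slots.cas_act) auto
  have self: "slots.cas2 r r = slots.cas {r}" for r by (simp add: slots.cas_eq)
  have "commute (slots.cas2 s t) (slots.act (MNV_slots d) k l)" if kl: "k < K" "l < K" for k l
  proof (cases "s = t")
    case True
    then show ?thesis using s kl by (simp add: self cas)
  next
    case False
    have "slots.cas {t, s} = slots.cas {s} + 2 * slots.cas2 s t + slots.cas {t}"
      using slots.cas_insert[of t "{s}"] False s t by (simp add: self)
    then have "slots.cas2 s t = sc (1/2) * (slots.cas {t, s} - slots.cas {s} - slots.cas {t})"
      using braid.half[of "slots.cas2 s t"] by (simp add: algebra_simps)
    then show ?thesis
      using s t kl by (simp only:) (intro commute_intros braid.commute_scal cas; simp)
  qed
  then show ?thesis using descends graded by (simp add: invariant_def)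
qed

lemma invariant_cas: "S \<subseteq> MNV_slots d \<Longrightarrow> invariant (slots.cas S)"
  unfolding slots.cas_eq by (intro invariant_sum invariant_cas2) auto

text \<open>A signed transposition is a pairwise Casimir term and hence invariant; products of
  transpositions give all permutations without any further sign computation.\<close>

lemma invariant_pm:
  assumes "\<pi> permutes {1..d}"
  shows "invariant (pm \<pi>)"
  using assms finite_atLeastAtMost
proof (induction rule: permutes_induct)
  case id
  show ?case unfolding pm_id by (rule invariant_proj)
next
  case (swap k l p)
  have tr: "invariant (pm (Transposition.transpose k l))" if "k \<in> {1..d}" "l \<in> {1..d}" "k < l" for k l
    using that by (subst braid.cas2_transpose[symmetric]) (auto intro: invariant_cas2)
  have "invariant (pm (Transposition.transpose k l))"
    using tr[of k l] tr[of l k] swap by (cases "k < l") (auto simp: transpose_commute)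
  then have "invariant (pm (Transposition.transpose k l) * pm p)"
    using swap by (intro invariant_mult)
  also have "pm (Transposition.transpose k l) * pm p = pm (Transposition.transpose k l \<circ> p)"
    using swap by (intro pm_comp permutes_swap_id)
  finally show ?case .
qed

lemma invariant_gen:
  assumes "g \<in> braid_gens d"
  shows "invariant (braid.gen g)"
proof -
  have sub: "MV_slots i \<subseteq> MNV_slots d" "NV_slots i \<subseteq> MNV_slots d" "MNV_slots i \<subseteq> MNV_slots d"
    if "i \<le> d" for i using slots_mono[OF that] by auto
  have sub1: "i - 1 \<le> d" if "i \<le> d" for i using that by auto
  show ?thesis
  proof (cases g)
    case (GenX i)
    then have "i \<le> d" using assms by (auto simp: braid_gens_def)
    then show ?thesis unfolding GenX braid.gen.simps
      by (intro invariant_mult invariant_sc invariant_diff invariant_cas sub sub1)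
  next
    case (GenY i)
    then have "i \<le> d" using assms by (auto simp: braid_gens_def)
    then show ?thesis unfolding GenY braid.gen.simps
      by (intro invariant_mult invariant_sc invariant_diff invariant_cas sub sub1)
  next
    case (GenZ i)
    then have "i \<le> d" using assms by (auto simp: braid_gens_def)
    then show ?thesis unfolding GenZ braid.gen.simps
      by (split if_split) (intro conjI impI invariant_mult invariant_sc invariant_diff invariant_add
          invariant_proj invariant_cas sub sub1 le0)
  next
    case (GenP \<pi>)
    then show ?thesis using assms invariant_pm by (auto simp: braid_gens_def)
  qed
qed

lemma invariant_Phi:
  assumes "p \<in> carrier (free_alg d)"
  shows "invariant (braid.Phi p)"
proof -
  have list: "invariant (prod_list (map braid.gen w))" if "set w \<subseteq> braid_gens d" for w
    using that by (induction w) (simp_all add: invariant_one invariant_mult invariant_gen)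
  have "set w \<subseteq> braid_gens d" if "w \<in> Poly_Mapping.keys p" for w
    using assms that by (auto simp: free_alg_def)
  then show ?thesis
    unfolding braid.Phi_def by (intro invariant_sum invariant_mult invariant_sc invariant_proj list)
qed

end


section \<open>The homomorphism\<close>

text \<open>Scaling is multiplication by a constant polynomial, so ideals of the free algebra are
  closed under scalars.\<close>

lemma single_Nil_mult: "Poly_Mapping.single [] c * r = fscale c (r :: 'g list \<Rightarrow>\<^sub>0 complex)"
proof -
  have r: "(\<Sum>w\<in>Poly_Mapping.keys r. Poly_Mapping.single w (Poly_Mapping.lookup r w)) = r"
    using flift_fbasis_id[of r] by (simp add: flift_def fscale_fbasis)
  have "fscale c (Poly_Mapping.single w b) = Poly_Mapping.single [] c * Poly_Mapping.single w b" for w :: "'g list" and b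
    by (rule poly_mapping_eqI) (simp add: fscale_lookup lookup_single mult_single plus_list_def when_def)
  then have "fscale c (\<Sum>w\<in>Poly_Mapping.keys r. Poly_Mapping.single w (Poly_Mapping.lookup r w))
      = Poly_Mapping.single [] c * (\<Sum>w\<in>Poly_Mapping.keys r. Poly_Mapping.single w (Poly_Mapping.lookup r w))"
    by (simp only: fs.scale_sum_right sum_distrib_left)
  then show ?thesis by (simp only: r)
qed

context tensor_product
begin

lemma matrix_unit_expansion:
  fixes \<phi> :: "complex mat \<Rightarrow> ('a, 'b) pure endo"
  assumes add: "\<And>x y. x \<in> carrier_mat K K \<Longrightarrow> y \<in> carrier_mat K K \<Longrightarrow> \<phi> (x + y) = \<phi> x + \<phi> y"
    and smult: "\<And>c x. x \<in> carrier_mat K K \<Longrightarrow> \<phi> (c \<cdot>\<^sub>m x) = sc c * \<phi> x"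
    and x: "x \<in> carrier_mat K K"
  shows "\<phi> x = (\<Sum>k<K. \<Sum>l<K. sc (x $$ (k, l)) * \<phi> (unit_mat K k l))"
proof -
  \<comment> \<open>Only the entries with position in \<open>P\<close> are kept; the induction
    restores them one by one.\<close>
  let ?R = "\<lambda>P. mat K K (\<lambda>ij. if ij \<in> P then x $$ ij else 0)"
  have "\<phi> (?R P) = (\<Sum>(k, l)\<in>P. sc (x $$ (k, l)) * \<phi> (unit_mat K k l))"
    if "finite P" "P \<subseteq> {..<K} \<times> {..<K}" for P
    using that
  proof (induction P rule: finite_induct)
    case empty
    have "?R {} = 0 \<cdot>\<^sub>m 0\<^sub>m K K" by (intro eq_matI) auto
    moreover have "sc 0 = (0 :: ('a, 'b) pure endo)" by (rule endo_eqI) simp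
    ultimately show ?case using smult[of "0\<^sub>m K K" 0] by simp
  next
    case (insert t P)
    obtain k l where t: "t = (k, l)" by (cases t)
    have "?R (insert t P) = ?R P + x $$ (k, l) \<cdot>\<^sub>m unit_mat K k l"
      using insert.hyps insert.prems t by (intro eq_matI) (auto simp: unit_mat_def)
    then have "\<phi> (?R (insert t P)) = \<phi> (?R P) + sc (x $$ (k, l)) * \<phi> (unit_mat K k l)"
      by (simp add: add smult)
    then show ?case using insert t by (simp add: add.commute)
  qed
  from this[of "{..<K} \<times> {..<K}"]
  have "\<phi> (?R ({..<K} \<times> {..<K})) = (\<Sum>k<K. \<Sum>l<K. sc (x $$ (k, l)) * \<phi> (unit_mat K k l))"
    by (simp add: sum.cartesian_product)
  moreover have "?R ({..<K} \<times> {..<K}) = x" using x by (intro eq_matI) auto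
  ultimately show ?thesis by simp
qed

text \<open>Before projection this fails: the basis vector of a sum is not the sum of basis vectors.
  It holds modulo the relations, hence after \<open>hat\<close>.\<close>

lemma hat_slot_op_linear:
  assumes x: "x \<in> carrier_mat K K" and y: "y \<in> carrier_mat K K" and s: "s \<in> MNV_slots d"
  shows "hat (slot_op p (x + y) s) = hat (slot_op p x s) + hat (slot_op p y s)"
    and "hat (slot_op p (c \<cdot>\<^sub>m x) s) = sc c * hat (slot_op p x s)"
proof -
  have gl: "z \<in> gl_carrier n m" if "z \<in> carrier_mat K K" for z using that by (simp add: gl_carrier_def)
  have bt: "app (hat (slot_op p z s)) (bt u w is) = app proj (fbasis (slot_act n M N p z s (u, w, units is)))"
    if "z \<in> carrier_mat K K" "is \<in> indices" for z u w "is"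
    using that s by (simp add: hat_bt descends_slot_op gl slot_op_fbasis)
  have eq: "app proj (fbasis (slot_act n M N p (x + y) s (u, w, units is)))
        = app proj (fbasis (slot_act n M N p x s (u, w, units is))) + app proj (fbasis (slot_act n M N p y s (u, w, units is)))
      \<and> app proj (fbasis (slot_act n M N p (c \<cdot>\<^sub>m x) s (u, w, units is)))
        = fscale c (app proj (fbasis (slot_act n M N p x s (u, w, units is))))"
    if "is": "is \<in> indices" for u w "is"
    using s
  proof (cases rule: slots_cases)
    case 1
    show ?thesis unfolding 1 slot_act.simps pv_def[symmetric]
      by (simp add: M.act_add M.act_smult gl x y bt_linear[OF "is"])
  next
    case 2
    show ?thesis unfolding 2 slot_act.simps pv_def[symmetric]
      by (simp add: N.act_add N.act_smult gl x y bt_linear[OF "is"])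
  next
    case (3 k)
    let ?L = "\<lambda>v. map (vkoszul n p) (take (k - 1) (units is)) @ [v] @ drop k (units is)"
    have k: "k - 1 < d" "k \<le> d" using 3 by auto
    have len: "length is = d" using "is" by (rule indices_length)
    \<comment> \<open>Any two such lists differ by an update in one position, which is the shape in
      which multilinearity is available.\<close>
    have upd: "?L v = (?L v')[k - 1 := v]" for v v'
      using k len by (simp add: list_update_append)
    have pure: "(koszul M p u, koszul N p w, ?L v) \<in> pures" if "v \<in> carrier_vec K" for v
    proof -
      obtain k' where k': "k = Suc k'" using 3 by (cases k) auto
      have unit: "x \<in> set (units is) \<Longrightarrow> x \<in> carrier_vec K" for x by auto
      moreover have "x \<in> carrier_vec K \<Longrightarrow> vkoszul n p x \<in> carrier_vec K" for x
        by (simp add: vkoszul_def)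
      ultimately have "set (?L v) \<subseteq> carrier_vec K"
        using that set_take_subset[of "k - 1" "units is"] set_drop_subset[of k "units is"]
        by (simp only: set_append set_map list.set) blast
      moreover have "length (?L v) = d" using k len k' by simp
      ultimately show ?thesis by (simp only: pures_iff)
    qed
    let ?e = "units is ! (k - 1)"
    have e: "?e \<in> carrier_vec K" using k len by simp
    let ?v = "0\<^sub>v K :: complex vec"
    note P = pure[OF zero_carrier_vec]
    have v: "x *\<^sub>v ?e \<in> carrier_vec K" "y *\<^sub>v ?e \<in> carrier_vec K" using x y e by auto
    have 1: "(x + y) *\<^sub>v ?e = x *\<^sub>v ?e + y *\<^sub>v ?e" using x y e by (rule add_mult_distrib_mat_vec)
    have 2: "(c \<cdot>\<^sub>m x) *\<^sub>v ?e = c \<cdot>\<^sub>v (x *\<^sub>v ?e)" using x e by (intro eq_vecI) auto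
    show ?thesis
      unfolding 3(1) slot_act.simps pv_def[symmetric] 1 2
      using pv_add(5)[OF P k(1) v] pv_add(6)[OF P k(1) v(1)] by (simp only: upd[of _ ?v, symmetric])
  qed
  have xy: "x + y \<in> carrier_mat K K" "c \<cdot>\<^sub>m x \<in> carrier_mat K K" using x y by auto
  show "hat (slot_op p (x + y) s) = hat (slot_op p x s) + hat (slot_op p y s)"
    by (rule corner_eqI_bt) (simp_all add: bt xy x y eq distrib_right)
  show "hat (slot_op p (c \<cdot>\<^sub>m x) s) = sc c * hat (slot_op p x s)"
    by (rule corner_eqI_bt) (simp_all add: bt xy x y eq mult.assoc)
qed

text \<open>The Koszul signs depend on the declared parity, which is \<open>p\<close> on the left
  and that of the matrix unit on the right. They agree wherever the entry of x does not
  vanish.\<close>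

lemma hat_slot_op:
  assumes x: "x \<in> gl_part n m p" and s: "s \<in> MNV_slots d"
  shows "hat (slot_op p x s) = (\<Sum>k<K. \<Sum>l<K. sc (x $$ (k, l)) * a s k l)"
proof -
  have xc: "x \<in> carrier_mat K K" using x by (simp add: gl_part_def gl_carrier_def)
  have "hat (slot_op p x s) = (\<Sum>k<K. \<Sum>l<K. sc (x $$ (k, l)) * hat (slot_op p (unit_mat K k l) s))"
    using hat_slot_op_linear[OF _ _ s] xc by (intro matrix_unit_expansion) auto
  also have "\<dots> = (\<Sum>k<K. \<Sum>l<K. sc (x $$ (k, l)) * a s k l)"
  proof (intro sum.cong refl)
    fix k l assume kl: "k \<in> {..<K}" "l \<in> {..<K}"
    have z: "sc 0 * F = 0" for F :: "('a, 'b) pure endo" by (rule endo_eqI) simp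
    show "sc (x $$ (k, l)) * hat (slot_op p (unit_mat K k l) s) = sc (x $$ (k, l)) * a s k l"
      using x kl by (cases "par k + par l = p") (auto simp: a_def gl_part_def z)
  qed
  finally show ?thesis .
qed

section \<open>Induced operators as endomorphisms of the tensor product\<close>

lemma ind_in_tensor_lin:
  assumes "descends G"
  shows "ind G \<in> tensor_lin n m d M N"
proof -
  have "app G f \<in> C" if "f \<in> C" for f using assms that by (simp add: descends_def)
  then show ?thesis
    using assms ind_extensional[of G] fs.subspace_add[OF subspace_C] fs.subspace_scale[OF subspace_C]
    by (auto simp: tensor_lin_def carrier_T PiE_def ind_tclass add_T smult_T)
qed

lemma tensor_act_eq: "tensor_act n m d M N p x = ind (\<Sum>s\<in>MNV_slots d. slot_op p x s)"
  unfolding tensor_act_def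
  by (rule induced_eq_ind) (simp only: slots_act_def slot_op_def app_sum app_efl)

lemma descends_tensor_act:
  assumes "x \<in> gl_part n m p"
  shows "descends (\<Sum>s\<in>MNV_slots d. slot_op p x s)"
  using assms by (intro descends_sum descends_slot_op) (simp_all add: gl_part_def)

lemma ind_invariant:
  assumes X: "invariant X"
  shows "ind X \<in> tensor_hom_part n m d M N 0"
proof -
  have descends: "descends X" and graded: "graded 0 X" using X by (auto simp: invariant_def)
  have "ind X Y \<in> tensor_part n m d M N (p + 0)" if Y: "Y \<in> tensor_part n m d M N p" for p Y
  proof -
    obtain f where f: "f \<in> H p" "Y = tclass f" using Y by (auto simp: tensor_part_eq)
    then obtain h where "h \<in> H (p + 0)" "app X f - h \<in> null" using graded unfolding graded_def by blast
    then show ?thesis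
      using f H_C descends by (auto simp: tensor_part_eq ind_tclass tclass_eq_iff[THEN iffD2] subset_iff)
  qed
  moreover have "ind X (tensor_act n m d M N p x Y) = ksgn (p * 0) \<odot>\<^bsub>T\<^esub> tensor_act n m d M N p x (ind X Y)"
    if x: "x \<in> gl_part n m p" and Y: "Y \<in> carrier T" for p x Y
  proof -
    let ?A = "\<Sum>s\<in>MNV_slots d. slot_op p x s"
    have A: "descends ?A" using x by (rule descends_tensor_act)
    obtain f where f: "f \<in> C" "Y = tclass f" using Y by (auto simp: carrier_T)
    have hatA: "hat ?A = (\<Sum>k<K. \<Sum>l<K. sc (x $$ (k, l)) * slots.act (MNV_slots d) k l)"
    proof -
      have "hat ?A = (\<Sum>s\<in>MNV_slots d. \<Sum>k<K. \<Sum>l<K. sc (x $$ (k, l)) * a s k l)"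
        unfolding hat_sum using x by (intro sum.cong refl hat_slot_op)
      also have "\<dots> = (\<Sum>k<K. \<Sum>s\<in>MNV_slots d. \<Sum>l<K. sc (x $$ (k, l)) * a s k l)"
        by (rule sum.swap)
      also have "\<dots> = (\<Sum>k<K. \<Sum>l<K. \<Sum>s\<in>MNV_slots d. sc (x $$ (k, l)) * a s k l)"
        by (intro sum.cong refl sum.swap)
      finally show ?thesis by (simp add: slots.act_def sum_distrib_left)
    qed
    have comm1: "X * slots.act (MNV_slots d) k l = slots.act (MNV_slots d) k l * X" if "k < K" "l < K" for k l
      using X that by (simp add: invariant_def commute_def)
    have "X * (sc c * slots.act (MNV_slots d) k l) = sc c * slots.act (MNV_slots d) k l * X"
      if "k < K" "l < K" for c k l
    proof -
      have "X * (sc c * slots.act (MNV_slots d) k l) = sc c * (X * slots.act (MNV_slots d) k l)"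
        by (simp only: mult.assoc[symmetric] sc_comm[of c X])
      then show ?thesis by (simp only: comm1[OF that] mult.assoc)
    qed
    then have comm: "X * hat ?A = hat ?A * X"
      unfolding hatA sum_distrib_left sum_distrib_right by (intro sum.cong refl) simp
    \<comment> \<open>The projected action absorbs the projectors around \<open>X\<close>, so
      commutation with \<open>X\<close> itself yields commutation with \<open>hat X\<close>.\<close>
    have "hat X * hat ?A = proj * X * hat ?A" by (simp add: hat_def[of X] mult.assoc)
    also have "\<dots> = hat ?A * X" by (simp add: mult.assoc comm) (simp flip: mult.assoc)
    also have "\<dots> = hat ?A * hat X"
      by (metis (no_types) comm hat_def mult.assoc proj_hat)
    finally have "hat (X * ?A) = hat (?A * X)" by (simp add: hat_mult descends A)
    then have "ind (X * ?A) = ind (?A * X)" by (intro ind_eqI descends_mult descends A)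
    then have "tclass (app X (app ?A f)) = tclass (app ?A (app X f))"
      using ind_tclass[OF descends_mult[OF descends A] f(1)] ind_tclass[OF descends_mult[OF A descends] f(1)] by simp
    moreover have "app X f \<in> C" "app ?A f \<in> C" using descends A f by (auto simp only: descends_def)
    ultimately show ?thesis
      using f by (simp add: tensor_act_eq ind_tclass descends A smult_T del: app_sum)
  qed
  ultimately show ?thesis
    using ind_in_tensor_lin[OF descends] by (simp add: tensor_hom_part_def)
qed

text \<open>Members of \<open>tensor_End\<close> are sums of an even and an odd homomorphism; zero
  is the odd part of the operators considered here.\<close>

lemma ind_zero_odd: "ind 0 \<in> tensor_hom_part n m d M N 1"
proof -
  have z: "ind 0 Y = tclass 0" if "Y \<in> carrier T" for Y
    using that by (auto simp: carrier_T ind_tclass descends_zero)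
  have act: "tensor_act n m d M N p x Y \<in> carrier T" if "x \<in> gl_part n m p" "Y \<in> carrier T" for p x Y
    using ind_in_tensor_lin[OF descends_tensor_act[OF that(1)]] that(2)
    by (auto simp: tensor_act_eq tensor_lin_def)
  have act0: "tensor_act n m d M N p x (tclass 0) = tclass 0" if "x \<in> gl_part n m p" for p x
    unfolding tensor_act_eq
    by (subst ind_tclass[OF descends_tensor_act[OF that]]) (simp_all add: fs.subspace_0[OF subspace_C])
  have part: "Y \<in> carrier T" if "Y \<in> tensor_part n m d M N p" for Y p
    using that H_C by (auto simp: tensor_part_eq carrier_T)
  show ?thesis
    using ind_in_tensor_lin[OF descends_zero]
    by (auto simp: tensor_hom_part_def z act act0 smult_T part)
      (auto simp: tensor_part_eq fs.subspace_0[OF subspace_H])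
qed

abbreviation "E \<equiv> tensor_End n m d M N"

section \<open>Algebra operations on induced operators\<close>

lemma ind_add: "descends F \<Longrightarrow> descends G \<Longrightarrow> ind F \<oplus>\<^bsub>E\<^esub> ind G = ind (F + G)"
  by (rule T_ext[OF _ ind_extensional]) (auto simp: tensor_End_def carrier_T ind_tclass descends_add add_T ind_extensional)

lemma ind_smult: "descends G \<Longrightarrow> c \<odot>\<^bsub>E\<^esub> ind G = ind (sc c * G)"
  by (rule T_ext[OF _ ind_extensional]) (auto simp: tensor_End_def carrier_T ind_tclass descends_mult descends_sc smult_T ind_extensional)

lemma ind_mult: "descends F \<Longrightarrow> descends G \<Longrightarrow> ind F \<otimes>\<^bsub>E\<^esub> ind G = ind (F * G)"
  by (rule T_ext[OF _ ind_extensional]) (auto simp: tensor_End_def carrier_T ind_tclass descends_mult ind_extensional compose_def descends_def)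

text \<open>The projector moves vectors of \<open>C\<close> only by relations, so on the quotient it
  is the identity.\<close>

lemma ind_one: "\<one>\<^bsub>E\<^esub> = ind proj"
proof (rule T_ext)
  fix f assume "f \<in> C"
  then show "\<one>\<^bsub>E\<^esub> (tclass f) = ind proj (tclass f)"
    using proj_diff[of f] fs.subspace_neg[OF subspace_null, of "app proj f - f"]
    by (auto simp: tensor_End_def carrier_T ind_tclass descends_proj tclass_eq_iff)
qed (simp_all add: ind_extensional tensor_End_def)

lemma ind_zero: "\<zero>\<^bsub>E\<^esub> = ind 0"
  by (rule T_ext[OF _ ind_extensional]) (auto simp: tensor_End_def carrier_T ind_tclass descends_zero zero_T ind_extensional)

lemma ind_carrier:
  assumes "invariant X"
  shows "ind X \<in> carrier E"
proof -
  have descends: "descends X" using assms by (simp add: invariant_def)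
  have "ind X = (\<lambda>Y\<in>carrier T. ind X Y \<oplus>\<^bsub>T\<^esub> ind 0 Y)"
    by (rule T_ext[OF ind_extensional]) (auto simp: carrier_T ind_tclass descends descends_zero add_T ind_extensional)
  then show ?thesis
    unfolding tensor_End_def using ind_invariant[OF assms] ind_zero_odd by auto
qed

text \<open>A description of arbitrary members of \<open>E\<close>, not only induced ones, as needed
  for the uniqueness of negatives.\<close>

lemma carrier_E_tclass:
  assumes "Z \<in> carrier E"
  shows "Z \<in> extensional (carrier T)" "f \<in> C \<Longrightarrow> \<exists>g\<in>C. Z (tclass f) = tclass g"
proof -
  obtain F0 F1 where Z: "Z = (\<lambda>X\<in>carrier T. F0 X \<oplus>\<^bsub>T\<^esub> F1 X)"
    and F: "F0 \<in> tensor_lin n m d M N" "F1 \<in> tensor_lin n m d M N"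
    using assms by (auto simp: tensor_End_def tensor_hom_part_def)
  show "Z \<in> extensional (carrier T)" by (simp add: Z)
  assume f: "f \<in> C"
  then have "tclass f \<in> carrier T" by (simp add: carrier_T)
  moreover have "F0 \<in> carrier T \<rightarrow>\<^sub>E carrier T" "F1 \<in> carrier T \<rightarrow>\<^sub>E carrier T"
    using F by (simp_all add: tensor_lin_def)
  ultimately have "F0 (tclass f) \<in> carrier T" "F1 (tclass f) \<in> carrier T"
    by (blast dest: PiE_mem)+
  then obtain g0 g1 where "g0 \<in> C" "g1 \<in> C" "F0 (tclass f) = tclass g0" "F1 (tclass f) = tclass g1"
    by (auto simp: carrier_T)
  then show "\<exists>g\<in>C. Z (tclass f) = tclass g"
    using f by (intro bexI[of _ "g0 + g1"]) (auto simp: Z carrier_T add_T fs.subspace_add[OF subspace_C])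
qed

text \<open>In \<open>E\<close>, subtraction rests on a definite description of the negative.
  Uniqueness is therefore checked pointwise against every member of the carrier.\<close>

lemma ind_minus:
  assumes "invariant F" "invariant G"
  shows "ind F \<ominus>\<^bsub>E\<^esub> ind G = ind (F - G)"
proof -
  have descends: "descends F" "descends G" "descends (- G)"
    using assms invariant_uminus[OF assms(2)] by (auto simp: invariant_def)
  have "\<ominus>\<^bsub>E\<^esub> ind G = ind (- G)"
    unfolding a_inv_def m_inv_def
  proof (rule the_equality, goal_cases)
    case 1
    show ?case
      using ind_carrier[OF invariant_uminus[OF assms(2)]] ind_add[OF descends(2,3)] ind_add[OF descends(3,2)]
      by (simp add: ind_zero)
  next
    case (2 Z)
    then have Z: "Z \<in> carrier E" and sum: "ind G \<oplus>\<^bsub>E\<^esub> Z = ind 0" by (auto simp: ind_zero)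
    show ?case
    proof (rule T_ext[OF carrier_E_tclass(1)[OF Z] ind_extensional])
      fix f assume f: "f \<in> C"
      obtain g where g: "g \<in> C" "Z (tclass f) = tclass g" using carrier_E_tclass(2)[OF Z f] by blast
      have "(ind G \<oplus>\<^bsub>E\<^esub> Z) (tclass f) = ind G (tclass f) \<oplus>\<^bsub>T\<^esub> Z (tclass f)"
        using f by (simp add: tensor_End_def carrier_T)
      then have "tclass (app G f + g) = tclass 0"
        using f g by (simp add: sum ind_tclass descends descends_zero add_T)
      then show "Z (tclass f) = ind (- G) (tclass f)"
        using f g by (simp add: ind_tclass descends tclass_eq_iff add.commute)
    qed
  qed
  then show ?thesis by (simp add: a_minus_def ind_add descends)
qed

section \<open>Passage to the quotient by the defining relations\<close>

lemma braid_class_mem: "q \<in> braid_class d p \<longleftrightarrow> (\<exists>h\<in>braid_ideal d. q = h + p)"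
  by (simp add: braid_class_def a_r_coset_def' free_alg_def)

lemma free_alg_closed:
  assumes "p \<in> carrier (free_alg d)" "q \<in> carrier (free_alg d)"
  shows "p + q \<in> carrier (free_alg d)" "p * q \<in> carrier (free_alg d)" "fscale c p \<in> carrier (free_alg d)"
    "- p \<in> carrier (free_alg d)"
  using assms keys_fscale[of c p]
  by (auto simp: free_alg_def keys_add_sub(1) keys_mult_lists simp del: in_lists_conv_set)

lemma braid_ideal_is_ideal:
  assumes "d \<ge> 1"
  shows "ideal (braid_ideal d) (free_alg d)"
  unfolding braid_ideal_def using assms braid_rel_carrier free_alg_ring[of d]
  by (intro ring.genideal_ideal) auto

text \<open>The kernel of \<open>Phi\<close> is an ideal that contains the defining differences by
  \<open>Phi_rel\<close>, so it contains the ideal they generate.\<close>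

lemma Phi_braid_ideal:
  assumes "d \<ge> 1" "h \<in> braid_ideal d"
  shows "braid.Phi h = 0"
proof -
  let ?I = "{p \<in> carrier (free_alg d). braid.Phi p = 0}"
  have "ideal ?I (free_alg d)"
  proof (rule idealI[OF free_alg_ring])
    show "subgroup ?I (add_monoid (free_alg d))"
    proof (rule group.subgroupI)
      show "group (add_monoid (free_alg d))"
        by (rule abelian_group.a_group) (rule ring.is_abelian_group[OF free_alg_ring])
      show "?I \<noteq> {}" using braid.Phi_zero by (auto simp: free_alg_def intro!: exI[of _ 0])
      fix p assume p: "p \<in> ?I"
      interpret R: ring "free_alg d" by (rule free_alg_ring)
      have "inv\<^bsub>add_monoid (free_alg d)\<^esub> p = - p"
        using p free_alg_closed[of p p] R.minus_equality[of "- p" p]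
        by (simp add: a_inv_def) (simp add: free_alg_def)
      then show "inv\<^bsub>add_monoid (free_alg d)\<^esub> p \<in> ?I"
        using p free_alg_closed[of p p] braid.Phi_diff[of 0 p] by (simp add: braid.Phi_zero)
    qed (auto simp: braid.Phi_add free_alg_closed free_alg_def[THEN arg_cong[where f = add]])
  qed (auto simp: braid.Phi_mult free_alg_closed free_alg_def[THEN arg_cong[where f = mult]])
  moreover have "{a - b |a b. braid_rel d a b} \<subseteq> ?I"
    using braid_rel_carrier assms(1) braid.Phi_rel by (auto simp: braid.Phi_diff)
  ultimately have "braid_ideal d \<subseteq> ?I"
    unfolding braid_ideal_def by (rule ring.genideal_minimal[OF free_alg_ring])
  then show ?thesis using assms(2) by auto
qed

text \<open>The choice of representative does not matter, since \<open>Phi\<close> vanishes on the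
  ideal; see \<open>rho_braid_class\<close>.\<close>

definition rho :: "braid_poly set \<Rightarrow> (('a, 'b) pure \<Rightarrow>\<^sub>0 complex) set \<Rightarrow> (('a, 'b) pure \<Rightarrow>\<^sub>0 complex) set" where
  "rho X = ind (braid.Phi (SOME p. p \<in> X))"

lemma rho_braid_class:
  assumes "d \<ge> 1"
  shows "rho (braid_class d p) = ind (braid.Phi p)"
proof -
  interpret I: ideal "braid_ideal d" "free_alg d" using assms by (rule braid_ideal_is_ideal)
  have "0 \<in> braid_ideal d" using additive_subgroup.zero_closed[OF I.additive_subgroup_axioms] by (simp add: free_alg_def)
  then have "p \<in> braid_class d p" unfolding braid_class_mem by force
  then have "(SOME q. q \<in> braid_class d p) \<in> braid_class d p" by (rule someI)
  then obtain h where "h \<in> braid_ideal d" "(SOME q. q \<in> braid_class d p) = h + p"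
    unfolding braid_class_mem by blast
  then show ?thesis by (simp add: rho_def braid.Phi_add Phi_braid_ideal[OF assms])
qed

lemma rho_alg_hom:
  assumes "d \<ge> 1"
  shows "rho \<in> alg_hom (braid_alg d) E"
proof -
  interpret I: ideal "braid_ideal d" "free_alg d" using assms by (rule braid_ideal_is_ideal)
  have carrier: "\<exists>p\<in>carrier (free_alg d). X = braid_class d p" if "X \<in> carrier (braid_alg d)" for X
    using that by (auto simp: braid_alg_simps A_RCOSETS_def' braid_class_def)
  have fa: "p \<otimes>\<^bsub>free_alg d\<^esub> q = p * q" "p \<oplus>\<^bsub>free_alg d\<^esub> q = p + q" for p q
    by (simp_all add: free_alg_def)
  have mult: "braid_class d p \<otimes>\<^bsub>braid_alg d\<^esub> braid_class d q = braid_class d (p * q)"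
    if "p \<in> carrier (free_alg d)" "q \<in> carrier (free_alg d)" for p q
    using I.rcoset_mult_add[OF that] by (simp add: braid_alg_simps braid_class_def fa)
  have add: "braid_class d p \<oplus>\<^bsub>braid_alg d\<^esub> braid_class d q = braid_class d (p + q)"
    if "p \<in> carrier (free_alg d)" "q \<in> carrier (free_alg d)" for p q
    using I.a_rcos_sum[OF that]
    by (simp add: braid_alg_def FactRing_def ring.defs module.defs braid_class_def fa)
  have descends: "descends (braid.Phi p)" if "p \<in> carrier (free_alg d)" for p
    using invariant_Phi[OF that] by (simp add: invariant_def)
  have smult: "c \<odot>\<^bsub>braid_alg d\<^esub> braid_class d p = braid_class d (fscale c p)"
    if p: "p \<in> carrier (free_alg d)" for c p
  proof -
    have "braid_class d (fscale c q) = braid_class d (fscale c p)" if q: "q \<in> braid_class d p" for q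
    proof -
      obtain h where h: "h \<in> braid_ideal d" "q = h + p" using q unfolding braid_class_mem by blast
      \<comment> \<open>The constant polynomial c, which turns closure of the ideal under left
        multiplication into closure under scaling.\<close>
      define e where "e = (Poly_Mapping.single [] c :: braid_poly)"
      have e: "e \<in> carrier (free_alg d)" by (auto simp: e_def free_alg_def)
      have ch: "fscale c h \<in> braid_ideal d"
      proof -
        have "e * r = fscale c r" for r
          unfolding e_def by (rule single_Nil_mult)
        then show ?thesis using I.I_l_closed[OF h(1) e] by (simp add: fa)
      qed
      then have "fscale c q \<in> braid_class d (fscale c p)"
        using h(2) unfolding braid_class_mem by (auto simp: fs.scale_right_distrib)
      then show ?thesis
        using I.a_repr_independence[OF _ free_alg_closed(3)[OF p p] additive_subgroup.a_subgroup[OF I.additive_subgroup_axioms]]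
        by (simp add: braid_class_def)
    qed
    moreover have "p \<in> braid_class d p"
      using additive_subgroup.zero_closed[OF I.additive_subgroup_axioms] unfolding braid_class_mem by (force simp: free_alg_def)
    ultimately show ?thesis unfolding braid_alg_simps by blast
  qed
  note rho = rho_braid_class[OF assms]
  have "rho \<in> Ring.ring_hom (braid_alg d) E"
  proof (rule ring_hom_memI)
    fix X assume "X \<in> carrier (braid_alg d)"
    then obtain p where p: "p \<in> carrier (free_alg d)" "X = braid_class d p" using carrier by blast
    then show "rho X \<in> carrier E" by (simp add: rho ind_carrier invariant_Phi)
    fix Y assume "Y \<in> carrier (braid_alg d)"
    then obtain q where q: "q \<in> carrier (free_alg d)" "Y = braid_class d q" using carrier by blast
    show "rho (X \<otimes>\<^bsub>braid_alg d\<^esub> Y) = rho X \<otimes>\<^bsub>E\<^esub> rho Y"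
      using p q by (simp add: mult rho ind_mult descends braid.Phi_mult)
    show "rho (X \<oplus>\<^bsub>braid_alg d\<^esub> Y) = rho X \<oplus>\<^bsub>E\<^esub> rho Y"
      using p q by (simp add: add rho ind_add descends braid.Phi_add)
  next
    show "rho \<one>\<^bsub>braid_alg d\<^esub> = \<one>\<^bsub>E\<^esub>"
      by (simp add: braid_alg_simps rho braid.Phi_one ind_one)
  qed
  moreover have "rho (c \<odot>\<^bsub>braid_alg d\<^esub> X) = c \<odot>\<^bsub>E\<^esub> rho X" if "X \<in> carrier (braid_alg d)" for c X
    using carrier[OF that] by (auto simp: smult rho ind_smult descends braid.Phi_fscale)
  ultimately show ?thesis by (simp add: alg_hom_def)
qed

end

theorem theorem1p1:
  fixes n m d :: nat
    and M :: "'a::ab_group_add gl_smod" and N :: "'b::ab_group_add gl_smod"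
  assumes "d \<ge> 1"
    and "category_O n m M"
    and "category_O n m N"
  shows "let E = tensor_End n m d M N; \<kappa> = casimir n m d M N in
    \<exists>\<rho> \<in> alg_hom (braid_alg d) E.
      (\<forall>i\<in>{1..<d}. \<rho> (braid_class d (tg i)) = signed_swap n m d M N i)
    \<and> (\<forall>i\<in>{1..d}. \<rho> (braid_class d (xg i))
         = (1 / 2) \<odot>\<^bsub>E\<^esub> (\<kappa> (MV_slots i) \<ominus>\<^bsub>E\<^esub> \<kappa> (MV_slots (i - 1))))
    \<and> (\<forall>i\<in>{1..d}. \<rho> (braid_class d (yg i))
         = (1 / 2) \<odot>\<^bsub>E\<^esub> (\<kappa> (NV_slots i) \<ominus>\<^bsub>E\<^esub> \<kappa> (NV_slots (i - 1))))
    \<and> (\<forall>i\<in>{1..d}. \<rho> (braid_class d (zg i))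
         = (1 / 2) \<odot>\<^bsub>E\<^esub> ((\<kappa> (MNV_slots i) \<ominus>\<^bsub>E\<^esub> \<kappa> (MNV_slots (i - 1)))
             \<oplus>\<^bsub>E\<^esub> kappa_V n m \<odot>\<^bsub>E\<^esub> \<one>\<^bsub>E\<^esub>))
    \<and> \<rho> (braid_class d (zg 0))
         = (1 / 2) \<odot>\<^bsub>E\<^esub> ((\<kappa> (MNV_slots 0) \<ominus>\<^bsub>E\<^esub> \<kappa> (MV_slots 0)) \<ominus>\<^bsub>E\<^esub> \<kappa> (NV_slots 0))"
proof -
  interpret tensor_product n m M N d
    using assms by (intro tensor_product.intro) (simp_all add: category_O_def)
  have sub: "MV_slots i \<subseteq> MNV_slots d" "NV_slots i \<subseteq> MNV_slots d" "MNV_slots i \<subseteq> MNV_slots d"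
    if "i \<le> d" for i using slots_mono[OF that] by auto
  have inv: "invariant (slots.cas (MV_slots i))" "invariant (slots.cas (NV_slots i))"
    "invariant (slots.cas (MNV_slots i))" if "i \<le> d" for i
    using sub[OF that] by (simp_all add: invariant_cas)
  have descends: "descends X" if "invariant X" for X using that by (simp add: invariant_def)
  note simps = casimir_eq sub inv descends ind_minus ind_smult ind_add ind_one invariant_diff invariant_add
    invariant_mult invariant_sc invariant_proj
  show ?thesis
    unfolding Let_def
  proof (rule bexI[OF _ rho_alg_hom[OF assms(1)]], intro conjI ballI)
    fix i assume "i \<in> {1..<d}"
    then show "rho (braid_class d (tg i)) = signed_swap n m d M N i"
      by (simp only: rho_braid_class[OF assms(1)] braid.Phi_generators signed_swap_eq)
  next
    fix i assume "i \<in> {1..d}"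
    \<comment> \<open>The last fact selects the branch of \<open>gen\<close> for z_i with positive
      index; the bounds place both levels inside the full set of slots.\<close>
    then have i: "i \<le> d" "i - 1 \<le> d" "i \<noteq> 0" by auto
    show "rho (braid_class d (xg i))
        = (1 / 2) \<odot>\<^bsub>E\<^esub> (casimir n m d M N (MV_slots i) \<ominus>\<^bsub>E\<^esub> casimir n m d M N (MV_slots (i - 1)))"
      unfolding rho_braid_class[OF assms(1)] braid.Phi_generators braid.gen.simps using i by (simp add: simps)
    show "rho (braid_class d (yg i))
        = (1 / 2) \<odot>\<^bsub>E\<^esub> (casimir n m d M N (NV_slots i) \<ominus>\<^bsub>E\<^esub> casimir n m d M N (NV_slots (i - 1)))"
      unfolding rho_braid_class[OF assms(1)] braid.Phi_generators braid.gen.simps using i by (simp add: simps)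
    show "rho (braid_class d (zg i))
        = (1 / 2) \<odot>\<^bsub>E\<^esub> ((casimir n m d M N (MNV_slots i) \<ominus>\<^bsub>E\<^esub> casimir n m d M N (MNV_slots (i - 1)))
             \<oplus>\<^bsub>E\<^esub> kappa_V n m \<odot>\<^bsub>E\<^esub> \<one>\<^bsub>E\<^esub>)"
      unfolding rho_braid_class[OF assms(1)] braid.Phi_generators braid.gen.simps using i by (simp add: simps)
  next
    show "rho (braid_class d (zg 0))
        = (1 / 2) \<odot>\<^bsub>E\<^esub> ((casimir n m d M N (MNV_slots 0) \<ominus>\<^bsub>E\<^esub> casimir n m d M N (MV_slots 0))
          \<ominus>\<^bsub>E\<^esub> casimir n m d M N (NV_slots 0))"
      unfolding rho_braid_class[OF assms(1)] braid.Phi_generators braid.gen.simps by (simp add: simps)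
  qed
qed

end
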